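(* There is a universal constant $c>0$ such that the following holds. Let $0<\varepsilon<1$, $0<\delta<1/5$, $2\le s\le2^{d+1}$, let $\Lambda=\Lambda^{\mathrm{HC}}_{d,s}$ be the hyperbolic cross, and let $\{\phi_{\boldsymbol i}\}_{\boldsymbol i\in\mathbb N_0^d}$ be the tensor Legendre or tensor Chebyshev polynomial basis. Put $\rho=\frac{4\delta}{1-\delta}$ and $\tau=\frac{\sqrt{1+\delta}}{1-\delta}$. Draw $\boldsymbol t_1,\dots,\boldsymbol t_m$ independently according to the corresponding measure $\nu$, with $$m\ \ge\ c\,s^\gamma L(s,n,\delta,\varepsilon).$$ Then, with probability at least $1-\varepsilon$, the following holds. For every $f\in L^2_\nu(D)\cap L^\infty(D)$ with coefficient sequence $\boldsymbol x$, every $\boldsymbol e\in\mathbb C^m$ and data $\boldsymbol y=\boldsymbol A\boldsymbol x_\Lambda+\boldsymbol e$, the approximation $\tilde f=\sum_{\boldsymbol i\in\Lambda}\hat x_{\boldsymbol i}\phi_{\boldsymbol i}$ computed from a minimizer (weighted square-root LASSO) $$\hat{\boldsymbol x}_\Lambda\in\arg\min_{\boldsymbol z\in\mathbb C^n}\|\boldsymbol z\|_{1,\boldsymbol u}+\lambda\|\boldsymbol A\boldsymbol z-\boldsymbol y\|_2$$ with tuning parameter $$\lambda=\theta\sqrt{K(s)},\qquad\theta\ge\frac{(5+\rho)\tau}{(1+\rho)(2+\rho)},$$ satisfies $$\|f-\tilde f\|_{L^\infty}\le C_1\,\sigma_{s,L}(\boldsymbol x)_{1,\boldsymbol u}+C_2\,s^{\gamma/2}\|\boldsymbol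 e\|_2,$$ $$\|f-\tilde f\|_{L^2_\nu}\le C_3\,\frac{\sigma_{s,L}(\boldsymbol x)_{1,\boldsymbol u}}{s^{\gamma/2}}+C_4\|\boldsymbol e\|_2+\|f-f_\Lambda\|_{L^2_\nu},$$ where $$C_1=\frac{3+\rho}{1-\rho},\quad C_2=\frac{(1+\rho)\theta+2\tau}{1-\rho},\quad C_3=\frac{4(1+\rho)(2+\rho)}{1-\rho},\quad C_4=\frac{(1+\rho)(2+\rho)\theta+(5+\rho)\tau}{1-\rho}.$$
   Context: Setting. $d\in\mathbb N$, $D=(-1,1)^d$, $\mathbb N_0=\{0,1,2,\dots\}$. The measure $\nu$ on $D$ is the tensor uniform probability measure $d\nu=2^{-d}d\boldsymbol t$ (Legendre case) or the tensor Chebyshev measure $d\nu=\prod_{\ell=1}^d\frac{1}{\pi\sqrt{1-t_\ell^2}}d\boldsymbol t$ (Chebyshev case). $\{\phi_{\boldsymbol i}\}_{\boldsymbol i\in\mathbb N_0^d}$ is the tensor product of the corresponding univariate orthonormal polynomials; it is an orthonormal basis of $L^2_\nu(D)$. For $f\in L^2_\nu(D)\cap L^\infty(D)$ (complex valued), $\boldsymbol x=(x_{\boldsymbol i})_{\boldsymbol i\in\mathbb N_0^d}$ with $x_{\boldsymbol i}=\langle f,\phi_{\boldsymbol i}\rangle_{L^2_\nu}$, so $f=\sum_{\boldsymbol i}x_{\boldsymbol i}\phi_{\boldsymbol i}$. Weights: $u_{\boldsymbol i}=\|\phi_{\boldsymbol i}\|_{L^\infty}$, i.e. $u_{\boldsymbol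 i}=\prod_{\ell=1}^d\sqrt{2i_\ell+1}$ (Legendre) and $u_{\boldsymbol i}=2^{\|\boldsymbol i\|_0/2}$ (Chebyshev, $\|\boldsymbol i\|_0$ the number of nonzero entries). $\|\boldsymbol z\|_{1,\boldsymbol u}=\sum_{\boldsymbol i}u_{\boldsymbol i}|z_{\boldsymbol i}|$. For $S\subseteq\mathbb N_0^d$, $|S|_{\boldsymbol u}=\sum_{\boldsymbol i\in S}u_{\boldsymbol i}^2$. A set $S\subseteq\mathbb N_0^d$ is lower if $\boldsymbol i\in S$ and $\boldsymbol j\le\boldsymbol i$ componentwise imply $\boldsymbol j\in S$. $\sigma_{s,L}(\boldsymbol z)_{1,\boldsymbol u}=\inf\{\|\boldsymbol z-\boldsymbol z'\|_{1,\boldsymbol u}:|\mathrm{supp}(\boldsymbol z')|\le s,\ \mathrm{supp}(\boldsymbol z')\text{ lower}\}$ (possibly $+\infty$). $K(s)=\max\{|S|_{\boldsymbol u}:S\subseteq\mathbb N_0^d\text{ lower},\ |S|\le s\}$. $\gamma=2$ (Legendre), $\gamma=\ln 3/\ln 2$ (Chebyshev). Hyperbolic cross: $\Lambda^{\mathrm{HC}}_{d,s}=\{\boldsymbol i\in\mathbb N_0^d:\prod_{\ell=1}^d(i_\ell+1)\le s\}$, $n=|\Lambda|$, with a fixed enumeration $\boldsymbol i_1,\dots,\boldsymbol i_n$ of $\Lambda$. Vectors in $\mathbb C^n$ are indexed by $\Lambda$ and identified with sequences on $\mathbb N_0^d$ vanishing off $\Lambda$. $\boldsymbol x_\Lambda=(x_{\boldsymbol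 i})_{\boldsymbol i\in\Lambda}$ and $f_\Lambda=\sum_{\boldsymbol i\in\Lambda}x_{\boldsymbol i}\phi_{\boldsymbol i}$. Design matrix: $\boldsymbol A\in\mathbb C^{m\times n}$, $A_{ij}=\frac1{\sqrt m}\phi_{\boldsymbol i_j}(\boldsymbol t_i)$. The data are $\boldsymbol y=\boldsymbol A\boldsymbol x_\Lambda+\boldsymbol e$, where the unknown error $\boldsymbol e$ contains the truncation error $\frac{1}{\sqrt m}(f(\boldsymbol t_i)-f_\Lambda(\boldsymbol t_i))_{i}$ and possibly any further error. Polylogarithmic factor: $$L(s,n,\delta,\varepsilon)=\frac1{\delta^2}\ln\Big(\frac{K(s)}{\delta^2}\Big)\max\Big\{\frac1{\delta^4}\ln\Big(\frac{K(s)}{\delta^2}\ln\Big(\frac{K(s)}{\delta^2}\Big)\Big)\ln(n),\ \frac1\delta\ln\Big(\frac1{\delta\varepsilon}\ln\Big(\frac{K(s)}{\delta^2}\Big)\Big)\Big\}.$$ *)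

theory Defs
  imports "HOL-Probability.Probability" "HOL-Computational_Algebra.Polynomial"
begin

text \<open>
  Points of \<open>\<real>\<^sup>d\<close> are functions \<open>nat \<Rightarrow> real\<close> of which the arguments \<open>l < d\<close> matter
  (the carrier is a product space over \<open>{..<d}\<close>), so that \<open>d\<close> is an ordinary natural number and
  a constant can be chosen independently of it.
\<close>

datatype poly_family = Legendre | Chebyshev

fun uni_measure :: "poly_family \<Rightarrow> real measure" where
  "uni_measure Legendre = density (restrict_space lborel {-1<..<1}) (\<lambda>_. ennreal (1 / 2))"
| "uni_measure Chebyshev =
     density (restrict_space lborel {-1<..<1}) (\<lambda>x. ennreal (1 / (pi * sqrt (1 - x\<^sup>2))))"

text \<open>The space of this measure is the cube \<open>{..<d} \<rightarrow>\<^sub>E {-1<..<1}\<close>.\<close>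

definition cube_measure :: "poly_family \<Rightarrow> nat \<Rightarrow> (nat \<Rightarrow> real) measure" where
  "cube_measure F d = (\<Pi>\<^sub>M l\<in>{..<d}. uni_measure F)"

fun growth_exponent :: "poly_family \<Rightarrow> real" where
  "growth_exponent Legendre = 2"
| "growth_exponent Chebyshev = ln 3 / ln 2"


text \<open>
  The orthonormal polynomials of a measure on the line, with the sign fixed by a positive leading
  coefficient; unique, and existing for both measures above by Gram-Schmidt.
\<close>

definition orthonormal_poly :: "real measure \<Rightarrow> nat \<Rightarrow> real poly" where
  "orthonormal_poly M k = (THE p. degree p = k \<and> lead_coeff p > 0 \<and>
      (LINT x|M. poly p x * poly p x) = 1 \<and>
      (\<forall>q. degree q < k \<longrightarrow> (LINT x|M. poly p x * poly q x) = 0))"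

definition tensor_poly :: "poly_family \<Rightarrow> nat \<Rightarrow> (nat \<Rightarrow> nat) \<Rightarrow> (nat \<Rightarrow> real) \<Rightarrow> complex" where
  "tensor_poly F d i x =
     (\<Prod>l<d. complex_of_real (poly (orthonormal_poly (uni_measure F) (i l)) (x l)))"


definition L2_space :: "'a measure \<Rightarrow> ('a \<Rightarrow> complex) set" where
  "L2_space M = {f \<in> borel_measurable M. integrable M (\<lambda>x. (cmod (f x))\<^sup>2)}"

definition L2_norm :: "'a measure \<Rightarrow> ('a \<Rightarrow> complex) \<Rightarrow> real" where
  "L2_norm M f = sqrt (LINT x|M. (cmod (f x))\<^sup>2)"

definition L2_inner :: "'a measure \<Rightarrow> ('a \<Rightarrow> complex) \<Rightarrow> ('a \<Rightarrow> complex) \<Rightarrow> complex" where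
  "L2_inner M f g = (LINT x|M. f x * cnj (g x))"

definition Linf_norm :: "'a measure \<Rightarrow> ('a \<Rightarrow> complex) \<Rightarrow> ennreal" where
  "Linf_norm M f = esssup M (\<lambda>x. ennreal (cmod (f x)))"

definition Linf_space :: "'a measure \<Rightarrow> ('a \<Rightarrow> complex) set" where
  "Linf_space M = {f \<in> borel_measurable M. Linf_norm M f < \<infinity>}"


text \<open>
  Multi-indices vanish beyond \<open>d\<close>, so the componentwise order is the pointwise order on
  functions.
\<close>

definition multi_indices :: "nat \<Rightarrow> (nat \<Rightarrow> nat) set" where
  "multi_indices d = {i. \<forall>l\<ge>d. i l = 0}"

definition lower_set :: "(nat \<Rightarrow> nat) set \<Rightarrow> bool" where
  "lower_set S \<longleftrightarrow> (\<forall>i\<in>S. \<forall>j\<le>i. j \<in> S)"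

definition hyperbolic_cross :: "nat \<Rightarrow> nat \<Rightarrow> (nat \<Rightarrow> nat) set" where
  "hyperbolic_cross d s = {i \<in> multi_indices d. (\<Prod>l<d. i l + 1) \<le> s}"

definition weight :: "poly_family \<Rightarrow> nat \<Rightarrow> (nat \<Rightarrow> nat) \<Rightarrow> real" where
  "weight F d i = enn2real (Linf_norm (cube_measure F d) (tensor_poly F d i))"

definition weighted_card :: "poly_family \<Rightarrow> nat \<Rightarrow> (nat \<Rightarrow> nat) set \<Rightarrow> real" where
  "weighted_card F d S = (\<Sum>i\<in>S. (weight F d i)\<^sup>2)"

definition weighted_l1_norm :: "poly_family \<Rightarrow> nat \<Rightarrow> ((nat \<Rightarrow> nat) \<Rightarrow> complex) \<Rightarrow> ennreal" where
  "weighted_l1_norm F d z = (\<Sum>\<^sub>\<infinity>i\<in>multi_indices d. ennreal (weight F d i * cmod (z i)))"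

text \<open>
  The maximum exists: a lower set with at most \<open>s\<close> elements is contained in the finite set
  \<open>hyperbolic_cross d s\<close>.
\<close>

definition max_lower_card :: "poly_family \<Rightarrow> nat \<Rightarrow> nat \<Rightarrow> real" where
  "max_lower_card F d s = Max (weighted_card F d `
     {S. S \<subseteq> multi_indices d \<and> lower_set S \<and> finite S \<and> card S \<le> s})"

definition lower_approx_error ::
    "poly_family \<Rightarrow> nat \<Rightarrow> nat \<Rightarrow> ((nat \<Rightarrow> nat) \<Rightarrow> complex) \<Rightarrow> ennreal" where
  "lower_approx_error F d s z =
     (INF z' \<in> {z'. {i. z' i \<noteq> 0} \<subseteq> multi_indices d \<and> finite {i. z' i \<noteq> 0} \<and>
                     card {i. z' i \<noteq> 0} \<le> s \<and> lower_set {i. z' i \<noteq> 0}}.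
        weighted_l1_norm F d (\<lambda>i. z i - z' i))"

definition coeffs_of ::
    "poly_family \<Rightarrow> nat \<Rightarrow> ((nat \<Rightarrow> real) \<Rightarrow> complex) \<Rightarrow> (nat \<Rightarrow> nat) \<Rightarrow> complex" where
  "coeffs_of F d f i = L2_inner (cube_measure F d) f (tensor_poly F d i)"

definition expansion :: "poly_family \<Rightarrow> nat \<Rightarrow> (nat \<Rightarrow> nat) set \<Rightarrow> ((nat \<Rightarrow> nat) \<Rightarrow> complex) \<Rightarrow>
    (nat \<Rightarrow> real) \<Rightarrow> complex" where
  "expansion F d I z x = (\<Sum>i\<in>I. z i * tensor_poly F d i x)"


text \<open>
  Vectors in \<open>\<complex>\<^sup>n\<close>, \<open>n = card I\<close>, are indexed by the multi-indices in \<open>I\<close> themselves and vanish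
  off \<open>I\<close>; the columns of the design matrix are indexed in the same way.  Rows and data vectors
  are indexed by \<open>k < m\<close>.
\<close>

definition vectors_on :: "(nat \<Rightarrow> nat) set \<Rightarrow> ((nat \<Rightarrow> nat) \<Rightarrow> complex) set" where
  "vectors_on I = {z. \<forall>i. i \<notin> I \<longrightarrow> z i = 0}"

definition design_matrix :: "poly_family \<Rightarrow> nat \<Rightarrow> nat \<Rightarrow> (nat \<Rightarrow> nat \<Rightarrow> real) \<Rightarrow>
    nat \<Rightarrow> (nat \<Rightarrow> nat) \<Rightarrow> complex" where
  "design_matrix F d m t k i = complex_of_real (1 / sqrt (real m)) * tensor_poly F d i (t k)"

definition mat_vec :: "(nat \<Rightarrow> (nat \<Rightarrow> nat) \<Rightarrow> complex) \<Rightarrow> (nat \<Rightarrow> nat) set \<Rightarrow>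
    ((nat \<Rightarrow> nat) \<Rightarrow> complex) \<Rightarrow> nat \<Rightarrow> complex" where
  "mat_vec A I z k = (\<Sum>i\<in>I. A k i * z i)"

definition l2_norm :: "nat \<Rightarrow> (nat \<Rightarrow> complex) \<Rightarrow> real" where
  "l2_norm m v = L2_set (\<lambda>k. cmod (v k)) {..<m}"

definition sr_lasso_objective :: "poly_family \<Rightarrow> nat \<Rightarrow> nat \<Rightarrow> (nat \<Rightarrow> nat) set \<Rightarrow>
    (nat \<Rightarrow> (nat \<Rightarrow> nat) \<Rightarrow> complex) \<Rightarrow> (nat \<Rightarrow> complex) \<Rightarrow> real \<Rightarrow>
    ((nat \<Rightarrow> nat) \<Rightarrow> complex) \<Rightarrow> real" where
  "sr_lasso_objective F d m I A y lam z =
     (\<Sum>i\<in>I. weight F d i * cmod (z i)) + lam * l2_norm m (\<lambda>k. mat_vec A I z k - y k)"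

definition sr_lasso_minimizer :: "poly_family \<Rightarrow> nat \<Rightarrow> nat \<Rightarrow> (nat \<Rightarrow> nat) set \<Rightarrow>
    (nat \<Rightarrow> (nat \<Rightarrow> nat) \<Rightarrow> complex) \<Rightarrow> (nat \<Rightarrow> complex) \<Rightarrow> real \<Rightarrow>
    ((nat \<Rightarrow> nat) \<Rightarrow> complex) \<Rightarrow> bool" where
  "sr_lasso_minimizer F d m I A y lam z \<longleftrightarrow>
     is_arg_min (sr_lasso_objective F d m I A y lam) (\<lambda>z. z \<in> vectors_on I) z"

definition polylog_factor :: "poly_family \<Rightarrow> nat \<Rightarrow> nat \<Rightarrow> nat \<Rightarrow> real \<Rightarrow> real \<Rightarrow> real" where
  "polylog_factor F d s n \<delta> \<epsilon> =
     (let q = max_lower_card F d s / \<delta>\<^sup>2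
      in 1 / \<delta>\<^sup>2 * ln q *
         max (1 / \<delta>^4 * ln (q * ln q) * ln (real n))
             (1 / \<delta> * ln (1 / (\<delta> * \<epsilon>) * ln q)))"

end

theory Submission
  imports Defs
begin

text \<open>
  Let \<open>K\<close> be the maximal weighted cardinality of a lower set with at most \<open>s\<close> elements.  The whole
  randomness of the problem is condensed into one property of the design matrix \<open>A\<close>, a lower
  isometry: with probability at least \<open>1 - \<epsilon>\<close>, all vectors \<open>z\<close> on the hyperbolic cross satisfy
  \<open>\<parallel>z\<parallel>\<^sub>2\<^sup>2 \<le> (1 + \<delta>) \<parallel>A z\<parallel>\<^sub>2\<^sup>2 + (\<delta>\<^sup>2 / K) \<parallel>z\<parallel>\<^sup>2\<close>, where the last norm is the weighted \<open>\<ell>\<^sup>1\<close> norm.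

  This suffices for recovery (\<open>sr_lasso_recovery\<close>).  On a lower set \<open>S\<close> with at most \<open>s\<close> elements the
  weighted \<open>\<ell>\<^sup>1\<close> norm is at most \<open>sqrt K\<close> times the \<open>\<ell>\<^sup>2\<close> norm.  Hence the isometry bounds the
  \<open>\<ell>\<^sup>2\<close> norm on \<open>S\<close> by the weighted \<open>\<ell>\<^sup>1\<close> norm off \<open>S\<close> and by \<open>\<parallel>A z\<parallel>\<^sub>2\<close>; this is the robust null
  space property with the constants \<open>\<delta> / (1 - \<delta>) \<le> \<rho>\<close> and \<open>\<tau>\<close>.  Comparing the objective at the
  minimizer and at the true coefficients yields the two error bounds.

  The isometry is one-sided, and for this reason it has an elementary proof
  (\<open>convex_hull_lower_isometry\<close>).  A combination of the basis with weighted \<open>\<ell>\<^sup>1\<close> norm 1 is a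
  point \<open>f\<close> of the convex hull of the functions \<open>\<plusminus> \<phi>\<^sub>i / u\<^sub>i\<close>, which are bounded by 1.  Its mean
  square is a sum over the level sets of \<open>|f|\<close> at geometrically decreasing heights \<open>v\<close>.  At height
  \<open>v\<close>, replace \<open>f\<close> by an average of about \<open>\<delta>\<^sup>-\<^sup>2 v\<^sup>-\<^sup>2\<close> of these functions (up to a logarithm).
  Maurey's empirical method finds an average that is close to \<open>f\<close> at most points, both for the
  measure and for the samples.  There are only finitely many such averages, so a Chernoff bound for
  the lower tail of the number of samples in a level set and a union bound control all \<open>f\<close> at once.
  The logarithm of the number of averages and the admissible error of the level set probabilities
  scale alike in \<open>v\<close>, so no chaining over the levels is needed.  Besides \<open>ln n\<close>, from the number of
  functions, one logarithm comes from the accuracy of the averages and one from the number of levels.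

  Three facts about the basis complete the picture.  The weights are products of univariate
  sup norms, which are attained at the endpoint 1 (\<open>weight_sq\<close>).  Slicing a lower set along its
  coordinates shows \<open>K \<le> s\<^sup>\<gamma>\<close>, and intervals and discrete cubes show \<open>s\<^sup>\<gamma> \<le> 3 K\<close>
  (\<open>max_lower_card_le_powr\<close>, \<open>max_lower_card_ge_powr\<close>).  Completeness of the tensor polynomials
  bounds the sup norm of a function by the weighted \<open>\<ell>\<^sup>1\<close> norm of its coefficients
  (\<open>AE_bounded_by_coeffs\<close>).
\<close>

section \<open>Orthonormal polynomials on the interval\<close>

lemma sets_uni_measure: "sets (uni_measure F) = sets (restrict_space borel {-1<..<1})"
  by (cases F) (auto simp: sets_restrict_space)

lemma space_uni_measure: "space (uni_measure F) = {-1<..<1}"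
  by (cases F) (auto simp: space_restrict_space)

definition uni_density :: "poly_family \<Rightarrow> real \<Rightarrow> real" where
  "uni_density F x = (case F of Legendre \<Rightarrow> 1 / 2 | Chebyshev \<Rightarrow> 1 / (pi * sqrt (1 - x\<^sup>2)))"

lemma uni_measure_eq:
  "uni_measure F = density (restrict_space lborel {-1<..<1}) (\<lambda>x. ennreal (uni_density F x))"
  by (cases F) (simp_all add: uni_density_def)

lemma uni_density_pos: "x \<in> {-1<..<1} \<Longrightarrow> 0 < uni_density F x"
  by (cases F) (auto simp: uni_density_def abs_square_less_1)

lemma measurable_uni_density [measurable]: "uni_density F \<in> borel_measurable borel"
  by (cases F) (simp_all add: uni_density_def[abs_def])

lemma borel_measurable_uni_measure:
  "f \<in> borel_measurable borel \<Longrightarrow> f \<in> borel_measurable (uni_measure F)"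
  by (simp add: uni_measure_eq measurable_restrict_space1)

lemma integral_uni_measure:
  fixes f :: "real \<Rightarrow> real"
  assumes [measurable]: "f \<in> borel_measurable borel"
  shows "(LINT x|uni_measure F. f x) = (LINT x|lborel. indicator {-1<..<1} x * (uni_density F x * f x))"
proof -
  have "(LINT x|uni_measure F. f x) = (LINT x|restrict_space lborel {-1<..<1}. uni_density F x *\<^sub>R f x)"
    unfolding uni_measure_eq
    by (rule integral_density)
       (auto intro!: measurable_restrict_space1 AE_restrict_space_iff[THEN iffD2] AE_I2 less_imp_le[OF uni_density_pos])
  also have "\<dots> = (LINT x|lborel. indicator {-1<..<1} x *\<^sub>R (uni_density F x *\<^sub>R f x))"
    by (rule integral_restrict_space) auto
  finally show ?thesis by simp
qed

lemma AE_uni_measure_iff: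
  "(AE x in uni_measure F. Q x) \<longleftrightarrow> (AE x in lborel. x \<in> {-1<..<1} \<longrightarrow> Q x)"
proof -
  have "(AE x in uni_measure F. Q x) \<longleftrightarrow> (AE x in restrict_space lborel {-1<..<1}. 0 < ennreal (uni_density F x) \<longrightarrow> Q x)"
    unfolding uni_measure_eq by (rule AE_density) (auto intro!: measurable_restrict_space1)
  also have "\<dots> \<longleftrightarrow> (AE x in lborel. x \<in> {-1<..<1} \<longrightarrow> (0 < ennreal (uni_density F x) \<longrightarrow> Q x))"
    by (rule AE_restrict_space_iff) auto
  also have "\<dots> \<longleftrightarrow> (AE x in lborel. x \<in> {-1<..<1} \<longrightarrow> Q x)"
    using uni_density_pos by (intro AE_cong) auto
  finally show ?thesis .
qed

lemma prob_space_uni_Legendre: "prob_space (uni_measure Legendre)"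
proof
  have "emeasure (uni_measure Legendre) (space (uni_measure Legendre))
     = (\<integral>\<^sup>+x. ennreal (1/2) * indicator {-1<..<1::real} x \<partial>restrict_space lborel {-1<..<1})"
    unfolding space_uni_measure
    by (subst uni_measure.simps, subst emeasure_density) (auto simp: sets_restrict_space)
  also have "\<dots> = (\<integral>\<^sup>+x. ennreal (1/2) * indicator {-1<..<1::real} x \<partial>lborel)"
    by (subst nn_integral_restrict_space) (auto intro!: nn_integral_cong simp: indicator_def)
  also have "\<dots> = ennreal (1/2) * 2"
    by (subst nn_integral_cmult_indicator) auto
  also have "\<dots> = 1"
    using ennreal_mult[of "1 / 2" 2] by simp
  finally show "emeasure (uni_measure Legendre) (space (uni_measure Legendre)) = 1" .
qed

lemma nn_integral_arcsine_density:
  "(\<integral>\<^sup>+x. ennreal (1 / sqrt (1 - x\<^sup>2)) * indicator {-1<..<1::real} x \<partial>lborel) = ennreal pi"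
  and arcsine_integrable: "set_integrable lborel {-1<..<1} (\<lambda>x::real. 1 / sqrt (1 - x\<^sup>2))"
proof -
  have lim: "((arcsin \<circ> real_of_ereal) \<longlongrightarrow> arcsin (- 1)) (at_right (- 1 :: ereal))"
            "((arcsin \<circ> real_of_ereal) \<longlongrightarrow> arcsin 1) (at_left (1 :: ereal))"
  proof -
    have c: "continuous_on {-1..1} arcsin" by (rule continuous_on_arcsin')
    have "(arcsin \<longlongrightarrow> arcsin (- 1)) (at_right (- 1))"
      by (rule continuous_on_Icc_at_rightD[OF c]) simp
    then show "((arcsin \<circ> real_of_ereal) \<longlongrightarrow> arcsin (- 1)) (at_right (- 1 :: ereal))"
      by (metis ereal_tendsto_simps1(2) ereal_minus(1) one_ereal_def uminus_ereal.simps(1))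
    have "(arcsin \<longlongrightarrow> arcsin 1) (at_left 1)"
      by (rule continuous_on_Icc_at_leftD[OF c]) simp
    then show "((arcsin \<circ> real_of_ereal) \<longlongrightarrow> arcsin 1) (at_left (1 :: ereal))"
      by (metis ereal_tendsto_simps1(1) one_ereal_def)
  qed
  have e: "einterval (- 1) 1 = {-1<..<1::real}"
    using einterval_eq(1)[of "- 1" 1] by (simp add: one_ereal_def)
  have pos: "0 < 1 - x\<^sup>2" if "- 1 < ereal x" "ereal x < 1" for x
    using that by (simp add: one_ereal_def abs_square_less_1 abs_less_iff)
  have der: "DERIV arcsin x :> 1 / sqrt (1 - x\<^sup>2)" if "- 1 < ereal x" "ereal x < 1" for x
    using that by (auto intro!: derivative_eq_intros simp: one_ereal_def divide_inverse)
  have cont: "isCont (\<lambda>x. 1 / sqrt (1 - x\<^sup>2)) x" if "- 1 < ereal x" "ereal x < 1" for x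
    using pos[OF that] by (intro continuous_intros) auto
  have nn: "AE x in lborel. - 1 < ereal x \<longrightarrow> ereal x < 1 \<longrightarrow> 0 \<le> 1 / sqrt (1 - x\<^sup>2)"
    using pos by (auto intro!: AE_I2 simp: less_imp_le)
  have lt: "- 1 < (1 :: ereal)" by (simp add: one_ereal_def)
  have FTC: "set_integrable lborel (einterval (- 1) 1) (\<lambda>x. 1 / sqrt (1 - x\<^sup>2))"
    "(LBINT x=- 1..1. 1 / sqrt (1 - x\<^sup>2)) = arcsin 1 - arcsin (- 1)"
    using interval_integral_FTC_nonneg[of "- 1" 1 arcsin "\<lambda>x. 1 / sqrt (1 - x\<^sup>2)", OF lt der cont nn lim]
    by simp_all
  show int: "set_integrable lborel {-1<..<1} (\<lambda>x::real. 1 / sqrt (1 - x\<^sup>2))"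
    using FTC(1) by (simp only: e)
  have "(\<integral>\<^sup>+x. ennreal (1 / sqrt (1 - x\<^sup>2)) * indicator {-1<..<1::real} x \<partial>lborel)
     = (\<integral>\<^sup>+x. ennreal (indicator {-1<..<1} x *\<^sub>R (1 / sqrt (1 - x\<^sup>2))) \<partial>lborel)"
    by (intro nn_integral_cong) (auto simp: indicator_def)
  also have "\<dots> = ennreal (LBINT x:{-1<..<1}. 1 / sqrt (1 - x\<^sup>2))"
    unfolding set_lebesgue_integral_def
  proof (rule nn_integral_eq_integral)
    have "0 \<le> 1 - x\<^sup>2" if "- 1 < x" "x < 1" for x :: real
      using that abs_square_le_1[of x] by auto
    then show "AE x in lborel. 0 \<le> indicator {-1<..<1} x *\<^sub>R (1 / sqrt (1 - x\<^sup>2))"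
      by (intro AE_I2) (auto simp: indicator_def)
  qed (use int in \<open>simp add: set_integrable_def\<close>)
  also have "(LBINT x:{-1<..<1}. 1 / sqrt (1 - x\<^sup>2)) = pi"
    using FTC(2) less_imp_le[OF lt] by (simp add: interval_lebesgue_integral_def e)
  finally show "(\<integral>\<^sup>+x. ennreal (1 / sqrt (1 - x\<^sup>2)) * indicator {-1<..<1::real} x \<partial>lborel) = ennreal pi" .
qed

lemma prob_space_uni_Chebyshev: "prob_space (uni_measure Chebyshev)"
proof
  have split: "ennreal (1 / (pi * sqrt (1 - x\<^sup>2))) = ennreal (1 / pi) * ennreal (1 / sqrt (1 - x\<^sup>2))"
    if "- 1 < x" "x < 1" for x :: real
  proof -
    have "x\<^sup>2 \<le> 1" using that by (simp add: abs_square_le_1 abs_le_iff)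
    then show ?thesis by (subst ennreal_mult[symmetric]) auto
  qed
  have "emeasure (uni_measure Chebyshev) (space (uni_measure Chebyshev))
     = (\<integral>\<^sup>+x. ennreal (uni_density Chebyshev x) * indicator {-1<..<1::real} x \<partial>restrict_space lborel {-1<..<1})"
    unfolding space_uni_measure uni_measure_eq
    by (subst emeasure_density) (auto simp: sets_restrict_space intro!: measurable_restrict_space1)
  also have "\<dots> = (\<integral>\<^sup>+x. ennreal (1 / pi) * (ennreal (1 / sqrt (1 - x\<^sup>2)) * indicator {-1<..<1::real} x) \<partial>lborel)"
    by (subst nn_integral_restrict_space)
       (auto intro!: nn_integral_cong simp: indicator_def uni_density_def split)
  also have "\<dots> = ennreal (1 / pi) * ennreal pi"
    by (subst nn_integral_cmult) (auto simp: nn_integral_arcsine_density)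
  also have "\<dots> = 1" by (simp flip: ennreal_mult)
  finally show "emeasure (uni_measure Chebyshev) (space (uni_measure Chebyshev)) = 1" .
qed

lemma prob_space_uni_measure: "prob_space (uni_measure F)"
  by (cases F) (simp_all only: prob_space_uni_Legendre prob_space_uni_Chebyshev)

lemma bounded_integrable_uni_measure:
  fixes f :: "real \<Rightarrow> real"
  assumes "f \<in> borel_measurable borel" "\<And>x. x \<in> {-1<..<1} \<Longrightarrow> \<bar>f x\<bar> \<le> B"
  shows "integrable (uni_measure F) f"
proof -
  interpret prob_space "uni_measure F" by (rule prob_space_uni_measure)
  show ?thesis
    by (rule integrable_const_bound[where B = B])
       (use assms in \<open>auto simp: space_uni_measure intro!: AE_I2 borel_measurable_uni_measure\<close>)
qed

lemma measurable_poly [measurable]: "poly p \<in> borel_measurable (borel :: real measure)"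
  by (intro borel_measurable_continuous_onI) (intro continuous_intros)

lemma poly_integrable: "integrable (uni_measure F) (\<lambda>x. poly p x)"
proof -
  have "compact (poly p ` {-1..1::real})" by (intro compact_continuous_image continuous_intros) auto
  then obtain B where "\<And>x. x \<in> {-1..1} \<Longrightarrow> \<bar>poly p x\<bar> \<le> B"
    using compact_imp_bounded bounded_real by (metis image_eqI)
  then show ?thesis by (intro bounded_integrable_uni_measure[where B = B]) auto
qed

text \<open>
  Working with the mean as a linear functional on polynomials keeps the following arguments
  algebraic: every polynomial is integrable, so linearity holds without side conditions.
\<close>

definition poly_mean :: "poly_family \<Rightarrow> real poly \<Rightarrow> real" where
  "poly_mean F p = (LINT x|uni_measure F. poly p x)"

lemma poly_mean_add: "poly_mean F (p + q) = poly_mean F p + poly_mean F q"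
  by (simp add: poly_mean_def poly_integrable)

lemma poly_mean_diff: "poly_mean F (p - q) = poly_mean F p - poly_mean F q"
  by (simp add: poly_mean_def poly_integrable)

lemma poly_mean_smult: "poly_mean F (smult c p) = c * poly_mean F p"
  by (simp add: poly_mean_def)

lemma poly_mean_mult: "poly_mean F (p * q) = (LINT x|uni_measure F. poly p x * poly q x)"
  unfolding poly_mean_def by (rule Bochner_Integration.integral_cong) simp_all

lemma poly_mean_0 [simp]: "poly_mean F 0 = 0"
  by (simp add: poly_mean_def)

lemma poly_mean_sum: "poly_mean F (sum p A) = (\<Sum>i\<in>A. poly_mean F (p i))"
  by (induction A rule: infinite_finite_induct) (simp_all add: poly_mean_add)

lemma poly_mean_1 [simp]: "poly_mean F 1 = 1"
proof -
  interpret prob_space "uni_measure F" by (rule prob_space_uni_measure)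
  show ?thesis by (simp add: poly_mean_def prob_space)
qed

lemma poly_mean_square_nonneg: "0 \<le> poly_mean F (p * p)"
  unfolding poly_mean_def by (rule Bochner_Integration.integral_nonneg) simp

text \<open>
  The measure has a positive density, so a polynomial vanishing almost everywhere on the
  interval has infinitely many roots.
\<close>

lemma poly_mean_square_eq_0:
  assumes "poly_mean F (p * p) = 0"
  shows "p = 0"
proof (rule ccontr)
  assume p: "p \<noteq> 0"
  have "AE x in uni_measure F. poly (p * p) x = 0"
    using assms integral_nonneg_eq_0_iff_AE[OF poly_integrable[of F "p * p"]]
    by (simp add: poly_mean_def)
  then have "AE x in lborel. x \<in> {-1<..<1} \<longrightarrow> poly p x = 0"
    by (simp add: AE_uni_measure_iff)
  moreover have "AE x in lborel. x \<notin> {x. poly p x = 0}"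
    by (rule AE_not_in) (use poly_roots_finite[OF p] in \<open>auto intro: finite_imp_null_set_lborel\<close>)
  ultimately have "AE x in lborel. x \<notin> {-1<..<1::real}" by eventually_elim auto
  then have "emeasure lborel {-1<..<1::real} = 0"
    by (subst (asm) AE_iff_measurable[where N = "{-1<..<1::real}"]) auto
  then show False by simp
qed

definition is_orthonormal_poly :: "poly_family \<Rightarrow> nat \<Rightarrow> real poly \<Rightarrow> bool" where
  "is_orthonormal_poly F k p \<longleftrightarrow> degree p = k \<and> lead_coeff p > 0 \<and> poly_mean F (p * p) = 1 \<and>
      (\<forall>q. degree q < k \<longrightarrow> poly_mean F (p * q) = 0)"

text \<open>
  Polynomials with degrees \<open>0, \<dots>, k - 1\<close> span those of degree less than \<open>k\<close>; the leading term is
  removed one degree at a time.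
\<close>

lemma orthogonal_to_lower_degree:
  assumes deg: "\<And>j. j < k \<Longrightarrow> degree (b j) = j \<and> b j \<noteq> 0"
    and orth: "\<And>j. j < k \<Longrightarrow> poly_mean F (p * b j) = 0"
    and "degree q < k"
  shows "poly_mean F (p * q) = 0"
  using \<open>degree q < k\<close>
proof (induction "degree q" arbitrary: q rule: less_induct)
  case less
  define j where "j = degree q"
  define c where "c = lead_coeff q / lead_coeff (b j)"
  define r where "r = q - smult c (b j)"
  have j: "j < k" using less.prems by (simp add: j_def)
  have b: "degree (b j) = j" "coeff (b j) j \<noteq> 0"
    using deg[OF j] leading_coeff_neq_0[of "b j"] by auto
  have "degree r \<le> j" unfolding r_def by (intro degree_diff_le) (auto simp: j_def[symmetric] b)
  moreover have "coeff r j = 0" using b by (simp add: r_def c_def j_def[symmetric])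
  ultimately have "r = 0 \<or> degree r < j" by (rule eq_zero_or_degree_less)
  then have "poly_mean F (p * r) = 0"
    using less.hyps[of r] j by (auto simp: j_def[symmetric])
  moreover have "p * q = p * r + smult c (p * b j)" by (simp add: r_def algebra_simps)
  ultimately show ?case using orth[OF j] by (simp add: poly_mean_add poly_mean_smult)
qed

text \<open>
  Two candidates differ by a constant factor: cancelling the leading coefficients leaves a
  polynomial of lower degree, to which both are orthogonal, hence with mean square zero.  The
  normalisation then makes the positive factor equal to 1.
\<close>

lemma is_orthonormal_poly_unique:
  assumes "is_orthonormal_poly F k p" "is_orthonormal_poly F k p'"
  shows "p = p'"
proof -
  note d = assms[unfolded is_orthonormal_poly_def]
  define c where "c = lead_coeff p / lead_coeff p'"
  have c: "0 < c" unfolding c_def using d by (intro divide_pos_pos) auto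
  define r where "r = p - smult c p'"
  have "degree r \<le> k" unfolding r_def using d by (intro degree_diff_le) auto
  moreover have "coeff r k = 0"
  proof -
    have "lead_coeff p = coeff p k" "lead_coeff p' = coeff p' k" "coeff p' k > 0" using d by auto
    then show ?thesis by (simp add: r_def c_def)
  qed
  ultimately have "r = 0 \<or> degree r < k" by (rule eq_zero_or_degree_less)
  then have pr: "poly_mean F (p * r) = 0" "poly_mean F (p' * r) = 0" using d by auto
  have "r * r = (p - smult c p') * r" by (simp only: r_def)
  also have "\<dots> = p * r - smult c (p' * r)" by (simp only: left_diff_distrib mult_smult_left)
  finally have "r * r = p * r - smult c (p' * r)" .
  then have "poly_mean F (r * r) = 0" using pr by (simp add: poly_mean_diff poly_mean_smult)
  then have r0: "p = smult c p'" using poly_mean_square_eq_0[of F r] by (simp add: r_def)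
  have "1 = poly_mean F (p * p)" using d by simp
  also have "p * p = smult (c * c) (p' * p')" by (simp add: r0)
  also have "poly_mean F \<dots> = c * c" using d by (simp add: poly_mean_smult)
  finally have "c = 1" using c by (metis abs_of_pos abs_square_eq_1 power2_eq_square)
  then show ?thesis using r0 by simp
qed

abbreviation onp :: "poly_family \<Rightarrow> nat \<Rightarrow> real poly" where
  "onp F k \<equiv> orthonormal_poly (uni_measure F) k"

lemma orthonormal_poly_eqI: "is_orthonormal_poly F k p \<Longrightarrow> onp F k = p"
proof -
  have eq: "orthonormal_poly (uni_measure F) k = (THE p. is_orthonormal_poly F k p)"
    unfolding orthonormal_poly_def is_orthonormal_poly_def poly_mean_mult by (rule refl)
  show "is_orthonormal_poly F k p \<Longrightarrow> onp F k = p"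
    unfolding eq by (rule the_equality) (auto intro: is_orthonormal_poly_unique)
qed

text \<open>
  Gram-Schmidt, subtracting from \<open>x\<^sup>k\<close> its projection on the lower orthonormal polynomials.
\<close>

lemma is_orthonormal_poly_exists: "\<exists>p. is_orthonormal_poly F k p"
proof (induction k rule: less_induct)
  case (less k)
  define b where "b = onp F"
  have b: "is_orthonormal_poly F j (b j)" if "j < k" for j
    using less[OF that] orthonormal_poly_eqI unfolding b_def by blast
  note bd = b[unfolded is_orthonormal_poly_def]
  have bb: "poly_mean F (b i * b j) = of_bool (i = j)" if "i < k" "j < k" for i j
  proof (cases i j rule: linorder_cases)
    case less
    then have "poly_mean F (b j * b i) = 0" using bd[OF that(1)] bd[OF that(2)] by simp
    then show ?thesis using less by (simp add: mult.commute)
  next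
    case greater
    then have "poly_mean F (b i * b j) = 0" using bd[OF that(1)] bd[OF that(2)] by simp
    then show ?thesis using greater by simp
  qed (use bd[OF that(1)] in simp)
  define q where "q = monom 1 k - (\<Sum>j<k. smult (poly_mean F (monom 1 k * b j)) (b j))"
  have deg_sum: "degree (\<Sum>j<k. smult (poly_mean F (monom 1 k * b j)) (b j)) < k \<or>
      (\<Sum>j<k. smult (poly_mean F (monom 1 k * b j)) (b j)) = 0"
  proof (cases "k = 0")
    case False
    then show ?thesis using bd by (intro disjI1 degree_sum_less) (auto intro: le_less_trans[OF degree_smult_le])
  qed simp
  have ck: "coeff q k = 1"
    using deg_sum by (auto simp: q_def coeff_eq_0)
  have "degree q \<le> k"
    unfolding q_def using deg_sum by (intro degree_diff_le) (auto simp: degree_monom_le)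
  then have dq: "degree q = k" using ck le_degree[of q k] by auto
  have q0: "q \<noteq> 0" using ck by auto
  have "poly_mean F (q * q) \<noteq> 0" using q0 poly_mean_square_eq_0 by blast
  then have S: "0 < poly_mean F (q * q)" using poly_mean_square_nonneg[of F q] by simp
  have orth: "poly_mean F (q * b i) = 0" if i: "i < k" for i
  proof -
    have "q * b i = monom 1 k * b i - (\<Sum>j<k. smult (poly_mean F (monom 1 k * b j)) (b j * b i))"
      by (simp add: q_def left_diff_distrib sum_distrib_right)
    then have "poly_mean F (q * b i) = poly_mean F (monom 1 k * b i)
       - (\<Sum>j<k. poly_mean F (monom 1 k * b j) * poly_mean F (b j * b i))"
      by (simp add: poly_mean_diff poly_mean_sum poly_mean_smult)
    also have "(\<Sum>j<k. poly_mean F (monom 1 k * b j) * poly_mean F (b j * b i))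
       = (\<Sum>j<k. if j = i then poly_mean F (monom 1 k * b j) else 0)"
      using bb i by (intro sum.cong) auto
    finally show ?thesis using i by simp
  qed
  have orth': "poly_mean F (q * r) = 0" if "degree r < k" for r
  proof (rule orthogonal_to_lower_degree[of k b])
    show "degree (b j) = j \<and> b j \<noteq> 0" if "j < k" for j using bd[OF that] by auto
  qed (use orth that in auto)
  define p where "p = smult (1 / sqrt (poly_mean F (q * q))) q"
  have "is_orthonormal_poly F k p"
    unfolding is_orthonormal_poly_def
  proof (intro conjI allI impI)
    show "degree p = k" using S dq by (simp add: p_def)
    show "0 < lead_coeff p" using S dq ck by (simp add: p_def)
    show "poly_mean F (p * p) = 1" using S by (simp add: p_def poly_mean_smult)
    show "poly_mean F (p * r) = 0" if "degree r < k" for r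
      using orth'[OF that] by (simp add: p_def poly_mean_smult)
  qed
  then show ?case by blast
qed

lemma is_orthonormal_poly_onp: "is_orthonormal_poly F k (onp F k)"
  using is_orthonormal_poly_exists[of F k] orthonormal_poly_eqI by blast

lemma degree_onp: "degree (onp F k) = k"
  using is_orthonormal_poly_onp[of F k] by (simp add: is_orthonormal_poly_def)

lemma poly_mean_onp_lower: "degree q < k \<Longrightarrow> poly_mean F (onp F k * q) = 0"
  using is_orthonormal_poly_onp[of F k] by (simp add: is_orthonormal_poly_def)

lemma poly_mean_onp_square: "poly_mean F (onp F k * onp F k) = 1"
  using is_orthonormal_poly_onp[of F k] by (simp add: is_orthonormal_poly_def)

lemma poly_mean_onp_mult: "poly_mean F (onp F i * onp F j) = of_bool (i = j)"
proof (cases i j rule: linorder_cases)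
  case less
  then have "poly_mean F (onp F j * onp F i) = 0" by (intro poly_mean_onp_lower) (simp add: degree_onp)
  then show ?thesis using less by (simp add: mult.commute)
next
  case greater
  then have "poly_mean F (onp F i * onp F j) = 0" by (intro poly_mean_onp_lower) (simp add: degree_onp)
  then show ?thesis using greater by simp
qed (simp add: poly_mean_onp_square)

section \<open>Legendre polynomials\<close>

declare uni_measure.simps [simp del]

text \<open>
  The fundamental theorem of calculus is the only information about the uniform measure that the
  Legendre case uses; no explicit formula for the polynomials is needed.
\<close>

lemma poly_mean_Legendre_pderiv: "poly_mean Legendre (pderiv p) = (poly p 1 - poly p (- 1)) / 2"
proof -
  have "poly_mean Legendre (pderiv p) = (LINT x|lborel. indicator {-1<..<1} x * (1 / 2 * poly (pderiv p) x))"
    unfolding poly_mean_def by (subst integral_uni_measure) (simp_all add: uni_density_def)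
  also have "\<dots> = (LINT x|lborel. 1 / 2 * (indicator {-1..1} x * poly (pderiv p) x))"
  proof (rule integral_cong_AE)
    have "AE x in lborel. x \<notin> {-1, 1::real}"
      by (rule AE_not_in) (auto intro: finite_imp_null_set_lborel)
    then show "AE x in lborel. indicator {-1<..<1} x * (1 / 2 * poly (pderiv p) x)
        = 1 / 2 * (indicator {-1..1} x * poly (pderiv p) x)"
      by eventually_elim (auto simp: indicator_def)
  qed auto
  also have "\<dots> = 1 / 2 * (LINT x|lborel. poly (pderiv p) x * indicator {-1..1} x)"
    by (simp add: mult.commute)
  also have "(LINT x|lborel. poly (pderiv p) x * indicator {-1..1} x) = poly p 1 - poly p (- 1)"
  proof (rule integral_FTC_Icc_real)
    show "DERIV (poly p) x :> poly (pderiv p) x" for x by (rule poly_DERIV)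
    show "isCont (poly (pderiv p)) x" for x by simp
  qed simp
  finally show ?thesis by simp
qed

lemma Legendre_integration_by_parts:
  assumes "poly (p * q) 1 = 0" "poly (p * q) (- 1) = 0"
  shows "poly_mean Legendre (pderiv p * q) = - poly_mean Legendre (p * pderiv q)"
proof -
  have "poly_mean Legendre (pderiv (p * q)) = 0"
    using assms by (simp only: poly_mean_Legendre_pderiv) simp
  then show ?thesis by (simp add: pderiv_mult poly_mean_add mult.commute)
qed

text \<open>
  The Euler operator \<open>x d/dx\<close> multiplies \<open>x\<^sup>n\<close> by \<open>n\<close>; hence it maps a polynomial \<open>p\<close> of degree
  \<open>k\<close> to \<open>k p\<close> up to lower degree.
\<close>

lemma coeff_x_pderiv: "coeff ([:0, 1:] * pderiv p) n = of_nat n * coeff p n"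
  by (cases n) (simp_all add: coeff_pderiv)

lemma poly_mean_onp_eq_0I:
  fixes r :: "real poly"
  assumes "degree r \<le> k" "coeff r k = 0"
  shows "poly_mean F (onp F k * r) = 0"
  using eq_zero_or_degree_less[OF assms] poly_mean_onp_lower by auto

text \<open>
  The mean of \<open>(p\<^sup>2)'\<close> is \<open>2 \<langle>p, p'\<rangle> = 0\<close>, as \<open>p'\<close> has lower degree; so the endpoint values have equal
  squares.  The mean of \<open>(x p\<^sup>2)'\<close> is \<open>\<langle>p, p\<rangle> + 2 \<langle>p, x p'\<rangle> = 1 + 2 k\<close> by the Euler operator, and it
  is also the average of the two squares.
\<close>

lemma onp_Legendre_endpoints:
  "(poly (onp Legendre k) 1)\<^sup>2 = 2 * real k + 1" "(poly (onp Legendre k) (- 1))\<^sup>2 = 2 * real k + 1"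
proof -
  let ?p = "onp Legendre k"
  have dp: "degree ?p = k" by (rule degree_onp)
  have "poly_mean Legendre (pderiv (?p * ?p)) = 2 * poly_mean Legendre (?p * pderiv ?p)"
    by (simp only: pderiv_mult poly_mean_add mult_2)
  also have "poly_mean Legendre (?p * pderiv ?p) = 0"
    by (rule poly_mean_onp_eq_0I) (auto simp: degree_pderiv coeff_pderiv dp coeff_eq_0)
  finally have 1: "(poly ?p 1)\<^sup>2 = (poly ?p (- 1))\<^sup>2"
    by (simp add: poly_mean_Legendre_pderiv power2_eq_square)
  define r where "r = [:0, 1:] * pderiv ?p - smult (real k) ?p"
  have "poly_mean Legendre (?p * r) = 0"
  proof (rule poly_mean_onp_eq_0I)
    show "coeff r k = 0" by (simp only: r_def coeff_diff coeff_x_pderiv coeff_smult diff_self)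
    show "degree r \<le> k"
      unfolding r_def
    proof (rule degree_diff_le)
      show "degree ([:0, 1:] * pderiv ?p) \<le> k"
        by (rule degree_le) (simp only: coeff_x_pderiv, simp add: coeff_eq_0 dp)
    qed (simp add: dp)
  qed
  moreover have "?p * ([:0, 1:] * pderiv ?p) = ?p * r + smult (real k) (?p * ?p)"
    by (simp only: r_def right_diff_distrib mult_smult_right diff_add_cancel)
  ultimately have xp: "poly_mean Legendre (?p * ([:0, 1:] * pderiv ?p)) = real k"
    by (simp only: poly_mean_add poly_mean_smult poly_mean_onp_square)
  have x1: "pderiv [:0, 1::real:] = 1" by (simp add: pderiv_pCons)
  have "pderiv ([:0, 1:] * (?p * ?p))
      = ?p * ?p + (?p * ([:0, 1:] * pderiv ?p) + ?p * ([:0, 1:] * pderiv ?p))"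
    unfolding pderiv_mult x1 by (simp only: distrib_left mult_1_right mult_1_left mult_ac add_ac)
  then have "poly_mean Legendre (pderiv ([:0, 1:] * (?p * ?p))) = 1 + (real k + real k)"
    by (simp only: poly_mean_add poly_mean_onp_square xp)
  then have "(poly ?p 1)\<^sup>2 + (poly ?p (- 1))\<^sup>2 = 2 * (1 + 2 * real k)"
    by (simp add: poly_mean_Legendre_pderiv power2_eq_square)
  with 1 show "(poly ?p 1)\<^sup>2 = 2 * real k + 1" "(poly ?p (- 1))\<^sup>2 = 2 * real k + 1" by simp_all
qed

text \<open>
  The operator \<open>q \<mapsto> ((x\<^sup>2 - 1) q')'\<close> does not raise degrees and is symmetric, because the boundary
  terms vanish with \<open>x\<^sup>2 - 1\<close>.  So it maps \<open>p\<close> to a polynomial of degree \<open>k\<close> orthogonal to all lower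
  degrees, that is, to a multiple of \<open>p\<close>; the factor is read off the leading coefficient.
\<close>

lemma Legendre_ODE:
  "pderiv ([:-1, 0, 1:] * pderiv (onp Legendre k)) = smult (real k * (real k + 1)) (onp Legendre k)"
proof -
  let ?p = "onp Legendre k" and ?w = "[:-1, 0, 1::real:]"
  have dp: "degree ?p = k" by (rule degree_onp)
  define Q where "Q = pderiv (?w * pderiv ?p)"
  define r where "r = Q - smult (real k * (real k + 1)) ?p"
  have coeffQ: "coeff (pderiv (?w * pderiv q)) n = real n * (real n + 1) * coeff q n - (real n + 1) * (real n + 2) * coeff q (n + 2)" for q n
    by (cases n; cases "n - 1") (simp_all add: coeff_pderiv algebra_simps numeral_eq_Suc)
  have degQ: "degree (pderiv (?w * pderiv q)) \<le> degree q" for q :: "real poly"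
    by (rule degree_le) (simp only: coeffQ, simp add: coeff_eq_0)
  have "degree r \<le> k" unfolding r_def Q_def using degQ[of ?p] by (intro degree_diff_le) (simp_all add: dp)
  moreover have "coeff r k = 0"
    by (simp only: r_def Q_def coeffQ coeff_diff coeff_smult) (simp add: coeff_eq_0 dp)
  ultimately have r: "r = 0 \<or> degree r < k" by (rule eq_zero_or_degree_less)
  have pr: "poly_mean Legendre (?p * r) = 0" using r poly_mean_onp_lower by auto
  have "poly_mean Legendre (Q * r) = - poly_mean Legendre (?w * pderiv ?p * pderiv r)"
    unfolding Q_def by (rule Legendre_integration_by_parts) simp_all
  also have "?w * pderiv ?p * pderiv r = pderiv ?p * (?w * pderiv r)" by (simp only: mult_ac)
  also have "poly_mean Legendre \<dots> = - poly_mean Legendre (?p * pderiv (?w * pderiv r))"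
    by (rule Legendre_integration_by_parts) simp_all
  also have "poly_mean Legendre (?p * pderiv (?w * pderiv r)) = 0"
    using r degQ[of r] poly_mean_onp_lower[of "pderiv (?w * pderiv r)" k Legendre] by auto
  finally have "poly_mean Legendre (Q * r) = 0" by simp
  moreover have "r * r = Q * r - smult (real k * (real k + 1)) (?p * r)"
  proof -
    have "r * r = (Q - smult (real k * (real k + 1)) ?p) * r" by (simp only: r_def)
    then show ?thesis by (simp only: left_diff_distrib mult_smult_left)
  qed
  ultimately have "poly_mean Legendre (r * r) = 0"
    by (simp add: poly_mean_diff poly_mean_smult pr)
  then have "r = 0" by (rule poly_mean_square_eq_0)
  then show ?thesis by (simp add: r_def Q_def)
qed

text \<open>
  Sonin's argument: for \<open>k > 0\<close>, by the differential equation, \<open>f = p\<^sup>2 + (1 - x\<^sup>2) p'\<^sup>2 / (k (k + 1))\<close> has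
  derivative \<open>2 x p'\<^sup>2 / (k (k + 1))\<close>.  It is therefore largest at the endpoints, where it
  equals \<open>p\<^sup>2\<close>, and it dominates \<open>p\<^sup>2\<close> everywhere.
\<close>

lemma onp_Legendre_bound:
  assumes "x \<in> {-1..1}"
  shows "\<bar>poly (onp Legendre k) x\<bar> \<le> sqrt (2 * real k + 1)"
proof (cases "k = 0")
  case True
  then obtain c where c: "onp Legendre k = [:c:]"
    using degree_onp[of Legendre k] by (metis degree_eq_zeroE)
  have "poly (onp Legendre k) x = poly (onp Legendre k) 1" by (simp add: c)
  then have "(poly (onp Legendre k) x)\<^sup>2 = 2 * real k + 1" using onp_Legendre_endpoints(1)[of k] by simp
  then show ?thesis by (metis order_refl real_sqrt_abs)
next
  case False
  let ?p = "onp Legendre k"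
  define a where "a = real k * (real k + 1)"
  have a: "0 < a" using False by (simp add: a_def)
  define f where "f = (\<lambda>x. (poly ?p x)\<^sup>2 + (1 - x\<^sup>2) * (poly (pderiv ?p) x)\<^sup>2 / a)"
  have ode: "(x\<^sup>2 - 1) * poly (pderiv (pderiv ?p)) x = a * poly ?p x - 2 * x * poly (pderiv ?p) x" for x
  proof -
    have "poly (pderiv ([:-1, 0, 1:] * pderiv ?p)) x = a * poly ?p x"
      by (simp only: Legendre_ODE a_def poly_smult)
    moreover have "poly (pderiv ([:-1, 0, 1:] * pderiv ?p)) x
        = (x\<^sup>2 - 1) * poly (pderiv (pderiv ?p)) x + 2 * x * poly (pderiv ?p) x"
      by (simp only: pderiv_mult poly_add poly_mult) (simp add: pderiv_pCons power2_eq_square algebra_simps)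
    ultimately show ?thesis by simp
  qed
  have der: "DERIV f x :> 2 * x * (poly (pderiv ?p) x)\<^sup>2 / a" for x
  proof -
    have "DERIV f x :> 2 * poly ?p x * poly (pderiv ?p) x +
       ((- 2 * x) * (poly (pderiv ?p) x)\<^sup>2 + (1 - x\<^sup>2) * (2 * poly (pderiv ?p) x * poly (pderiv (pderiv ?p)) x)) / a"
      unfolding f_def by (auto intro!: derivative_eq_intros simp: a less_imp_neq[OF a, symmetric])
    also have "(1 - x\<^sup>2) * (2 * poly (pderiv ?p) x * poly (pderiv (pderiv ?p)) x)
        = - 2 * poly (pderiv ?p) x * ((x\<^sup>2 - 1) * poly (pderiv (pderiv ?p)) x)"
      by (simp add: algebra_simps)
    also have "\<dots> = - 2 * poly (pderiv ?p) x * (a * poly ?p x - 2 * x * poly (pderiv ?p) x)"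
      by (simp only: ode)
    finally show ?thesis
      using a by (simp add: field_simps power2_eq_square)
  qed
  have "f x \<le> 2 * real k + 1"
  proof (cases "0 \<le> x")
    case True
    have "f x \<le> f 1"
    proof (rule DERIV_nonneg_imp_nondecreasing[of x 1 f])
      show "x \<le> 1" using assms by simp
      fix y assume "x \<le> y" "y \<le> 1"
      then show "\<exists>d. DERIV f y :> d \<and> 0 \<le> d" using der[of y] True a
        by (intro exI[of _ "2 * y * (poly (pderiv ?p) y)\<^sup>2 / a"] conjI) auto
    qed
    then show ?thesis by (simp add: f_def onp_Legendre_endpoints)
  next
    case False
    have "f x \<le> f (- 1)"
    proof (rule DERIV_nonpos_imp_nonincreasing[of "- 1" x f])
      show "- 1 \<le> x" using assms by simp
      fix y assume y: "- 1 \<le> y" "y \<le> x"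
      then have "2 * y \<le> 0" using False by linarith
      then have "2 * y * (poly (pderiv ?p) y)\<^sup>2 / a \<le> 0"
        using a by (intro divide_nonpos_pos mult_nonpos_nonneg[of "2 * y"]) auto
      then show "\<exists>d. DERIV f y :> d \<and> d \<le> 0" using der[of y] by blast
    qed
    then show ?thesis by (simp add: f_def onp_Legendre_endpoints)
  qed
  moreover have "(poly ?p x)\<^sup>2 \<le> f x"
    using assms a by (auto simp: f_def abs_square_le_1 intro!: divide_nonneg_pos mult_nonneg_nonneg)
  ultimately have "(poly ?p x)\<^sup>2 \<le> 2 * real k + 1" by linarith
  then show ?thesis by (rule real_le_rsqrt[OF order_trans, rotated]) simp
qed

section \<open>Chebyshev polynomials\<close>

fun chebyshev_T :: "nat \<Rightarrow> real poly" where
  "chebyshev_T 0 = 1"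
| "chebyshev_T (Suc 0) = [:0, 1:]"
| "chebyshev_T (Suc (Suc n)) = [:0, 2:] * chebyshev_T (Suc n) - chebyshev_T n"

lemma poly_chebyshev_T_cos: "poly (chebyshev_T n) (cos t) = cos (real n * t)"
proof (induction n rule: chebyshev_T.induct)
  case (3 n)
  have "cos (real (Suc (Suc n)) * t) = 2 * cos t * cos (real (Suc n) * t) - cos (real n * t)"
  proof -
    have "cos (real (Suc (Suc n)) * t) = cos (real (Suc n) * t + t)" by (simp add: algebra_simps)
    moreover have "cos (real n * t) = cos (real (Suc n) * t - t)" by (simp add: algebra_simps)
    ultimately show ?thesis by (simp only: cos_add cos_diff) (simp add: algebra_simps)
  qed
  with 3 show ?case by simp
qed simp_all

lemma poly_chebyshev_T: "x \<in> {-1..1} \<Longrightarrow> poly (chebyshev_T n) x = cos (real n * arccos x)"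
  using poly_chebyshev_T_cos[of n "arccos x"] by simp

lemma poly_chebyshev_T_1: "poly (chebyshev_T n) 1 = 1"
  using poly_chebyshev_T_cos[of n 0] by simp

lemma abs_poly_chebyshev_T_le: "x \<in> {-1..1} \<Longrightarrow> \<bar>poly (chebyshev_T n) x\<bar> \<le> 1"
  by (simp add: poly_chebyshev_T)

lemma degree_chebyshev_T: "degree (chebyshev_T n) = n \<and> 0 < lead_coeff (chebyshev_T n)"
proof (induction n rule: chebyshev_T.induct)
  case (3 n)
  have ne: "chebyshev_T (Suc n) \<noteq> 0" using 3 by auto
  have d: "degree ([:0, 2:] * chebyshev_T (Suc n)) = Suc (Suc n)"
    using 3 ne by (subst degree_mult_eq) auto
  have dl: "degree (chebyshev_T (Suc (Suc n))) = Suc (Suc n)"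
    using 3 d by (simp only: chebyshev_T.simps) (subst diff_conv_add_uminus, subst degree_add_eq_left, auto)
  moreover have "coeff (chebyshev_T (Suc (Suc n))) (Suc (Suc n)) = 2 * coeff (chebyshev_T (Suc n)) (Suc n)"
    using 3 by (simp add: coeff_eq_0)
  moreover have "0 < coeff (chebyshev_T (Suc n)) (Suc n)" using 3(1) by metis
  ultimately show ?case by simp
qed simp_all

text \<open>
  For \<open>n > 0\<close>, the function \<open>- sin (n arccos x) / n\<close> is an antiderivative of \<open>T\<^sub>n(x) / sqrt (1 - x\<^sup>2)\<close> and
  vanishes at both endpoints.
\<close>

lemma poly_mean_chebyshev_T: "poly_mean Chebyshev (chebyshev_T n) = of_bool (n = 0)"
proof (cases "n = 0")
  case False
  define g where "g = (\<lambda>x::real. poly (chebyshev_T n) x / sqrt (1 - x\<^sup>2))"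
  define G where "G = (\<lambda>x::real. - sin (real n * arccos x) / real n)"
  have e: "einterval (- 1) 1 = {-1<..<1::real}"
    using einterval_eq(1)[of "- 1" 1] by (simp add: one_ereal_def)
  have lt: "- 1 < (1 :: ereal)" by (simp add: one_ereal_def)
  have der: "(G has_vector_derivative g x) (at x)" if "- 1 < ereal x" "ereal x < 1" for x
  proof -
    have x: "- 1 < x" "x < 1" using that by (auto simp: one_ereal_def)
    have "DERIV G x :> - (cos (real n * arccos x) * (real n * inverse (- sqrt (1 - x\<^sup>2)))) / real n"
      unfolding G_def using x False by (auto intro!: derivative_eq_intros)
    also have "- (cos (real n * arccos x) * (real n * inverse (- sqrt (1 - x\<^sup>2)))) / real n = g x"
      using False x by (simp add: g_def poly_chebyshev_T divide_inverse)
    finally show ?thesis by (simp add: has_real_derivative_iff_has_vector_derivative)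
  qed
  have cont: "isCont g x" if "- 1 < ereal x" "ereal x < 1" for x
  proof -
    have "0 < 1 - x\<^sup>2" using that abs_square_less_1[of x] by (auto simp: one_ereal_def)
    then show ?thesis unfolding g_def by (intro continuous_intros) auto
  qed
  have int: "set_integrable lborel (einterval (- 1) 1) g"
    unfolding e
  proof (rule set_integrable_bound[OF arcsine_integrable])
    show "set_borel_measurable lborel {-1<..<1} g"
      unfolding set_borel_measurable_def g_def by measurable
    show "AE x in lborel. x \<in> {-1<..<1} \<longrightarrow> norm (g x) \<le> norm (1 / sqrt (1 - x\<^sup>2))"
    proof (intro AE_I2 impI)
      fix x :: real assume x: "x \<in> {-1<..<1}"
      have "\<bar>poly (chebyshev_T n) x\<bar> * (1 / \<bar>sqrt (1 - x\<^sup>2)\<bar>) \<le> 1 * (1 / \<bar>sqrt (1 - x\<^sup>2)\<bar>)"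
        using abs_poly_chebyshev_T_le[of x n] x by (intro mult_right_mono) auto
      then show "norm (g x) \<le> norm (1 / sqrt (1 - x\<^sup>2))" by (simp add: g_def abs_divide)
    qed
  qed
  have cG: "continuous_on {-1..1} G"
    unfolding G_def using False by (intro continuous_intros) auto
  have "(G \<longlongrightarrow> G (- 1)) (at_right (- 1))" by (rule continuous_on_Icc_at_rightD[OF cG]) simp
  then have l1: "((G \<circ> real_of_ereal) \<longlongrightarrow> G (- 1)) (at_right (- 1 :: ereal))"
    by (metis ereal_tendsto_simps1(2) ereal_minus(1) one_ereal_def uminus_ereal.simps(1))
  have "(G \<longlongrightarrow> G 1) (at_left 1)" by (rule continuous_on_Icc_at_leftD[OF cG]) simp
  then have l2: "((G \<circ> real_of_ereal) \<longlongrightarrow> G 1) (at_left (1 :: ereal))"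
    by (metis ereal_tendsto_simps1(1) one_ereal_def)
  have "(LBINT x=- 1..1. g x) = G 1 - G (- 1)"
    by (rule interval_integral_FTC_integrable[OF lt der cont int l1 l2])
  also have "\<dots> = 0" by (simp add: G_def)
  finally have "(LBINT x:{-1<..<1}. g x) = 0"
    using less_imp_le[OF lt] by (simp add: interval_lebesgue_integral_def e)
  moreover have "poly_mean Chebyshev (chebyshev_T n) = (LINT x|lborel. 1 / pi * (indicator {-1<..<1} x * g x))"
    unfolding poly_mean_def
    by (subst integral_uni_measure)
       (auto intro!: Bochner_Integration.integral_cong simp: uni_density_def g_def)
  ultimately show ?thesis using False by (simp add: set_lebesgue_integral_def)
qed simp

lemma poly_mean_chebyshev_T_mult:
  assumes "j \<le> n"
  shows "poly_mean Chebyshev (chebyshev_T n * chebyshev_T j) = (of_bool (n + j = 0) + of_bool (n = j)) / 2"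
proof -
  have "poly_mean Chebyshev (chebyshev_T n * chebyshev_T j) = (LINT x|uni_measure Chebyshev. poly (smult (1 / 2) (chebyshev_T (n + j) + chebyshev_T (n - j))) x)"
    unfolding poly_mean_def
  proof (rule Bochner_Integration.integral_cong[OF refl])
    fix x assume "x \<in> space (uni_measure Chebyshev)"
    then have x: "x \<in> {-1..1}" by (simp add: space_uni_measure)
    have "cos (real n * arccos x) * cos (real j * arccos x)
       = (cos (real n * arccos x + real j * arccos x) + cos (real n * arccos x - real j * arccos x)) / 2"
      by (simp add: cos_add cos_diff)
    then show "poly (chebyshev_T n * chebyshev_T j) x = poly (smult (1 / 2) (chebyshev_T (n + j) + chebyshev_T (n - j))) x"
      using x assms by (simp add: poly_chebyshev_T of_nat_diff distrib_right left_diff_distrib)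
  qed
  also have "\<dots> = poly_mean Chebyshev (smult (1 / 2) (chebyshev_T (n + j) + chebyshev_T (n - j)))"
    by (simp only: poly_mean_def)
  also have "\<dots> = (poly_mean Chebyshev (chebyshev_T (n + j)) + poly_mean Chebyshev (chebyshev_T (n - j))) / 2"
    by (simp add: poly_mean_smult poly_mean_add)
  finally show ?thesis using assms by (auto simp: poly_mean_chebyshev_T)
qed

lemma onp_Chebyshev: "onp Chebyshev k = (if k = 0 then 1 else smult (sqrt 2) (chebyshev_T k))"
proof (rule orthonormal_poly_eqI)
  have orth: "poly_mean Chebyshev (chebyshev_T k * q) = 0" if "degree q < k" for q
  proof (rule orthogonal_to_lower_degree[OF _ _ that, where b = chebyshev_T])
    show "degree (chebyshev_T j) = j \<and> chebyshev_T j \<noteq> 0" for j using degree_chebyshev_T[of j] by auto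
    show "poly_mean Chebyshev (chebyshev_T k * chebyshev_T j) = 0" if "j < k" for j
      using that by (simp add: poly_mean_chebyshev_T_mult)
  qed
  show "is_orthonormal_poly Chebyshev k (if k = 0 then 1 else smult (sqrt 2) (chebyshev_T k))"
    unfolding is_orthonormal_poly_def
    using degree_chebyshev_T[of k] orth by (auto simp: poly_mean_smult poly_mean_chebyshev_T_mult)
qed

text \<open>
  The squares of the sup norms of the orthonormal polynomials, both attained at the endpoint 1.
\<close>

fun uni_sup_sq :: "poly_family \<Rightarrow> nat \<Rightarrow> real" where
  "uni_sup_sq Legendre k = 2 * real k + 1"
| "uni_sup_sq Chebyshev k = (if k = 0 then 1 else 2)"

lemma onp_bound: "x \<in> {-1..1} \<Longrightarrow> \<bar>poly (onp F k) x\<bar> \<le> sqrt (uni_sup_sq F k)"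
  using onp_Legendre_bound[of x k] abs_poly_chebyshev_T_le[of x k]
  by (cases F) (auto simp: onp_Chebyshev abs_mult)

lemma onp_at_1: "\<bar>poly (onp F k) 1\<bar> = sqrt (uni_sup_sq F k)"
proof (cases F)
  case Legendre
  then show ?thesis using onp_Legendre_endpoints(1)[of k] by (metis real_sqrt_abs uni_sup_sq.simps(1))
qed (auto simp: onp_Chebyshev poly_chebyshev_T_1 abs_mult)

lemma uni_sup_sq_ge_1: "1 \<le> uni_sup_sq F k"
  by (cases F) auto

section \<open>The tensor basis and its weights\<close>

lemma prob_space_cube_measure: "prob_space (cube_measure F d)"
  unfolding cube_measure_def by (rule prob_space_PiM) (rule prob_space_uni_measure)

lemma product_sigma_finite_uni: "product_sigma_finite (\<lambda>_. uni_measure F)"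
  unfolding product_sigma_finite_def
  using prob_space_uni_measure[of F] by (auto intro: prob_space_imp_sigma_finite)

lemma space_cube_measure: "space (cube_measure F d) = {..<d} \<rightarrow>\<^sub>E {-1<..<1}"
  by (simp add: cube_measure_def space_PiM space_uni_measure)

definition tensor_real :: "poly_family \<Rightarrow> nat \<Rightarrow> (nat \<Rightarrow> nat) \<Rightarrow> (nat \<Rightarrow> real) \<Rightarrow> real" where
  "tensor_real F d i x = (\<Prod>l<d. poly (onp F (i l)) (x l))"

lemma tensor_poly_eq: "tensor_poly F d i x = complex_of_real (tensor_real F d i x)"
  by (simp add: tensor_poly_def tensor_real_def)

lemma measurable_cube_component:
  assumes "g \<in> borel_measurable borel" "l < d"
  shows "(\<lambda>x. g (x l)) \<in> borel_measurable (cube_measure F d)"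
proof -
  have "(\<lambda>x. x l) \<in> measurable (cube_measure F d) (uni_measure F)"
    unfolding cube_measure_def using assms(2) by (intro measurable_component_singleton) auto
  from measurable_compose[OF this borel_measurable_uni_measure[OF assms(1)]] show ?thesis .
qed

lemma measurable_tensor_real: "tensor_real F d i \<in> borel_measurable (cube_measure F d)"
  unfolding tensor_real_def[abs_def]
  by (intro borel_measurable_prod measurable_cube_component) auto

lemma measurable_tensor_poly: "tensor_poly F d i \<in> borel_measurable (cube_measure F d)"
  unfolding tensor_poly_eq[abs_def] using measurable_tensor_real[of F d i] by measurable

definition sup_weight :: "poly_family \<Rightarrow> nat \<Rightarrow> (nat \<Rightarrow> nat) \<Rightarrow> real" where
  "sup_weight F d i = (\<Prod>l<d. sqrt (uni_sup_sq F (i l)))"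

lemma sup_weight_ge_1: "1 \<le> sup_weight F d i"
  unfolding sup_weight_def by (rule prod_ge_1) (simp add: uni_sup_sq_ge_1)

lemma tensor_real_bound:
  assumes "x \<in> space (cube_measure F d)"
  shows "\<bar>tensor_real F d i x\<bar> \<le> sup_weight F d i"
  unfolding tensor_real_def sup_weight_def abs_prod
proof (rule prod_mono)
  fix l assume "l \<in> {..<d}"
  then have "x l \<in> {-1<..<1}" using assms by (auto simp: space_cube_measure PiE_iff)
  then show "0 \<le> \<bar>poly (onp F (i l)) (x l)\<bar> \<and> \<bar>poly (onp F (i l)) (x l)\<bar> \<le> sqrt (uni_sup_sq F (i l))"
    using onp_bound[of "x l" F "i l"] by auto
qed

lemma tensor_real_orthonormal:
  assumes "i \<in> multi_indices d" "j \<in> multi_indices d"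
  shows "(\<integral>x. tensor_real F d i x * tensor_real F d j x \<partial>cube_measure F d) = of_bool (i = j)"
proof -
  interpret product_sigma_finite "\<lambda>_. uni_measure F" by (rule product_sigma_finite_uni)
  have "(\<integral>x. tensor_real F d i x * tensor_real F d j x \<partial>cube_measure F d)
      = (\<integral>x. (\<Prod>l<d. poly (onp F (i l) * onp F (j l)) (x l)) \<partial>cube_measure F d)"
    by (simp add: tensor_real_def prod.distrib)
  also have "\<dots> = (\<Prod>l<d. poly_mean F (onp F (i l) * onp F (j l)))"
    unfolding cube_measure_def poly_mean_def by (rule product_integral_prod) (auto simp del: poly_mult intro: poly_integrable)
  also have "\<dots> = (\<Prod>l<d. of_bool (i l = j l))" by (simp add: poly_mean_onp_mult)
  also have "\<dots> = of_bool (i = j)"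
  proof (cases "i = j")
    case False
    then obtain l where "i l \<noteq> j l" by auto
    moreover have "l < d" using calculation assms by (auto simp: multi_indices_def not_less intro: ccontr)
    ultimately show ?thesis using False by (auto intro!: prod_zero)
  qed simp
  finally show ?thesis .
qed

lemma uni_measure_interval_pos:
  assumes "b < 1" "- 1 \<le> b"
  shows "0 < emeasure (uni_measure F) {b<..<1}"
proof (rule ccontr)
  assume "\<not> ?thesis"
  then have 0: "emeasure (uni_measure F) {b<..<1} = 0" by simp
  have s: "{b<..<1} \<in> sets (uni_measure F)"
    using assms by (auto simp: sets_uni_measure sets_restrict_space)
  have "AE x in uni_measure F. x \<notin> {b<..<1}"
    using 0 s by (intro AE_not_in) (auto simp: null_sets_def)
  then have "AE x in lborel. x \<in> {-1<..<1} \<longrightarrow> x \<notin> {b<..<1}" by (simp only: AE_uni_measure_iff)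
  then have "AE x in lborel. x \<notin> {b<..<1}" by eventually_elim (use assms in auto)
  then have "emeasure lborel {b<..<1} = 0"
    by (subst (asm) AE_iff_measurable[where N = "{b<..<1}"]) auto
  then show False using assms by simp
qed

text \<open>
  The bound by the product of the sup norms holds at every point.  Conversely each factor is
  continuous and attains its sup norm at 1, so the product is arbitrarily close to the bound
  on a small box at the corner \<open>(1, \<dots>, 1)\<close>, and every such box has positive measure.
\<close>

lemma Linf_norm_tensor_poly:
  "Linf_norm (cube_measure F d) (tensor_poly F d i) = ennreal (sup_weight F d i)"
proof -
  let ?M = "cube_measure F d"
  interpret prob_space ?M by (rule prob_space_cube_measure)
  have norm: "cmod (tensor_poly F d i x) = \<bar>tensor_real F d i x\<bar>" for x by (simp add: tensor_poly_eq)
  define z where "z = esssup ?M (\<lambda>x. ennreal \<bar>tensor_real F d i x\<bar>)"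
  have zL: "Linf_norm ?M (tensor_poly F d i) = z" by (simp only: Linf_norm_def norm z_def)
  have meas: "(\<lambda>x. ennreal \<bar>tensor_real F d i x\<bar>) \<in> borel_measurable ?M"
    using measurable_tensor_real[of F d i] by measurable
  have "z \<le> ennreal (sup_weight F d i)"
    unfolding z_def by (rule esssup_I[OF meas]) (auto intro!: AE_I2 ennreal_leI tensor_real_bound)
  moreover have "ennreal (sup_weight F d i) \<le> z"
  proof (rule ccontr)
    assume "\<not> ?thesis"
    then have lt: "z < ennreal (sup_weight F d i)" by simp
    then obtain r where r: "z = ennreal r" "0 \<le> r" by (cases z) auto
    have rS: "r < sup_weight F d i" using lt r by (simp add: ennreal_less_iff)
    define S where "S = sup_weight F d i"
    have "((\<lambda>q::real. q ^ d * S) \<longlongrightarrow> 1 ^ d * S) (at_left 1)" by (intro tendsto_intros)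
    then have "eventually (\<lambda>q. r < q ^ d * S) (at_left 1)"
      by (rule order_tendstoD) (use rS in \<open>simp add: S_def\<close>)
    moreover have "eventually (\<lambda>q::real. q \<in> {0<..<1}) (at_left 1)"
      by (rule eventually_at_left_real) simp
    ultimately have "eventually (\<lambda>q::real. r < q ^ d * S \<and> 0 < q \<and> q < 1) (at_left 1)"
      by eventually_elim auto
    \<comment> \<open>A factor \<open>q < 1\<close> per coordinate still leaves the product above \<open>r\<close>.\<close>
    then obtain q :: real where q: "r < q ^ d * S" "0 < q" "q < 1"
      using eventually_happens by fastforce
    have "\<exists>b. - 1 \<le> b \<and> b < 1 \<and> (\<forall>x\<in>{b<..<1}. q * sqrt (uni_sup_sq F k) \<le> \<bar>poly (onp F k) x\<bar>)" for k
    proof -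
      have s1: "1 \<le> sqrt (uni_sup_sq F k)" by (simp add: uni_sup_sq_ge_1)
      have "((\<lambda>x. \<bar>poly (onp F k) x\<bar>) \<longlongrightarrow> \<bar>poly (onp F k) 1\<bar>) (at_left 1)"
        by (intro tendsto_intros)
      then have "eventually (\<lambda>x. q * sqrt (uni_sup_sq F k) < \<bar>poly (onp F k) x\<bar>) (at_left 1)"
        by (rule order_tendstoD) (use q s1 in \<open>simp add: onp_at_1\<close>)
      then obtain b where "b < 1" "\<And>x. b < x \<Longrightarrow> x < 1 \<Longrightarrow> q * sqrt (uni_sup_sq F k) < \<bar>poly (onp F k) x\<bar>"
        unfolding eventually_at_left_field by blast
      then show ?thesis by (intro exI[of _ "max b (- 1)"]) (auto simp: less_imp_le)
    qed
    then have "\<forall>k. \<exists>b. - 1 \<le> b \<and> b < 1 \<and> (\<forall>x\<in>{b<..<1}. q * sqrt (uni_sup_sq F k) \<le> \<bar>poly (onp F k) x\<bar>)" ..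
    from choice[OF this] obtain b where b: "\<And>k. - 1 \<le> b k" "\<And>k. b k < 1"
      "\<And>k x. x \<in> {b k<..<1} \<Longrightarrow> q * sqrt (uni_sup_sq F k) \<le> \<bar>poly (onp F k) x\<bar>"
      by blast
    define B where "B = (\<Pi>\<^sub>E l\<in>{..<d}. {b (i l)<..<1})"
    interpret product_sigma_finite "\<lambda>_. uni_measure F" by (rule product_sigma_finite_uni)
    have sB: "{b (i l)<..<1} \<in> sets (uni_measure F)" for l
    proof -
      have "{b (i l)<..<1} = {-1<..<1} \<inter> {b (i l)<..<1}" using b(1)[of "i l"] by auto
      moreover have "{-1<..<1} \<inter> {b (i l)<..<1} \<in> sets (uni_measure F)"
        unfolding sets_uni_measure sets_restrict_space by (rule imageI) simp
      ultimately show ?thesis by (simp only:)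
    qed
    have "emeasure ?M B = (\<Prod>l<d. emeasure (uni_measure F) {b (i l)<..<1})"
      unfolding cube_measure_def B_def by (rule emeasure_PiM) (auto simp: sB)
    also have "\<dots> \<noteq> 0"
      using uni_measure_interval_pos[OF b(2) b(1)] by (simp add: zero_less_iff_neq_zero)
    finally have Bpos: "emeasure ?M B \<noteq> 0" .
    have "AE x in ?M. ennreal \<bar>tensor_real F d i x\<bar> \<le> z" unfolding z_def by (rule esssup_AE)
    then have "AE x in ?M. x \<notin> B"
    proof eventually_elim
      case (elim x)
      show ?case
      proof
        assume x: "x \<in> B"
        have "q ^ d * S = (\<Prod>l<d. q * sqrt (uni_sup_sq F (i l)))"
          by (simp add: S_def sup_weight_def prod.distrib)
        also have "\<dots> \<le> (\<Prod>l<d. \<bar>poly (onp F (i l)) (x l)\<bar>)"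
        proof (rule prod_mono)
          fix l assume "l \<in> {..<d}"
          then have "x l \<in> {b (i l)<..<1}" using x by (auto simp: B_def PiE_iff)
          then show "0 \<le> q * sqrt (uni_sup_sq F (i l)) \<and> q * sqrt (uni_sup_sq F (i l)) \<le> \<bar>poly (onp F (i l)) (x l)\<bar>"
            using b(3)[of "x l" "i l"] q uni_sup_sq_ge_1[of F "i l"] by simp
        qed
        also have "\<dots> = \<bar>tensor_real F d i x\<bar>" by (simp add: tensor_real_def abs_prod)
        finally have "r < \<bar>tensor_real F d i x\<bar>" using q by simp
        then have "z < ennreal \<bar>tensor_real F d i x\<bar>" using r by (simp add: ennreal_less_iff)
        with elim show False by simp
      qed
    qed
    moreover have "B \<in> sets ?M" unfolding cube_measure_def B_def by (rule sets_PiM_I_finite) (auto simp: sB)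
    moreover have "B \<subseteq> space ?M"
      using calculation(2) by (rule sets.sets_into_space)
    ultimately have "emeasure ?M B = 0" by (subst (asm) AE_iff_measurable[where N = B]) auto
    then show False using Bpos by simp
  qed
  ultimately show ?thesis using zL by simp
qed

lemma weight_eq: "weight F d i = sup_weight F d i"
  using sup_weight_ge_1[of F d i] by (simp add: weight_def Linf_norm_tensor_poly)

lemma weight_sq: "(weight F d i)\<^sup>2 = (\<Prod>l<d. uni_sup_sq F (i l))"
proof -
  have "(weight F d i)\<^sup>2 = (\<Prod>l<d. (sqrt (uni_sup_sq F (i l)))\<^sup>2)"
    by (simp only: weight_eq sup_weight_def prod_power_distrib)
  also have "\<dots> = (\<Prod>l<d. uni_sup_sq F (i l))"
    using uni_sup_sq_ge_1 by (intro prod.cong refl real_sqrt_pow2) (meson order_trans zero_le_one)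
  finally show ?thesis .
qed

lemma weight_ge_1: "1 \<le> weight F d i"
  by (simp add: weight_eq sup_weight_ge_1)

section \<open>Weighted cardinality of lower sets\<close>

lemma chebyshev_exponent: "(2::real) powr (ln 3 / ln 2) = 3" "1 \<le> ln 3 / ln (2::real)"
  by (simp_all add: powr_def)

text \<open>
  For \<open>b > 0\<close> and \<open>y = a / b \<ge> 1\<close> this says that \<open>(1 + y)\<^sup>\<gamma> - y\<^sup>\<gamma>\<close> is at least its value at \<open>y = 1\<close>, and the
  difference is increasing in \<open>y\<close>.
\<close>

lemma powr_two_term_superadditive:
  fixes a b \<gamma> :: real
  assumes "1 \<le> \<gamma>" "0 \<le> b" "b \<le> a"
  shows "a powr \<gamma> + (2 powr \<gamma> - 1) * b powr \<gamma> \<le> (a + b) powr \<gamma>"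
proof (cases "b = 0")
  case False
  then have b: "0 < b" using assms by simp
  define h where "h = (\<lambda>y::real. (1 + y) powr \<gamma> - y powr \<gamma>)"
  have "h 1 \<le> h (a / b)"
  proof (rule DERIV_nonneg_imp_nondecreasing[of 1 "a / b" h])
    show "1 \<le> a / b" using assms b by simp
    fix y :: real assume y: "1 \<le> y" "y \<le> a / b"
    have "DERIV h y :> \<gamma> * (1 + y) powr (\<gamma> - 1) - \<gamma> * y powr (\<gamma> - 1)"
      unfolding h_def using y by (auto intro!: derivative_eq_intros)
    moreover have "0 \<le> \<gamma> * (1 + y) powr (\<gamma> - 1) - \<gamma> * y powr (\<gamma> - 1)"
      using assms y by (auto intro!: mult_left_mono powr_mono2)
    ultimately show "\<exists>d. DERIV h y :> d \<and> 0 \<le> d" by blast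
  qed
  then have "(2 powr \<gamma> - 1) * b powr \<gamma> \<le> ((1 + a / b) powr \<gamma> - (a / b) powr \<gamma>) * b powr \<gamma>"
    using b by (intro mult_right_mono) (auto simp: h_def)
  also have "\<dots> = ((1 + a / b) * b) powr \<gamma> - ((a / b) * b) powr \<gamma>"
    using assms b by (subst (1 2) powr_mult) (auto simp: left_diff_distrib)
  also have "(1 + a / b) * b = a + b" using b by (simp add: distrib_right)
  also have "a / b * b = a" using b by simp
  finally show ?thesis by simp
qed (use assms in simp)

lemma growth_exponent_ge_1: "1 \<le> growth_exponent F"
  by (cases F) (simp_all add: chebyshev_exponent)

text \<open>
  The growth exponent is chosen for this inequality.  It describes adding slice number \<open>k\<close>, of
  size \<open>b\<close>, to the earlier slices, of total size \<open>a\<close>: in a lower set each earlier slice has at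
  least \<open>b\<close> elements.  For the Legendre family it is \<open>a\<^sup>2 + (2 k + 1) b\<^sup>2 \<le> (a + b)\<^sup>2\<close>; for the
  Chebyshev family the factor 2 is \<open>2\<^sup>\<gamma> - 1\<close>.
\<close>

lemma growth_slice_step:
  assumes "0 \<le> b" "real k * b \<le> a" "k = 0 \<Longrightarrow> a = 0"
  shows "a powr growth_exponent F + uni_sup_sq F k * b powr growth_exponent F \<le> (a + b) powr growth_exponent F"
proof (cases F)
  case Legendre
  have a: "0 \<le> a" using assms by (meson mult_nonneg_nonneg of_nat_0_le_iff order_trans)
  have "a * a + (2 * real k + 1) * (b * b) = a * a + b * b + 2 * (real k * b) * b" by (simp add: algebra_simps)
  also have "\<dots> \<le> a * a + b * b + 2 * a * b" using assms by (simp add: mult_right_mono)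
  also have "\<dots> = (a + b) * (a + b)" by (simp add: algebra_simps)
  finally show ?thesis using Legendre a assms by (simp add: powr_numeral power2_eq_square)
next
  case Chebyshev
  show ?thesis
  proof (cases "k = 0")
    case True
    then show ?thesis using assms Chebyshev by simp
  next
    case False
    have "1 * b \<le> real k * b" using False assms by (intro mult_right_mono) auto
    then have "b \<le> a" using assms by simp
    then show ?thesis
      using powr_two_term_superadditive[OF chebyshev_exponent(2) assms(1)] Chebyshev False
      by (simp add: chebyshev_exponent)
  qed
qed

lemma growth_slices:
  fixes n :: "nat \<Rightarrow> real"
  assumes "\<And>k. 0 \<le> n k" "\<And>j k. j \<le> k \<Longrightarrow> n k \<le> n j"
  shows "(\<Sum>k<r. uni_sup_sq F k * n k powr growth_exponent F) \<le> (\<Sum>k<r. n k) powr growth_exponent F"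
proof (induction r)
  case (Suc r)
  have "real r * n r = (\<Sum>k<r. n r)" by simp
  also have "\<dots> \<le> (\<Sum>k<r. n k)" using assms(2) by (intro sum_mono) auto
  finally have "(\<Sum>k<r. n k) powr growth_exponent F + uni_sup_sq F r * n r powr growth_exponent F
      \<le> ((\<Sum>k<r. n k) + n r) powr growth_exponent F"
    using assms(1) by (intro growth_slice_step) auto
  with Suc show ?case by simp
qed simp

lemma lower_setD: "lower_set S \<Longrightarrow> i \<in> S \<Longrightarrow> j \<le> i \<Longrightarrow> j \<in> S"
  by (auto simp: lower_set_def)

text \<open>
  Induction on the dimension.  The slices of a lower set at the values of its last coordinate are
  decreasing lower sets in one dimension less, and their sizes add up to the size of the set.
\<close>

lemma weighted_card_le_powr:
  assumes "S \<subseteq> multi_indices d" "lower_set S" "finite S"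
  shows "weighted_card F d S \<le> real (card S) powr growth_exponent F"
  using assms
proof (induction d arbitrary: S)
  case 0
  then have "S \<subseteq> {\<lambda>_. 0}" by (auto simp: multi_indices_def)
  then consider "S = {}" | "S = {\<lambda>_. 0}" by auto
  then show ?case by cases (simp_all add: weighted_card_def weight_sq)
next
  case (Suc d)
  define T where "T = (\<lambda>k. (\<lambda>i. i(d := 0)) ` {i \<in> S. i d = k})"
  obtain r where r: "\<And>i. i \<in> S \<Longrightarrow> i d < r"
    using finite_nat_set_iff_bounded[of "(\<lambda>i. i d) ` S"] Suc.prems(3) by auto
  have inj: "inj_on (\<lambda>i. i(d := 0)) {i \<in> S. i d = k}" for k
    by (rule inj_onI) (auto simp: fun_eq_iff split: if_splits, metis)
  have cardT: "card (T k) = card {i \<in> S. i d = k}" for k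
    unfolding T_def by (rule card_image[OF inj])
  have T_mem: "j \<in> T k \<longleftrightarrow> j d = 0 \<and> j(d := k) \<in> S" for j k
  proof
    assume "j \<in> T k"
    then obtain i where i: "i \<in> S" "i d = k" "j = i(d := 0)" by (auto simp: T_def)
    then have "j(d := k) = i" by auto
    then show "j d = 0 \<and> j(d := k) \<in> S" using i by simp
  next
    assume *: "j d = 0 \<and> j(d := k) \<in> S"
    then have "j = (j(d := k))(d := 0)" by auto
    then show "j \<in> T k" unfolding T_def using * by (intro image_eqI[of _ _ "j(d := k)"]) auto
  qed
  have T_multi: "T k \<subseteq> multi_indices d" for k
  proof
    fix j assume j: "j \<in> T k"
    then have "j(d := k) \<in> multi_indices (Suc d)" using Suc.prems(1) by (auto simp: T_mem)
    then have *: "(j(d := k)) l = 0" if "Suc d \<le> l" for l using that by (simp only: multi_indices_def mem_Collect_eq)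
    have "j l = 0" if "d \<le> l" for l
      using *[of l] j that by (cases "l = d") (auto simp: T_mem)
    then show "j \<in> multi_indices d" by (simp add: multi_indices_def)
  qed
  have T_lower: "lower_set (T k)" for k
    unfolding lower_set_def
  proof (intro ballI allI impI)
    fix i j assume i: "i \<in> T k" and ji: "j \<le> i"
    have "j d \<le> i d" using ji by (simp add: le_fun_def)
    moreover have "j(d := k) \<le> i(d := k)" using ji by (simp add: le_fun_def)
    ultimately show "j \<in> T k" using i lower_setD[OF Suc.prems(2)] by (auto simp: T_mem)
  qed
  have T_fin: "finite (T k)" for k using Suc.prems(3) by (simp add: T_def)
  have T_dec: "T k \<subseteq> T j" if "j \<le> k" for j k
  proof
    fix i assume i: "i \<in> T k"
    have "i(d := j) \<le> i(d := k)" using that by (simp add: le_fun_def)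
    then show "i \<in> T j" using i lower_setD[OF Suc.prems(2)] by (auto simp: T_mem)
  qed
  have "weighted_card F (Suc d) S = (\<Sum>k<r. \<Sum>i | i \<in> S \<and> i d = k. (weight F (Suc d) i)\<^sup>2)"
    unfolding weighted_card_def
    by (rule sum.group[symmetric]) (use Suc.prems(3) r in auto)
  also have "\<dots> = (\<Sum>k<r. uni_sup_sq F k * weighted_card F d (T k))"
  proof (rule sum.cong[OF refl])
    fix k
    have "weighted_card F d (T k) = (\<Sum>i | i \<in> S \<and> i d = k. (weight F d (i(d := 0)))\<^sup>2)"
      unfolding weighted_card_def T_def by (subst sum.reindex[OF inj]) (simp add: o_def)
    moreover have "(weight F (Suc d) i)\<^sup>2 = uni_sup_sq F k * (weight F d (i(d := 0)))\<^sup>2" if "i d = k" for i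
    proof -
      have "(\<Prod>l<d. uni_sup_sq F ((i(d := 0)) l)) = (\<Prod>l<d. uni_sup_sq F (i l))"
        by (intro prod.cong) auto
      then show ?thesis using that by (simp add: weight_sq)
    qed
    ultimately show "(\<Sum>i | i \<in> S \<and> i d = k. (weight F (Suc d) i)\<^sup>2) = uni_sup_sq F k * weighted_card F d (T k)"
      by (simp add: sum_distrib_left)
  qed
  also have "\<dots> \<le> (\<Sum>k<r. uni_sup_sq F k * real (card (T k)) powr growth_exponent F)"
    using uni_sup_sq_ge_1[of F]
    by (intro sum_mono mult_left_mono Suc.IH T_multi T_lower T_fin) (meson order_trans zero_le_one)
  also have "\<dots> \<le> (\<Sum>k<r. real (card (T k))) powr growth_exponent F"
    by (rule growth_slices) (auto intro!: card_mono[OF T_fin] T_dec)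
  also have "(\<Sum>k<r. real (card (T k))) = real (card S)"
  proof -
    have "(\<Sum>k<r. \<Sum>i | i \<in> S \<and> i d = k. 1::nat) = (\<Sum>i\<in>S. 1)"
      by (rule sum.group) (use Suc.prems(3) r in auto)
    then have "(\<Sum>k<r. card (T k)) = card S" by (simp add: cardT)
    then show ?thesis by (metis of_nat_sum)
  qed
  finally show ?case .
qed

lemma hyperbolic_cross_finite: "finite (hyperbolic_cross d s)"
proof (rule finite_subset)
  show "hyperbolic_cross d s \<subseteq> PiE_dflt {..<d} 0 (\<lambda>_. {..s})"
  proof
    fix i assume i: "i \<in> hyperbolic_cross d s"
    have "i l \<le> s" if "l < d" for l
    proof -
      have "i l + 1 \<le> (\<Prod>l<d. i l + 1)"
        using that by (intro dvd_imp_le dvd_prodI) auto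
      then show ?thesis using i by (simp add: hyperbolic_cross_def)
    qed
    then show "i \<in> PiE_dflt {..<d} 0 (\<lambda>_. {..s})"
      using i by (auto simp: PiE_dflt_def hyperbolic_cross_def multi_indices_def)
  qed
qed (simp add: finite_PiE_dflt)

text \<open>
  A lower set contains the whole box below each of its elements \<open>i\<close>, which has \<open>\<Prod>(i\<^sub>l + 1)\<close> points.
\<close>

lemma lower_set_subset_hyperbolic_cross:
  assumes "S \<subseteq> multi_indices d" "lower_set S" "finite S" "card S \<le> s"
  shows "S \<subseteq> hyperbolic_cross d s"
proof
  fix i assume i: "i \<in> S"
  then have im: "i \<in> multi_indices d" using assms by auto
  have eq: "{j. j \<le> i} = PiE_dflt {..<d} 0 (\<lambda>l. {..i l})"
  proof (intro equalityI subsetI CollectI)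
    fix j assume "j \<in> {j. j \<le> i}"
    then have ji: "j l \<le> i l" for l by (simp add: le_fun_def)
    have "j l = 0" if "\<not> l < d" for l using ji[of l] im that by (simp add: multi_indices_def)
    then show "j \<in> PiE_dflt {..<d} 0 (\<lambda>l. {..i l})" using ji by (simp add: PiE_dflt_def)
  next
    fix j assume j: "j \<in> PiE_dflt {..<d} 0 (\<lambda>l. {..i l})"
    show "j \<le> i"
    proof (rule le_funI)
      fix l show "j l \<le> i l" using j by (cases "l < d") (auto simp: PiE_dflt_def)
    qed
  qed
  have "(\<Prod>l<d. i l + 1) = card {j. j \<le> i}" unfolding eq by (subst card_PiE_dflt) auto
  also have "\<dots> \<le> card S" using i assms lower_setD by (intro card_mono) auto
  finally show "i \<in> hyperbolic_cross d s" using im assms(4) by (simp add: hyperbolic_cross_def)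
qed

definition small_lower_sets :: "nat \<Rightarrow> nat \<Rightarrow> (nat \<Rightarrow> nat) set set" where
  "small_lower_sets d s = {S. S \<subseteq> multi_indices d \<and> lower_set S \<and> finite S \<and> card S \<le> s}"

lemma finite_small_lower_sets: "finite (small_lower_sets d s)"
  by (rule finite_subset[of _ "Pow (hyperbolic_cross d s)"])
     (auto simp: small_lower_sets_def hyperbolic_cross_finite dest: lower_set_subset_hyperbolic_cross)

lemma max_lower_card_ge: "S \<in> small_lower_sets d s \<Longrightarrow> weighted_card F d S \<le> max_lower_card F d s"
  unfolding max_lower_card_def small_lower_sets_def[symmetric]
  by (intro Max_ge finite_imageI finite_small_lower_sets) auto

lemma max_lower_card_le_powr: "max_lower_card F d s \<le> real s powr growth_exponent F"
  unfolding max_lower_card_def small_lower_sets_def[symmetric]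
proof (subst Max_le_iff)
  have "{} \<in> small_lower_sets d s" by (auto simp: small_lower_sets_def lower_set_def)
  then show "weighted_card F d ` small_lower_sets d s \<noteq> {}" by blast
  show "\<forall>a\<in>weighted_card F d ` small_lower_sets d s. a \<le> real s powr growth_exponent F"
  proof
    fix a assume "a \<in> weighted_card F d ` small_lower_sets d s"
    then obtain S where S: "S \<in> small_lower_sets d s" "a = weighted_card F d S" by auto
    then have "a \<le> real (card S) powr growth_exponent F"
      using weighted_card_le_powr by (auto simp: small_lower_sets_def)
    also have "\<dots> \<le> real s powr growth_exponent F"
      using S growth_exponent_ge_1[of F] by (intro powr_mono2) (auto simp: small_lower_sets_def)
    finally show "a \<le> real s powr growth_exponent F" .
  qed
qed (simp add: finite_small_lower_sets)

lemma max_lower_card_ge_1: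
  assumes "1 \<le> s"
  shows "1 \<le> max_lower_card F d s"
proof -
  have j0: "j = (\<lambda>_. 0)" if "j \<le> (\<lambda>_. 0::nat)" for j :: "nat \<Rightarrow> nat" using that by (auto simp: le_fun_def)
  have "{\<lambda>_. 0} \<in> small_lower_sets d s"
    using assms j0 by (auto simp: small_lower_sets_def lower_set_def multi_indices_def)
  from max_lower_card_ge[OF this, of F] have "(weight F d (\<lambda>_. 0))\<^sup>2 \<le> max_lower_card F d s"
    by (simp add: weighted_card_def)
  moreover have "1 \<le> (weight F d (\<lambda>_. 0))\<^sup>2" using weight_ge_1 by (simp add: one_le_power)
  ultimately show ?thesis by linarith
qed

text \<open>
  An interval of \<open>s\<close> points on a coordinate axis has weighted cardinality \<open>s\<^sup>2\<close>.
\<close>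

lemma max_lower_card_Legendre_ge:
  assumes "1 \<le> d"
  shows "real s powr 2 \<le> max_lower_card Legendre d s"
proof -
  define e where "e = (\<lambda>k::nat. (\<lambda>_::nat. 0::nat)(0 := k))"
  have inj: "inj_on e A" for A by (rule inj_onI) (auto simp: e_def fun_eq_iff split: if_splits)
  have "e ` {..<s} \<in> small_lower_sets d s"
  proof -
    have "j \<in> e ` {..<s}" if "j \<le> e k" "k < s" for j k
    proof (rule image_eqI)
      have "j l \<le> e k l" for l using that(1) by (simp add: le_fun_def)
      from this[of 0] have "j 0 \<le> k" by (simp add: e_def)
      moreover have "j l = 0" if "l \<noteq> 0" for l using \<open>\<And>l. j l \<le> e k l\<close>[of l] that by (simp add: e_def)
      ultimately
      show "j = e (j 0)" "j 0 \<in> {..<s}" using that(2) by (auto simp: e_def fun_eq_iff)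
    qed
    then show ?thesis using assms
      by (auto simp: small_lower_sets_def lower_set_def card_image[OF inj]) (auto simp: e_def multi_indices_def)
  qed
  from max_lower_card_ge[OF this, of Legendre]
  have "weighted_card Legendre d (e ` {..<s}) \<le> max_lower_card Legendre d s" .
  moreover have "weighted_card Legendre d (e ` {..<s}) = (\<Sum>k<s. 2 * real k + 1)"
  proof -
    have "(weight Legendre d (e k))\<^sup>2 = 2 * real k + 1" for k
    proof -
      have "(weight Legendre d (e k))\<^sup>2 = (\<Prod>l<d. if l = 0 then 2 * real k + 1 else 1)"
        unfolding weight_sq by (intro prod.cong) (auto simp: e_def)
      also have "\<dots> = 2 * real k + 1" using assms by (subst prod.delta) auto
      finally show ?thesis .
    qed
    then show ?thesis by (simp add: weighted_card_def sum.reindex[OF inj] o_def)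
  qed
  moreover have "(\<Sum>k<s. 2 * real k + 1) = (real s)\<^sup>2"
    by (induction s) (simp_all add: power2_eq_square algebra_simps)
  ultimately show ?thesis by (cases "s = 0") (simp_all add: powr_numeral)
qed

text \<open>
  The discrete cube with \<open>2\<^sup>k\<close> points has weighted cardinality \<open>(1 + 2)\<^sup>k\<close>.
\<close>

lemma max_lower_card_Chebyshev_ge:
  assumes "k \<le> d" "2 ^ k \<le> s"
  shows "3 ^ k \<le> max_lower_card Chebyshev d s"
proof -
  define e where "e = (\<lambda>A::nat set. (\<lambda>l. of_bool (l \<in> A)) :: nat \<Rightarrow> nat)"
  have e_supp: "{l. e A l = 1} = A" for A by (auto simp: e_def)
  have inj: "inj_on e B" for B by (rule inj_onI) (metis e_supp)
  have "e ` Pow {..<k} \<in> small_lower_sets d s"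
  proof -
    have "j \<in> e ` Pow {..<k}" if "j \<le> e A" "A \<subseteq> {..<k}" for j A
    proof (rule image_eqI)
      have le: "j l \<le> of_bool (l \<in> A)" for l using that(1) by (simp add: le_fun_def e_def)
      have "j l = of_bool (0 < j l)" for l using le[of l] by (cases "l \<in> A") auto
      then show "j = e {l. 0 < j l}" by (auto simp: e_def fun_eq_iff)
      have "{l. 0 < j l} \<subseteq> A"
      proof
        fix l assume "l \<in> {l. 0 < j l}"
        then show "l \<in> A" using le[of l] by (cases "l \<in> A") auto
      qed
      then show "{l. 0 < j l} \<in> Pow {..<k}" using that(2) by auto
    qed
    moreover have "e A \<in> multi_indices d" if "A \<subseteq> {..<k}" for A
      using that assms(1) by (auto simp: e_def multi_indices_def)
    ultimately show ?thesis using assms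
      by (auto simp: small_lower_sets_def lower_set_def card_image[OF inj] card_Pow)
  qed
  from max_lower_card_ge[OF this, of Chebyshev]
  have "weighted_card Chebyshev d (e ` Pow {..<k}) \<le> max_lower_card Chebyshev d s" .
  moreover have "weighted_card Chebyshev d (e ` Pow {..<k}) = (\<Sum>A\<in>Pow {..<k}. (\<Prod>l\<in>A. 2) * (\<Prod>l\<in>{..<k} - A. 1))"
  proof -
    have "(weight Chebyshev d (e A))\<^sup>2 = (\<Prod>l\<in>A. 2)" if "A \<in> Pow {..<k}" for A
    proof -
      have "(weight Chebyshev d (e A))\<^sup>2 = (\<Prod>l<d. if l \<in> A then 2 else 1)"
        unfolding weight_sq by (intro prod.cong) (auto simp: e_def)
      also have "\<dots> = (\<Prod>l\<in>{..<d} \<inter> A. 2)" by (simp add: prod.If_cases)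
      also have "{..<d} \<inter> A = A" using that assms(1) by auto
      finally show ?thesis .
    qed
    then show ?thesis by (simp add: weighted_card_def sum.reindex[OF inj] o_def)
  qed
  also have "\<dots> = (\<Prod>l<k. 2 + 1)" by (rule prod_add[symmetric]) simp
  also have "\<dots> = 3 ^ k" by simp
  finally show ?thesis by simp
qed

text \<open>
  In the Chebyshev case the dimension must admit a discrete cube of size comparable to \<open>s\<close>: this
  is where \<open>s \<le> 2\<^bsup>d + 1\<^esup>\<close> enters.  Rounding \<open>s\<close> down to a power of two costs the factor \<open>2\<^sup>\<gamma> = 3\<close>.
\<close>

lemma max_lower_card_ge_powr:
  assumes "1 \<le> d" "1 \<le> s" "s \<le> 2 ^ (d + 1)"
  shows "real s powr growth_exponent F \<le> 3 * max_lower_card F d s"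
proof (cases F)
  case Legendre
  then show ?thesis
    using max_lower_card_Legendre_ge[OF assms(1), of s] max_lower_card_ge_1[OF assms(2), of Legendre d] by simp
next
  case Chebyshev
  \<comment> \<open>The largest discrete cube that fits into both the dimension and the cardinality bound.\<close>
  define k where "k = Max {k. k \<le> d \<and> 2 ^ k \<le> s}"
  have fin: "finite {k. k \<le> d \<and> 2 ^ k \<le> s}" by simp
  have "0 \<in> {k. k \<le> d \<and> 2 ^ k \<le> s}" using assms by simp
  then have k: "k \<le> d" "2 ^ k \<le> s" using Max_in[OF fin] unfolding k_def by blast+
  have "s \<le> 2 ^ Suc k"
  proof (cases "k = d")
    case True
    then show ?thesis using assms by simp
  next
    case False
    show ?thesis
    proof (rule ccontr)
      assume "\<not> ?thesis"
      then have "Suc k \<in> {k. k \<le> d \<and> 2 ^ k \<le> s}" using k False by simp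
      then have "Suc k \<le> k" unfolding k_def using Max_ge[OF fin] by blast
      then show False by simp
    qed
  qed
  then have "real s \<le> 2 ^ Suc k" by (metis of_nat_le_iff of_nat_numeral of_nat_power)
  then have "real s powr (ln 3 / ln 2) \<le> (2 ^ Suc k) powr (ln 3 / ln 2)"
    by (intro powr_mono2) auto
  also have "\<dots> = (2 powr (ln 3 / ln 2)) ^ Suc k"
    by (simp only: powr_power powr_powr powr_realpow[symmetric] zero_less_numeral mult.commute)
  also have "\<dots> = 3 * 3 ^ k" by (simp add: chebyshev_exponent)
  also have "\<dots> \<le> 3 * max_lower_card Chebyshev d s"
    using max_lower_card_Chebyshev_ge[OF k] by simp
  finally show ?thesis using Chebyshev by simp
qed

lemma card_hyperbolic_cross_ge_2:
  assumes "1 \<le> d" "2 \<le> s"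
  shows "2 \<le> card (hyperbolic_cross d s)"
proof -
  define e where "e = (\<lambda>_::nat. 0::nat)(0 := 1)"
  have "(\<Prod>l<d. e l + 1) = (\<Prod>l<d. if l = 0 then 2 else 1)" by (intro prod.cong) (auto simp: e_def)
  also have "\<dots> = 2" using assms by (subst prod.delta) auto
  finally have "{\<lambda>_. 0, e} \<subseteq> hyperbolic_cross d s"
    using assms by (auto simp: hyperbolic_cross_def multi_indices_def e_def)
  then have "card {\<lambda>_. 0, e} \<le> card (hyperbolic_cross d s)"
    by (intro card_mono hyperbolic_cross_finite)
  moreover have "e \<noteq> (\<lambda>_. 0)" by (auto simp: e_def fun_eq_iff)
  ultimately show ?thesis by simp
qed

section \<open>Completeness of the tensor basis\<close>

lemma integrable_mult_bounded:
  fixes f g :: "'a \<Rightarrow> real"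
  assumes "integrable M f" "g \<in> borel_measurable M" "\<And>x. x \<in> space M \<Longrightarrow> \<bar>g x\<bar> \<le> C"
  shows "integrable M (\<lambda>x. f x * g x)"
proof (rule Bochner_Integration.integrable_bound[where f = "\<lambda>x. C * \<bar>f x\<bar>"])
  show "integrable M (\<lambda>x. C * \<bar>f x\<bar>)" using assms(1) by simp
  show "(\<lambda>x. f x * g x) \<in> borel_measurable M" using assms(1,2) by (auto intro: borel_measurable_times)
  show "AE x in M. norm (f x * g x) \<le> norm (C * \<bar>f x\<bar>)"
  proof (rule AE_I2)
    fix x assume x: "x \<in> space M"
    have "\<bar>f x\<bar> * \<bar>g x\<bar> \<le> \<bar>f x\<bar> * C" using assms(3)[OF x] by (intro mult_left_mono) auto
    moreover have "0 \<le> C" using assms(3)[OF x] by linarith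
    ultimately show "norm (f x * g x) \<le> norm (C * \<bar>f x\<bar>)" by (simp add: abs_mult mult.commute)
  qed
qed

lemma poly_bounded_on_interval: "\<exists>B. \<forall>x\<in>{-1..1}. \<bar>poly p x\<bar> \<le> (B::real)"
proof -
  have "compact (poly p ` {-1..1::real})" by (intro compact_continuous_image continuous_intros) auto
  then show ?thesis using compact_imp_bounded bounded_real by (metis image_eqI)
qed

text \<open>
  The indicator is the pointwise limit of continuous ramps of slope \<open>-n\<close>, each of which is uniformly
  approximated by a polynomial.
\<close>

lemma polynomial_approx_Iic:
  fixes a :: real
  shows "\<exists>p :: nat \<Rightarrow> real poly. (\<forall>n. \<forall>z\<in>{-1..1}. \<bar>poly (p n) z\<bar> \<le> 2) \<and>
    (\<forall>z\<in>{-1..1}. (\<lambda>n. poly (p n) z) \<longlonglongrightarrow> indicator {..a} z)"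
proof -
  define g where "g = (\<lambda>(n::nat) z::real. max 0 (min 1 (1 - real n * (z - a))))"
  have "\<exists>p. \<forall>z\<in>{-1..1}. \<bar>g n z - poly p z\<bar> < 1 / real (Suc n)" for n
  proof -
    have "continuous_on {-1..1} (g n)" unfolding g_def by (intro continuous_intros)
    then obtain h where h: "real_polynomial_function h" "\<And>z. z \<in> {-1..1} \<Longrightarrow> \<bar>g n z - h z\<bar> < 1 / real (Suc n)"
      using Stone_Weierstrass_real_polynomial_function[of "{-1..1}" "g n" "1 / real (Suc n)"] by auto
    from h(1) obtain c k where hc: "h = (\<lambda>x. \<Sum>i\<le>k. c i * x ^ i)"
      unfolding real_polynomial_function_iff_sum by blast
    have "poly (\<Sum>i\<le>k. monom (c i) i) z = h z" for z
      by (simp add: hc poly_sum poly_monom)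
    then show ?thesis using h(2) by (intro exI[of _ "\<Sum>i\<le>k. monom (c i) i"]) simp
  qed
  then obtain p where p: "\<And>n z. z \<in> {-1..1} \<Longrightarrow> \<bar>g n z - poly (p n) z\<bar> < 1 / real (Suc n)"
    by metis
  show ?thesis
  proof (intro exI[of _ p] conjI allI ballI)
    fix n z assume z: "z \<in> {-1..1::real}"
    have "\<bar>g n z\<bar> \<le> 1" by (auto simp: g_def)
    moreover have "1 / real (Suc n) \<le> 1" by simp
    ultimately show "\<bar>poly (p n) z\<bar> \<le> 2" using p[OF z, of n] by linarith
  next
    fix z assume z: "z \<in> {-1..1::real}"
    have "(\<lambda>n. g n z - poly (p n) z) \<longlonglongrightarrow> 0"
    proof (rule Lim_null_comparison)
      show "\<forall>\<^sub>F n in sequentially. norm (g n z - poly (p n) z) \<le> 1 / real (Suc n)"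
        using p[OF z] by (auto intro!: always_eventually less_imp_le)
      show "(\<lambda>n. 1 / real (Suc n)) \<longlonglongrightarrow> 0" by (rule LIMSEQ_Suc[OF lim_1_over_n])
    qed
    moreover have "(\<lambda>n. g n z) \<longlonglongrightarrow> indicator {..a} z"
    proof (cases "z \<le> a")
      case True
      have "g n z = 1" for n
        using mult_nonneg_nonpos[of "real n" "z - a"] True by (simp add: g_def)
      then show ?thesis using True by simp
    next
      case False
      obtain N :: nat where N: "1 / (z - a) < N" using reals_Archimedean2 by blast
      have "g n z = 0" if "N \<le> n" for n
      proof -
        have "1 / (z - a) < real n" using N that by linarith
        then have "1 < real n * (z - a)" using False by (simp add: field_simps)
        then show ?thesis by (simp add: g_def)
      qed
      then have "\<forall>\<^sub>F n in sequentially. g n z = 0" by (auto simp: eventually_sequentially)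
      then show ?thesis using False by (simp add: tendsto_eventually)
    qed
    ultimately have "(\<lambda>n. g n z - (g n z - poly (p n) z)) \<longlonglongrightarrow> indicator {..a} z - 0"
      by (intro tendsto_diff)
    then show "(\<lambda>n. poly (p n) z) \<longlonglongrightarrow> indicator {..a} z" by simp
  qed
qed

text \<open>
  The one-dimensional completeness argument, relative to a coordinate function \<open>y\<close> on an
  arbitrary measure space so that it can be applied to one coordinate of the cube at a time.
  Dominated convergence passes from polynomials to half-lines, which generate the Borel sets.
\<close>

lemma moments_zero_imp_borel_zero:
  fixes F y :: "'a \<Rightarrow> real"
  assumes F: "integrable N F" and y: "y \<in> borel_measurable N"
    and y1: "\<And>x. x \<in> space N \<Longrightarrow> y x \<in> {-1..1}"
    and mom: "\<And>p. (\<integral>x. F x * poly p (y x) \<partial>N) = 0"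
    and A: "A \<in> sets borel"
  shows "(\<integral>x. F x * indicator A (y x) \<partial>N) = 0"
proof -
  note [measurable] = y borel_measurable_integrable[OF F]
  have intA: "integrable N (\<lambda>x. F x * indicator B (y x))" if [measurable]: "B \<in> sets borel" for B
    by (rule integrable_mult_bounded[OF F, where C = 1]) (auto simp: indicator_def)
  have A': "A \<in> sigma_sets UNIV (range atMost)"
    using A unfolding borel_eq_atMost by (simp add: sets_measure_of)
  have sb: "B \<in> sets borel" if "B \<in> sigma_sets UNIV (range atMost)" for B :: "real set"
    using that unfolding borel_eq_atMost by (simp add: sets_measure_of)
  have stable: "Int_stable (range atMost :: real set set)"
    by (auto simp: Int_stable_def)
  have sub: "range atMost \<subseteq> Pow (UNIV :: real set)" by simp
  from stable sub A' show ?thesis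
  proof (induction rule: sigma_sets_induct_disjoint)
    case (basic A)
    then obtain a where a: "A = {..a}" by auto
    obtain p :: "nat \<Rightarrow> real poly" where p2: "\<And>n z. z \<in> {-1..1} \<Longrightarrow> \<bar>poly (p n) z\<bar> \<le> 2"
      and lim: "\<And>z. z \<in> {-1..1} \<Longrightarrow> (\<lambda>n. poly (p n) z) \<longlonglongrightarrow> indicator {..a} z"
      using polynomial_approx_Iic[of a] by blast
    have "(\<lambda>n. \<integral>x. F x * poly (p n) (y x) \<partial>N) \<longlonglongrightarrow> (\<integral>x. F x * indicator {..a} (y x) \<partial>N)"
    proof (rule integral_dominated_convergence[where w = "\<lambda>x. 2 * \<bar>F x\<bar>"])
      show "integrable N (\<lambda>x. 2 * \<bar>F x\<bar>)" using F by simp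
      show "AE x in N. (\<lambda>n. F x * poly (p n) (y x)) \<longlonglongrightarrow> F x * indicator {..a} (y x)"
        using lim y1 by (auto intro!: AE_I2 tendsto_mult)
      show "AE x in N. norm (F x * poly (p n) (y x)) \<le> 2 * \<bar>F x\<bar>" for n
        using p2 y1 by (auto intro!: AE_I2 mult_right_mono simp: abs_mult mult.commute[of "\<bar>F _\<bar>"])
    qed measurable
    then have "(\<lambda>n. 0) \<longlonglongrightarrow> (\<integral>x. F x * indicator {..a} (y x) \<partial>N)" by (simp only: mom)
    then show ?case unfolding a by (simp add: LIMSEQ_const_iff)
  next
    case empty
    then show ?case by simp
  next
    case (compl A)
    have "(\<integral>x. F x * indicator (UNIV - A) (y x) \<partial>N) = (\<integral>x. F x * poly 1 (y x) - F x * indicator A (y x) \<partial>N)"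
      by (rule Bochner_Integration.integral_cong) (auto simp: indicator_def)
    also have "\<dots> = (\<integral>x. F x * poly 1 (y x) \<partial>N) - (\<integral>x. F x * indicator A (y x) \<partial>N)"
      by (rule Bochner_Integration.integral_diff) (use F intA[OF sb[OF compl(1)]] in auto)
    finally show ?case using mom[of 1] compl by simp
  next
    case (union A)
    have Ab[measurable]: "A i \<in> sets borel" for i using union(2) sb by auto
    have "(\<lambda>n. \<integral>x. F x * indicator (\<Union>i<n. A i) (y x) \<partial>N) \<longlonglongrightarrow> (\<integral>x. F x * indicator (\<Union>i. A i) (y x) \<partial>N)"
    proof (rule integral_dominated_convergence[where w = "\<lambda>x. \<bar>F x\<bar>"])
      show "AE x in N. (\<lambda>n. F x * indicator (\<Union>i<n. A i) (y x)) \<longlonglongrightarrow> F x * indicator (\<Union>i. A i) (y x)"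
        by (intro AE_I2 tendsto_mult tendsto_const LIMSEQ_indicator_UN)
    qed (use F in \<open>auto simp: indicator_def\<close>)
    moreover have "(\<integral>x. F x * indicator (\<Union>i<n. A i) (y x) \<partial>N) = 0" for n
    proof -
      have "disjoint_family_on A {..<n}" using union(1) by (auto simp: disjoint_family_on_def)
      then have "(\<integral>x. F x * indicator (\<Union>i<n. A i) (y x) \<partial>N) = (\<integral>x. (\<Sum>i<n. F x * indicator (A i) (y x)) \<partial>N)"
        by (simp add: indicator_UN_disjoint sum_distrib_left)
      also have "\<dots> = (\<Sum>i<n. \<integral>x. F x * indicator (A i) (y x) \<partial>N)"
        by (rule Bochner_Integration.integral_sum) (rule intA[OF Ab])
      finally show ?thesis using union(3) by simp
    qed
    ultimately show ?case by (simp add: LIMSEQ_const_iff)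
  qed
qed

lemma poly_onp_expansion: "degree p \<le> n \<Longrightarrow> \<exists>c. p = (\<Sum>j\<le>n. smult (c j) (onp F j))"
proof (induction n arbitrary: p)
  case 0
  obtain a where a: "p = [:a:]" using 0 by (metis degree_eq_zeroE le_zero_eq)
  obtain b where b: "onp F 0 = [:b:]" using degree_onp[of F 0] by (metis degree_eq_zeroE)
  have "b \<noteq> 0" using is_orthonormal_poly_onp[of F 0] b by (auto simp: is_orthonormal_poly_def)
  then show ?case by (intro exI[of _ "\<lambda>_. a / b"]) (simp add: a b)
next
  case (Suc n)
  let ?b = "onp F (Suc n)"
  have b: "coeff ?b (Suc n) \<noteq> 0"
    using is_orthonormal_poly_onp[of F "Suc n"] degree_onp[of F "Suc n"] by (auto simp: is_orthonormal_poly_def)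
  define a where "a = coeff p (Suc n) / coeff ?b (Suc n)"
  have "degree (p - smult a ?b) \<le> Suc n"
    using Suc.prems by (intro degree_diff_le) (auto simp: degree_onp)
  moreover have "coeff (p - smult a ?b) (Suc n) = 0" using b by (simp add: a_def)
  ultimately have "p - smult a ?b = 0 \<or> degree (p - smult a ?b) < Suc n" by (rule eq_zero_or_degree_less)
  then have "degree (p - smult a ?b) \<le> n" by auto
  then obtain c where c: "p - smult a ?b = (\<Sum>j\<le>n. smult (c j) (onp F j))" using Suc.IH by blast
  have "p = (\<Sum>j\<le>n. smult (c j) (onp F j)) + smult a ?b" using c by (simp add: algebra_simps)
  also have "\<dots> = (\<Sum>j\<le>Suc n. smult ((c(Suc n := a)) j) (onp F j))" by simp
  finally show ?case by blast
qed

lemma enn2real_eqD: "enn2real a = enn2real b \<Longrightarrow> a \<noteq> \<infinity> \<Longrightarrow> b \<noteq> \<infinity> \<Longrightarrow> a = b"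
  by (cases a; cases b) auto

lemma integrable_mult_tensor_real:
  "\<lbrakk>integrable (cube_measure F d) f\<rbrakk> \<Longrightarrow> integrable (cube_measure F d) (\<lambda>x. f x * tensor_real F d i x)"
  by (rule integrable_mult_bounded[OF _ measurable_tensor_real tensor_real_bound])

text \<open>
  Products of polynomials are combinations of the tensor basis, so \<open>f\<close> is orthogonal to them.
  Replacing the polynomial factors by indicators of Borel sets, one coordinate after another, shows
  that \<open>f\<close> has integral zero over every measurable box.  Its positive and negative parts
  are then densities of finite measures that agree on all boxes, hence coincide.
\<close>

theorem orthogonal_to_tensor_imp_AE_zero:
  assumes f: "integrable (cube_measure F d) (f :: _ \<Rightarrow> real)"
    and orth: "\<And>i. i \<in> multi_indices d \<Longrightarrow> (\<integral>x. f x * tensor_real F d i x \<partial>cube_measure F d) = 0"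
  shows "AE x in cube_measure F d. f x = 0"
proof -
  let ?M = "cube_measure F d"
  interpret prob_space ?M by (rule prob_space_cube_measure)
  have comp: "x l \<in> {-1<..<1}" if "x \<in> space ?M" "l < d" for x l
    using that by (auto simp: space_cube_measure PiE_iff)
  have polys: "(\<integral>x. f x * (\<Prod>l<d. poly (p l) (x l)) \<partial>?M) = 0" for p :: "nat \<Rightarrow> real poly"
  proof -
    have "\<forall>l. \<exists>c. p l = (\<Sum>j\<le>degree (p l). smult (c j) (onp F j))"
      using poly_onp_expansion[OF order_refl] by blast
    from choice[OF this] obtain c where c: "\<And>l. p l = (\<Sum>j\<le>degree (p l). smult (c l j) (onp F j))" by blast
    define G where "G = (\<Pi>\<^sub>E l\<in>{..<d}. {..degree (p l)})"
    define e where "e = (\<lambda>g::nat \<Rightarrow> nat. \<lambda>l. if l < d then g l else 0)"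
    have "poly (p l) z = (\<Sum>j\<le>degree (p l). c l j * poly (onp F j) z)" for l z
      by (subst c) (simp add: poly_sum)
    then have "(\<Prod>l<d. poly (p l) (x l)) = (\<Prod>l<d. \<Sum>j\<le>degree (p l). c l j * poly (onp F j) (x l))" for x
      by simp
    also have "\<dots> x = (\<Sum>g\<in>G. (\<Prod>l<d. c l (g l)) * tensor_real F d (e g) x)" for x
    proof -
      have "(\<Prod>l<d. poly (onp F (g l)) (x l)) = tensor_real F d (e g) x" for g
        unfolding tensor_real_def e_def by (intro prod.cong) auto
      then show ?thesis unfolding G_def by (subst prod_sum_PiE) (auto simp: prod.distrib)
    qed
    finally have expand: "(\<Prod>l<d. poly (p l) (x l)) = (\<Sum>g\<in>G. (\<Prod>l<d. c l (g l)) * tensor_real F d (e g) x)" for x .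
    have "(\<integral>x. f x * (\<Prod>l<d. poly (p l) (x l)) \<partial>?M)
       = (\<integral>x. (\<Sum>g\<in>G. (\<Prod>l<d. c l (g l)) * (f x * tensor_real F d (e g) x)) \<partial>?M)"
      by (simp only: expand sum_distrib_left mult.left_commute)
    also have "\<dots> = (\<Sum>g\<in>G. (\<Prod>l<d. c l (g l)) * (\<integral>x. f x * tensor_real F d (e g) x \<partial>?M))"
      by (subst Bochner_Integration.integral_sum)
         (simp_all only: integral_mult_right_zero integrable_mult_right integrable_mult_tensor_real[OF f])
    also have "\<dots> = 0"
      by (rule sum.neutral) (auto intro!: orth simp: e_def multi_indices_def)
    finally show ?thesis .
  qed
  have step: "(\<integral>x. f x * (\<Prod>l<d. if l < k then indicator (A l) (x l) else poly (p l) (x l)) \<partial>?M) = 0"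
    if "k \<le> d" "\<And>l. A l \<in> sets borel" for A :: "nat \<Rightarrow> real set" and p k
    using that
  proof (induction k arbitrary: A p)
    case 0
    then show ?case using polys by simp
  next
    case (Suc k)
    note [measurable] = Suc.prems(2)
    define g where "g = (\<lambda>l z. if l < k then indicator (A l) z else poly (p l) z :: real)"
    define R where "R = (\<lambda>x. \<Prod>l\<in>{..<d} - {k}. g l (x l))"
    have kd: "k < d" using Suc.prems by simp
    have "\<exists>B. \<forall>z\<in>{-1..1}. \<bar>g l z\<bar> \<le> B" for l
      using poly_bounded_on_interval[of "p l"] by (cases "l < k") (auto simp: g_def intro!: exI[of _ 1] split: split_indicator)
    then obtain B where B: "\<And>l z. z \<in> {-1..1} \<Longrightarrow> \<bar>g l z\<bar> \<le> B l" by metis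
    have mg: "g l \<in> borel_measurable borel" for l
      unfolding g_def by (cases "l < k") auto
    have intR: "integrable ?M (\<lambda>x. f x * R x)"
    proof (rule integrable_mult_bounded[OF f, where C = "\<Prod>l\<in>{..<d} - {k}. B l"])
      show "R \<in> borel_measurable ?M"
        unfolding R_def by (intro borel_measurable_prod measurable_cube_component mg) auto
      show "\<bar>R x\<bar> \<le> (\<Prod>l\<in>{..<d} - {k}. B l)" if "x \<in> space ?M" for x
        unfolding R_def abs_prod
        by (intro prod_mono conjI B abs_ge_zero) (use comp[OF that] less_imp_le in force)
    qed
    have split: "(\<Prod>l<d. if l < Suc k then indicator (A l) (x l) else poly (p l) (x l)) = R x * indicator (A k) (x k)" for x
    proof -
      have "(\<Prod>l<d. if l < Suc k then indicator (A l) (x l) else poly (p l) (x l))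
          = indicator (A k) (x k) * (\<Prod>l\<in>{..<d} - {k}. if l < Suc k then indicator (A l) (x l) else poly (p l) (x l))"
        using kd by (subst prod.remove[of _ k]) auto
      also have "(\<Prod>l\<in>{..<d} - {k}. if l < Suc k then indicator (A l) (x l) else poly (p l) (x l)) = R x"
        unfolding R_def g_def by (intro prod.cong) auto
      finally show ?thesis by (simp add: mult.commute)
    qed
    have "(\<integral>x. (f x * R x) * indicator (A k) (x k) \<partial>?M) = 0"
    proof (rule moments_zero_imp_borel_zero[OF intR])
      show "(\<lambda>x. x k) \<in> borel_measurable ?M"
        using measurable_cube_component[of "\<lambda>z. z"] kd by simp
      show "x k \<in> {-1..1}" if "x \<in> space ?M" for x using comp[OF that kd] by auto
      fix q
      have "R x * poly q (x k) = (\<Prod>l<d. if l < k then indicator (A l) (x l) else poly ((p(k := q)) l) (x l))" for x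
      proof -
        have "(\<Prod>l<d. if l < k then indicator (A l) (x l) else poly ((p(k := q)) l) (x l))
          = poly q (x k) * (\<Prod>l\<in>{..<d} - {k}. if l < k then indicator (A l) (x l) else poly ((p(k := q)) l) (x l))"
          using kd by (subst prod.remove[of _ k]) auto
        also have "(\<Prod>l\<in>{..<d} - {k}. if l < k then indicator (A l) (x l) else poly ((p(k := q)) l) (x l)) = R x"
          unfolding R_def g_def by (intro prod.cong) auto
        finally show ?thesis by (simp add: mult.commute)
      qed
      then show "(\<integral>x. f x * R x * poly q (x k) \<partial>?M) = 0"
        using Suc.IH[of A "p(k := q)"] Suc.prems by (simp only: mult.assoc)
    qed (rule Suc.prems)
    then show ?case by (simp only: split mult.assoc)
  qed
  have boxes: "(\<integral>x. f x * (\<Prod>l<d. indicator (A l) (x l)) \<partial>?M) = 0"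
    if "\<And>l. A l \<in> sets borel" for A :: "nat \<Rightarrow> real set"
  proof -
    have "(\<Prod>l<d. if l < d then indicator (A l) (x l) else poly 0 (x l)) = (\<Prod>l<d. indicator (A l) (x l) :: real)"
      for x :: "nat \<Rightarrow> real"
      by (rule prod.cong) auto
    then show ?thesis using step[of d A "\<lambda>_. 0", OF order_refl that] by (simp only:)
  qed
  define P where "P = density ?M (\<lambda>x. ennreal (f x))"
  define Q where "Q = density ?M (\<lambda>x. ennreal (- f x))"
  have mf[measurable]: "f \<in> borel_measurable ?M" using f by simp
  have fin: "(\<integral>\<^sup>+x. ennreal (f x) \<partial>?M) \<noteq> \<infinity>"
  proof -
    have "(\<integral>\<^sup>+x. ennreal (f x) \<partial>?M) \<le> (\<integral>\<^sup>+x. ennreal (norm (f x)) \<partial>?M)"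
      by (intro nn_integral_mono ennreal_leI) simp
    also have "\<dots> < \<infinity>" using f by (simp add: integrable_iff_bounded)
    finally show ?thesis by simp
  qed
  have "P = Q"
  proof (rule measure_eqI_PiM_finite[where I = "{..<d}" and M = "\<lambda>_. uni_measure F"
      and A = "\<lambda>_::nat. \<Pi>\<^sub>E l\<in>{..<d}. space (uni_measure F)"])
    show "sets P = sets (\<Pi>\<^sub>M l\<in>{..<d}. uni_measure F)" "sets Q = sets (\<Pi>\<^sub>M l\<in>{..<d}. uni_measure F)"
      by (simp_all add: P_def Q_def cube_measure_def)
    show "range (\<lambda>_::nat. \<Pi>\<^sub>E l\<in>{..<d}. space (uni_measure F)) \<subseteq> prod_algebra {..<d} (\<lambda>_. uni_measure F)"
      by (auto intro!: prod_algebraI_finite)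
    have "space ?M = (\<Pi>\<^sub>E l\<in>{..<d}. space (uni_measure F))"
      by (simp add: space_cube_measure space_uni_measure)
    then have sp: "(\<Pi>\<^sub>E l\<in>{..<d}. space (uni_measure F)) = space ?M" ..
    have "emeasure P (\<Pi>\<^sub>E l\<in>{..<d}. space (uni_measure F)) = (\<integral>\<^sup>+x. ennreal (f x) \<partial>?M)"
      unfolding P_def sp by (subst emeasure_density) (auto intro!: nn_integral_cong simp: indicator_def)
    then show "emeasure P (\<Pi>\<^sub>E l\<in>{..<d}. space (uni_measure F)) \<noteq> \<infinity>" using fin by simp
    fix A :: "nat \<Rightarrow> real set" assume A: "\<And>i. i \<in> {..<d} \<Longrightarrow> A i \<in> sets (uni_measure F)"
    have "\<exists>C. C \<in> sets borel \<and> (l < d \<longrightarrow> A l = {-1<..<1} \<inter> C)" for l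
    proof (cases "l < d")
      case True
      then show ?thesis using A[of l] by (auto simp: sets_uni_measure sets_restrict_space)
    next
      case False
      then show ?thesis by (intro exI[of _ "{}"]) auto
    qed
    then have "\<forall>l. \<exists>C. C \<in> sets borel \<and> (l < d \<longrightarrow> A l = {-1<..<1} \<inter> C)" ..
    from choice[OF this] obtain C where C: "\<And>l. C l \<in> sets borel" "\<And>l. l < d \<Longrightarrow> A l = {-1<..<1} \<inter> C l"
      by blast
    have BX: "Pi\<^sub>E {..<d} A \<in> sets ?M" unfolding cube_measure_def by (rule sets_PiM_I_finite) (use A in auto)
    have ind: "indicator (Pi\<^sub>E {..<d} A) x = (\<Prod>l<d. indicator (C l) (x l) :: real)" if x: "x \<in> space ?M" for x
    proof -
      have "x \<in> Pi\<^sub>E {..<d} A \<longleftrightarrow> (\<forall>l<d. x l \<in> C l)"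
        using x C(2) by (auto simp: space_cube_measure PiE_iff)
      moreover have "(\<Prod>l<d. indicator (C l) (x l) :: real) = of_bool (\<forall>l<d. x l \<in> C l)"
        by (cases "\<forall>l<d. x l \<in> C l") (auto simp: indicator_def intro!: prod_zero)
      ultimately show ?thesis by (simp add: indicator_def)
    qed
    have int: "integrable ?M (\<lambda>x. f x * indicator (Pi\<^sub>E {..<d} A) x)"
      by (rule integrable_mult_bounded[OF f, where C = 1]) (use BX in \<open>auto simp: indicator_def\<close>)
    have "(\<integral>x. f x * indicator (Pi\<^sub>E {..<d} A) x \<partial>?M) = (\<integral>x. f x * (\<Prod>l<d. indicator (C l) (x l)) \<partial>?M)"
      by (rule Bochner_Integration.integral_cong) (simp_all add: ind)
    also have "\<dots> = 0" by (rule boxes) (rule C(1))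
    finally have "enn2real (\<integral>\<^sup>+x. ennreal (f x * indicator (Pi\<^sub>E {..<d} A) x) \<partial>?M)
        = enn2real (\<integral>\<^sup>+x. ennreal (- (f x * indicator (Pi\<^sub>E {..<d} A) x)) \<partial>?M)"
      by (simp add: real_lebesgue_integral_def[OF int])
    moreover have "(\<integral>\<^sup>+x. ennreal (f x * indicator (Pi\<^sub>E {..<d} A) x) \<partial>?M) \<noteq> \<infinity>"
      "(\<integral>\<^sup>+x. ennreal (- (f x * indicator (Pi\<^sub>E {..<d} A) x)) \<partial>?M) \<noteq> \<infinity>"
      using int by (simp_all add: real_integrable_def)
    ultimately have "(\<integral>\<^sup>+x. ennreal (f x * indicator (Pi\<^sub>E {..<d} A) x) \<partial>?M)
        = (\<integral>\<^sup>+x. ennreal (- (f x * indicator (Pi\<^sub>E {..<d} A) x)) \<partial>?M)"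
      by (rule enn2real_eqD)
    moreover have "ennreal (f x * indicator S x) = ennreal (f x) * indicator S x"
      "ennreal (- (f x * indicator S x)) = ennreal (- f x) * indicator S x" for x S
      by (simp_all add: indicator_def)
    ultimately show "emeasure P (Pi\<^sub>E {..<d} A) = emeasure Q (Pi\<^sub>E {..<d} A)"
      unfolding P_def Q_def using BX by (simp add: emeasure_density)
  qed (auto simp: space_PiM)
  then have "AE x in ?M. ennreal (f x) = ennreal (- f x)"
    unfolding P_def Q_def by (subst (asm) finite_density_unique) (use fin in auto)
  then show ?thesis
  proof eventually_elim
    case (elim x)
    then show "f x = 0"
      by (cases "f x" "0 :: real" rule: linorder_cases) (auto simp: ennreal_neg)
  qed
qed

section \<open>Coefficients and norms of functions\<close>

lemma L2_space_integrable:
  assumes "f \<in> L2_space (cube_measure F d)"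
  shows "integrable (cube_measure F d) f"
proof -
  interpret prob_space "cube_measure F d" by (rule prob_space_cube_measure)
  show ?thesis
  proof (rule Bochner_Integration.integrable_bound[where f = "\<lambda>x. 1 + (cmod (f x))\<^sup>2"])
    show "integrable (cube_measure F d) (\<lambda>x. 1 + (cmod (f x))\<^sup>2)" using assms by (simp add: L2_space_def)
    show "f \<in> borel_measurable (cube_measure F d)" using assms by (simp add: L2_space_def)
    have "a \<le> 1 + a\<^sup>2" for a :: real
      using zero_le_power2[of "a - 1/2"] by (simp add: power2_eq_square algebra_simps)
    then show "AE x in cube_measure F d. norm (f x) \<le> norm (1 + (cmod (f x))\<^sup>2)" by simp
  qed
qed

lemma coeffs_of_eq:
  "coeffs_of F d f i = (\<integral>x. f x * complex_of_real (tensor_real F d i x) \<partial>cube_measure F d)"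
  by (simp add: coeffs_of_def L2_inner_def tensor_poly_eq)

lemma integrable_mult_tensor:
  assumes "integrable (cube_measure F d) (f :: _ \<Rightarrow> complex)"
  shows "integrable (cube_measure F d) (\<lambda>x. f x * complex_of_real (tensor_real F d i x))"
proof (rule Bochner_Integration.integrable_bound[where f = "\<lambda>x. sup_weight F d i * cmod (f x)"])
  show "integrable (cube_measure F d) (\<lambda>x. sup_weight F d i * cmod (f x))" using assms by simp
  show "(\<lambda>x. f x * complex_of_real (tensor_real F d i x)) \<in> borel_measurable (cube_measure F d)"
    using assms measurable_tensor_real[of F d i] by measurable
  show "AE x in cube_measure F d. norm (f x * complex_of_real (tensor_real F d i x)) \<le> norm (sup_weight F d i * cmod (f x))"
  proof (rule AE_I2)
    fix x assume "x \<in> space (cube_measure F d)"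
    from mult_left_mono[OF tensor_real_bound[OF this, of i], of "cmod (f x)"]
    show "norm (f x * complex_of_real (tensor_real F d i x)) \<le> norm (sup_weight F d i * cmod (f x))"
      using sup_weight_ge_1[of F d i] by (simp add: norm_mult mult.commute)
  qed
qed

lemma tensor_poly_bound:
  "x \<in> space (cube_measure F d) \<Longrightarrow> cmod (tensor_poly F d i x) \<le> weight F d i"
  by (simp add: tensor_poly_eq tensor_real_bound weight_eq)

lemma integrable_tensor_poly: "integrable (cube_measure F d) (tensor_poly F d i)"
proof -
  interpret prob_space "cube_measure F d" by (rule prob_space_cube_measure)
  show ?thesis
    by (rule integrable_const_bound[where B = "weight F d i"])
       (auto intro: tensor_poly_bound measurable_tensor_poly)
qed

lemma integrable_expansion: "integrable (cube_measure F d) (expansion F d I z)"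
  unfolding expansion_def[abs_def]
  by (intro Bochner_Integration.integrable_sum integrable_mult_right integrable_tensor_poly)

lemma coeffs_of_tensor_poly:
  assumes "i \<in> multi_indices d" "j \<in> multi_indices d"
  shows "coeffs_of F d (tensor_poly F d i) j = of_bool (i = j)"
proof -
  have "coeffs_of F d (tensor_poly F d i) j
      = complex_of_real (\<integral>x. tensor_real F d i x * tensor_real F d j x \<partial>cube_measure F d)"
    unfolding coeffs_of_eq tensor_poly_eq by (simp only: of_real_mult[symmetric] integral_complex_of_real)
  then show ?thesis by (simp add: tensor_real_orthonormal[OF assms])
qed

lemma coeffs_of_expansion:
  assumes "I \<subseteq> multi_indices d" "finite I" "j \<in> multi_indices d"
  shows "coeffs_of F d (expansion F d I z) j = (if j \<in> I then z j else 0)"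
proof -
  have "coeffs_of F d (expansion F d I z) j
      = (\<integral>x. (\<Sum>i\<in>I. z i * (tensor_poly F d i x * complex_of_real (tensor_real F d j x))) \<partial>cube_measure F d)"
    unfolding coeffs_of_eq expansion_def by (simp add: sum_distrib_right mult.assoc)
  also have "\<dots> = (\<Sum>i\<in>I. \<integral>x. z i * (tensor_poly F d i x * complex_of_real (tensor_real F d j x)) \<partial>cube_measure F d)"
    by (rule Bochner_Integration.integral_sum)
       (intro integrable_mult_right integrable_mult_tensor integrable_tensor_poly)
  also have "\<dots> = (\<Sum>i\<in>I. z i * coeffs_of F d (tensor_poly F d i) j)"
    by (simp only: coeffs_of_eq integral_mult_right_zero)
  also have "\<dots> = (\<Sum>i\<in>I. if i = j then z i else 0)"
    using assms by (intro sum.cong refl) (auto simp: coeffs_of_tensor_poly subset_eq)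
  finally show ?thesis using assms(2) by simp
qed

lemma coeffs_of_diff:
  assumes "integrable (cube_measure F d) f" "integrable (cube_measure F d) g"
  shows "coeffs_of F d (\<lambda>x. f x - g x) i = coeffs_of F d f i - coeffs_of F d g i"
  unfolding coeffs_of_eq left_diff_distrib
  by (rule Bochner_Integration.integral_diff) (intro integrable_mult_tensor assms)+

lemma coeffs_zero_imp_AE_zero:
  assumes f: "integrable (cube_measure F d) f"
    and orth: "\<And>i. i \<in> multi_indices d \<Longrightarrow> coeffs_of F d f i = 0"
  shows "AE x in cube_measure F d. f x = 0"
proof -
  have "AE x in cube_measure F d. Re (f x) = 0"
  proof (rule orthogonal_to_tensor_imp_AE_zero)
    show "integrable (cube_measure F d) (\<lambda>x. Re (f x))" using f by simp
    fix i assume i: "i \<in> multi_indices d"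
    have "(\<integral>x. Re (f x * complex_of_real (tensor_real F d i x)) \<partial>cube_measure F d) = Re (coeffs_of F d f i)"
      unfolding coeffs_of_eq by (rule integral_Re[OF integrable_mult_tensor[OF f]])
    then show "(\<integral>x. Re (f x) * tensor_real F d i x \<partial>cube_measure F d) = 0" by (simp add: orth[OF i])
  qed
  moreover have "AE x in cube_measure F d. Im (f x) = 0"
  proof (rule orthogonal_to_tensor_imp_AE_zero)
    show "integrable (cube_measure F d) (\<lambda>x. Im (f x))" using f by simp
    fix i assume i: "i \<in> multi_indices d"
    have "(\<integral>x. Im (f x * complex_of_real (tensor_real F d i x)) \<partial>cube_measure F d) = Im (coeffs_of F d f i)"
      unfolding coeffs_of_eq by (rule integral_Im[OF integrable_mult_tensor[OF f]])
    then show "(\<integral>x. Im (f x) * tensor_real F d i x \<partial>cube_measure F d) = 0" by (simp add: orth[OF i])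
  qed
  ultimately show ?thesis by eventually_elim (simp add: complex_eq_iff)
qed

lemma countable_multi_indices: "countable (multi_indices d)"
proof (rule countable_subset)
  show "multi_indices d \<subseteq> (\<lambda>g l. if l < d then g l else 0) ` (\<Pi>\<^sub>E l\<in>{..<d}. UNIV)"
  proof
    fix i assume "i \<in> multi_indices d"
    then have "i = (\<lambda>l. if l < d then restrict i {..<d} l else 0)"
      by (auto simp: multi_indices_def fun_eq_iff not_less)
    then show "i \<in> (\<lambda>g l. if l < d then g l else 0) ` (\<Pi>\<^sub>E l\<in>{..<d}. UNIV)"
      by (rule image_eqI[where x = "restrict i {..<d}"]) simp
  qed
qed (rule countable_image, rule countable_PiE, simp_all)

lemma infinite_multi_indices:
  assumes "1 \<le> d"
  shows "infinite (multi_indices d)"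
proof (rule infinite_super)
  have inj: "inj (\<lambda>k. (\<lambda>_::nat. 0::nat)(0 := k))"
    by (rule injI, drule fun_cong[of _ _ 0]) simp
  show "infinite (range (\<lambda>k. (\<lambda>_::nat. 0::nat)(0 := k)))" using range_inj_infinite[OF inj] .
  show "range (\<lambda>k. (\<lambda>_::nat. 0::nat)(0 := k)) \<subseteq> multi_indices d"
    using assms by (auto simp: multi_indices_def)
qed

text \<open>
  If the weighted coefficients are summable, the expansion converges absolutely and uniformly, and
  its sum \<open>h\<close> obeys the bound.  The function \<open>h\<close> has the same coefficients as \<open>f\<close>, so completeness
  identifies it with \<open>f\<close> almost everywhere.
\<close>

lemma AE_bounded_by_coeffs:
  assumes d: "1 \<le> d" and f: "integrable (cube_measure F d) f"
    and bd: "\<And>T. finite T \<Longrightarrow> T \<subseteq> multi_indices d \<Longrightarrow> (\<Sum>i\<in>T. weight F d i * cmod (coeffs_of F d f i)) \<le> B"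
  shows "AE x in cube_measure F d. cmod (f x) \<le> B"
proof -
  let ?M = "cube_measure F d"
  interpret prob_space ?M by (rule prob_space_cube_measure)
  \<comment> \<open>Enumerating the multi-indices makes the series theorems for sequences of functions available.\<close>
  define e where "e = from_nat_into (multi_indices d)"
  have bij: "bij_betw e UNIV (multi_indices d)"
    unfolding e_def by (rule bij_betw_from_nat_into[OF countable_multi_indices infinite_multi_indices[OF d]])
  have em: "e n \<in> multi_indices d" for n using bij by (auto simp: bij_betw_def)
  have inj: "inj e" using bij by (simp add: bij_betw_def)
  define c where "c = coeffs_of F d f"
  define a where "a = (\<lambda>n. weight F d (e n) * cmod (c (e n)))"
  have a0: "0 \<le> a n" for n using weight_ge_1[of F d "e n"] by (simp add: a_def)
  have part: "(\<Sum>n<N. a n) \<le> B" for N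
  proof -
    have "(\<Sum>n<N. a n) = (\<Sum>i\<in>e ` {..<N}. weight F d i * cmod (c i))"
      unfolding a_def by (subst sum.reindex) (auto intro: inj_on_subset[OF inj])
    also have "\<dots> \<le> B" unfolding c_def by (rule bd) (use em in auto)
    finally show ?thesis .
  qed
  have suma: "summable a" by (rule summableI_nonneg_bounded[OF a0 part])
  define t where "t = (\<lambda>n x. c (e n) * tensor_poly F d (e n) x)"
  have tb: "norm (t n x) \<le> a n" if "x \<in> space ?M" for n x
    using mult_left_mono[OF tensor_poly_bound[OF that, of "e n"], of "cmod (c (e n))"]
    by (simp add: t_def a_def norm_mult mult.commute)
  have tint: "integrable ?M (t n)" for n
    unfolding t_def by (intro integrable_mult_right integrable_tensor_poly)
  have sumt: "summable (\<lambda>n. norm (t n x))" if "x \<in> space ?M" for x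
    by (rule summable_comparison_test'[OF suma, of 0]) (simp only: real_norm_def abs_norm_cancel tb[OF that])
  define h where "h = (\<lambda>x. \<Sum>n. t n x)"
  have hb: "norm (h x) \<le> B" if x: "x \<in> space ?M" for x
  proof -
    have "norm (h x) \<le> (\<Sum>n. norm (t n x))" unfolding h_def by (rule summable_norm[OF sumt[OF x]])
    also have "\<dots> \<le> suminf a" by (rule suminf_le[OF tb[OF x] sumt[OF x] suma])
    also have "\<dots> \<le> B" by (rule suminf_le_const[OF suma part])
    finally show ?thesis .
  qed
  have sint: "summable (\<lambda>n. \<integral>x. norm (t n x) \<partial>?M)"
  proof (rule summable_comparison_test'[OF suma, of 0])
    fix n
    have "(\<integral>x. norm (t n x) \<partial>?M) \<le> a n"
      by (rule integral_le_const[OF integrable_norm[OF tint] AE_I2[OF tb]])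
    then show "norm (\<integral>x. norm (t n x) \<partial>?M) \<le> a n" by simp
  qed
  have hint: "integrable ?M h"
    unfolding h_def by (rule integrable_suminf[OF tint AE_I2[OF sumt] sint])
  have hc: "coeffs_of F d h j = c j" if j: "j \<in> multi_indices d" for j
  proof -
    define tj where "tj = (\<lambda>n x. t n x * complex_of_real (tensor_real F d j x))"
    have tjint: "integrable ?M (tj n)" for n unfolding tj_def by (rule integrable_mult_tensor[OF tint])
    have tjb: "norm (tj n x) \<le> weight F d j * norm (t n x)" if "x \<in> space ?M" for n x
      using mult_left_mono[OF tensor_real_bound[OF that, of j], of "norm (t n x)"]
      by (simp add: tj_def norm_mult weight_eq mult.commute)
    have s1: "summable (\<lambda>n. norm (tj n x))" if "x \<in> space ?M" for x
      by (rule summable_comparison_test'[OF summable_mult[OF sumt[OF that], of "weight F d j"], of 0])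
         (simp only: real_norm_def abs_norm_cancel tjb[OF that])
    have s2: "summable (\<lambda>n. \<integral>x. norm (tj n x) \<partial>?M)"
    proof (rule summable_comparison_test'[OF summable_mult[OF sint, of "weight F d j"], of 0])
      fix n
      have "(\<integral>x. norm (tj n x) \<partial>?M) \<le> (\<integral>x. weight F d j * norm (t n x) \<partial>?M)"
        by (rule integral_mono[OF integrable_norm[OF tjint] integrable_mult_right[OF integrable_norm[OF tint]] tjb])
      then show "norm (\<integral>x. norm (tj n x) \<partial>?M) \<le> weight F d j * (\<integral>x. norm (t n x) \<partial>?M)" by simp
    qed
    have "coeffs_of F d h j = (\<integral>x. (\<Sum>n. tj n x) \<partial>?M)"
      unfolding coeffs_of_eq
    proof (rule Bochner_Integration.integral_cong[OF refl])
      fix x assume x: "x \<in> space ?M"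
      show "h x * complex_of_real (tensor_real F d j x) = (\<Sum>n. tj n x)"
        unfolding h_def tj_def by (rule suminf_mult2[OF summable_norm_cancel[OF sumt[OF x]]])
    qed
    also have "\<dots> = (\<Sum>n. \<integral>x. tj n x \<partial>?M)"
      by (rule integral_suminf[OF tjint AE_I2[OF s1] s2])
    also have "\<dots> = (\<Sum>n. c (e n) * of_bool (e n = j))"
    proof (rule suminf_cong)
      fix n
      have "(\<integral>x. tj n x \<partial>?M) = c (e n) * coeffs_of F d (tensor_poly F d (e n)) j"
        by (simp add: tj_def t_def coeffs_of_eq mult.assoc)
      then show "(\<integral>x. tj n x \<partial>?M) = c (e n) * of_bool (e n = j)" by (simp add: coeffs_of_tensor_poly[OF em j])
    qed
    also have "(\<Sum>n. c (e n) * of_bool (e n = j)) = c j"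
    proof -
      have "j \<in> range e" using bij j by (simp add: bij_betw_def)
      then obtain k where k: "e k = j" by blast
      have "(\<Sum>n. c (e n) * of_bool (e n = j)) = (\<Sum>n\<in>{k}. c (e n) * of_bool (e n = j))"
        by (rule suminf_finite) (use k inj in \<open>auto simp: inj_eq\<close>)
      then show ?thesis using k by simp
    qed
    finally show ?thesis .
  qed
  have "AE x in ?M. f x - h x = 0"
  proof (rule coeffs_zero_imp_AE_zero)
    show "integrable ?M (\<lambda>x. f x - h x)" by (rule Bochner_Integration.integrable_diff[OF f hint])
    show "coeffs_of F d (\<lambda>x. f x - h x) i = 0" if "i \<in> multi_indices d" for i
      using hc[OF that] by (simp only: coeffs_of_diff[OF f hint] c_def) simp
  qed
  then show ?thesis
    using AE_space
  proof eventually_elim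
    case (elim x)
    then have "f x = h x" by simp
    then show ?case using hb elim by simp
  qed
qed

lemma integral_norm_expansion_sq:
  assumes "I \<subseteq> multi_indices d" "finite I"
  shows "(\<integral>x. (cmod (expansion F d I z x))\<^sup>2 \<partial>cube_measure F d) = (\<Sum>i\<in>I. (cmod (z i))\<^sup>2)"
    and "integrable (cube_measure F d) (\<lambda>x. (cmod (expansion F d I z x))\<^sup>2)"
proof -
  let ?M = "cube_measure F d" and ?w = "expansion F d I z"
  have sq: "complex_of_real ((cmod (?w x))\<^sup>2) = (\<Sum>j\<in>I. cnj (z j) * (?w x * complex_of_real (tensor_real F d j x)))" for x
  proof -
    have "complex_of_real ((cmod (?w x))\<^sup>2) = ?w x * cnj (?w x)" by (rule complex_norm_square)
    also have "cnj (?w x) = (\<Sum>j\<in>I. cnj (z j) * complex_of_real (tensor_real F d j x))"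
      by (simp add: expansion_def tensor_poly_eq)
    finally show ?thesis by (simp add: sum_distrib_left mult_ac)
  qed
  have int: "integrable ?M (\<lambda>x. cnj (z j) * (?w x * complex_of_real (tensor_real F d j x)))" for j
    by (intro integrable_mult_right integrable_mult_tensor integrable_expansion)
  have cint: "integrable ?M (\<lambda>x. complex_of_real ((cmod (?w x))\<^sup>2))"
    unfolding sq by (intro Bochner_Integration.integrable_sum int)
  from integrable_Re[OF cint] show "integrable ?M (\<lambda>x. (cmod (?w x))\<^sup>2)" by (simp only: Re_complex_of_real)
  have "complex_of_real (\<integral>x. (cmod (?w x))\<^sup>2 \<partial>?M) = (\<integral>x. complex_of_real ((cmod (?w x))\<^sup>2) \<partial>?M)"
    by (rule integral_complex_of_real[symmetric])
  also have "\<dots> = (\<Sum>j\<in>I. \<integral>x. cnj (z j) * (?w x * complex_of_real (tensor_real F d j x)) \<partial>?M)"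
    unfolding sq by (rule Bochner_Integration.integral_sum) (rule int)
  also have "\<dots> = (\<Sum>j\<in>I. cnj (z j) * coeffs_of F d ?w j)"
    by (simp only: coeffs_of_eq integral_mult_right_zero)
  also have "\<dots> = (\<Sum>j\<in>I. complex_of_real ((cmod (z j))\<^sup>2))"
  proof (rule sum.cong[OF refl])
    fix j assume j: "j \<in> I"
    then have "coeffs_of F d ?w j = z j" using assms by (simp add: coeffs_of_expansion subset_eq)
    then show "cnj (z j) * coeffs_of F d ?w j = complex_of_real ((cmod (z j))\<^sup>2)"
      by (simp only: complex_norm_square mult.commute)
  qed
  finally show "(\<integral>x. (cmod (?w x))\<^sup>2 \<partial>?M) = (\<Sum>i\<in>I. (cmod (z i))\<^sup>2)"
    by (simp only: of_real_sum[symmetric] of_real_eq_iff)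
qed

text \<open>
  By Pythagoras, since \<open>f\<close> minus its own partial expansion is orthogonal to all tensor polynomials
  with index in \<open>I\<close>.
\<close>

lemma L2_norm_expansion_triangle:
  assumes f: "f \<in> L2_space (cube_measure F d)" and I: "I \<subseteq> multi_indices d" "finite I"
  defines "x \<equiv> coeffs_of F d f"
  shows "L2_norm (cube_measure F d) (\<lambda>p. f p - expansion F d I z p)
    \<le> sqrt (\<Sum>i\<in>I. (cmod (z i - x i))\<^sup>2) + L2_norm (cube_measure F d) (\<lambda>p. f p - expansion F d I x p)"
proof -
  let ?M = "cube_measure F d"
  define g where "g = (\<lambda>p. f p - expansion F d I x p)"
  define v where "v = (\<lambda>i. z i - x i)"
  define w where "w = expansion F d I v"
  have fi: "integrable ?M f" by (rule L2_space_integrable[OF f])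
  have gi: "integrable ?M g" unfolding g_def using fi integrable_expansion by (rule Bochner_Integration.integrable_diff)
  have gc: "coeffs_of F d g j = 0" if "j \<in> I" for j
    unfolding g_def using I that
    by (simp add: coeffs_of_diff fi integrable_expansion coeffs_of_expansion subset_eq x_def)
  have [measurable]: "f \<in> borel_measurable ?M" "g \<in> borel_measurable ?M" "w \<in> borel_measurable ?M"
    "expansion F d I x \<in> borel_measurable ?M"
    unfolding w_def by (rule borel_measurable_integrable, (rule fi gi integrable_expansion))+
  have w2: "(\<integral>p. (cmod (w p))\<^sup>2 \<partial>?M) = (\<Sum>i\<in>I. (cmod (v i))\<^sup>2)" "integrable ?M (\<lambda>p. (cmod (w p))\<^sup>2)"
    unfolding w_def by (rule integral_norm_expansion_sq[OF I])+
  have g2: "integrable ?M (\<lambda>p. (cmod (g p))\<^sup>2)"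
  proof (rule Bochner_Integration.integrable_bound[where f = "\<lambda>p. 2 * (cmod (f p))\<^sup>2 + 2 * (cmod (expansion F d I x p))\<^sup>2"])
    show "integrable ?M (\<lambda>p. 2 * (cmod (f p))\<^sup>2 + 2 * (cmod (expansion F d I x p))\<^sup>2)"
      using f integral_norm_expansion_sq(2)[OF I] by (simp add: L2_space_def)
    have "(cmod (a - b))\<^sup>2 \<le> 2 * (cmod a)\<^sup>2 + 2 * (cmod b)\<^sup>2" for a b :: complex
    proof -
      have "(cmod (a - b))\<^sup>2 \<le> (cmod a + cmod b)\<^sup>2" by (intro power_mono norm_triangle_ineq4) simp
      also have "\<dots> \<le> 2 * (cmod a)\<^sup>2 + 2 * (cmod b)\<^sup>2"
        using zero_le_power2[of "cmod a - cmod b"] by (simp add: power2_eq_square algebra_simps)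
      finally show ?thesis .
    qed
    then show "AE p in ?M. norm ((cmod (g p))\<^sup>2) \<le> norm (2 * (cmod (f p))\<^sup>2 + 2 * (cmod (expansion F d I x p))\<^sup>2)"
      by (simp add: g_def)
  qed measurable
  define cr where "cr = (\<lambda>p. g p * cnj (w p))"
  have cr_eq: "cr p = (\<Sum>j\<in>I. cnj (v j) * (g p * complex_of_real (tensor_real F d j p)))" for p
    by (simp add: cr_def w_def expansion_def tensor_poly_eq sum_distrib_left mult_ac)
  have cri: "integrable ?M cr"
    unfolding cr_eq[abs_def] by (intro Bochner_Integration.integrable_sum integrable_mult_right integrable_mult_tensor gi)
  have "(\<integral>p. cr p \<partial>?M) = (\<Sum>j\<in>I. \<integral>p. cnj (v j) * (g p * complex_of_real (tensor_real F d j p)) \<partial>?M)"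
    unfolding cr_eq by (rule Bochner_Integration.integral_sum) (intro integrable_mult_right integrable_mult_tensor gi)
  also have "\<dots> = (\<Sum>j\<in>I. cnj (v j) * coeffs_of F d g j)"
    by (simp only: coeffs_of_eq integral_mult_right_zero)
  also have "\<dots> = 0" using gc by simp
  finally have cr0: "(\<integral>p. Re (cr p) \<partial>?M) = 0" using integral_Re[OF cri] by simp
  have pt: "(cmod (f p - expansion F d I z p))\<^sup>2 = (cmod (g p))\<^sup>2 + (cmod (w p))\<^sup>2 - 2 * Re (cr p)" for p
  proof -
    have "f p - expansion F d I z p = g p - w p"
      by (simp add: g_def w_def v_def expansion_def left_diff_distrib sum_subtractf)
    moreover have "(cmod (a - b))\<^sup>2 = (cmod a)\<^sup>2 + (cmod b)\<^sup>2 - 2 * Re (a * cnj b)" for a b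
      by (simp only: cmod_power2) (simp add: power2_eq_square algebra_simps)
    ultimately show ?thesis by (simp only: cr_def)
  qed
  have "(\<integral>p. (cmod (f p - expansion F d I z p))\<^sup>2 \<partial>?M) = (\<integral>p. (cmod (g p))\<^sup>2 \<partial>?M) + (\<Sum>i\<in>I. (cmod (v i))\<^sup>2)"
  proof -
    have ri: "integrable ?M (\<lambda>p. 2 * Re (cr p))" by (intro integrable_mult_right integrable_Re cri)
    have "(\<integral>p. (cmod (g p))\<^sup>2 + (cmod (w p))\<^sup>2 - 2 * Re (cr p) \<partial>?M)
        = (\<integral>p. (cmod (g p))\<^sup>2 + (cmod (w p))\<^sup>2 \<partial>?M) - (\<integral>p. 2 * Re (cr p) \<partial>?M)"
      by (rule Bochner_Integration.integral_diff[OF Bochner_Integration.integrable_add[OF g2 w2(2)] ri])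
    also have "(\<integral>p. 2 * Re (cr p) \<partial>?M) = 0" by (simp only: integral_mult_right_zero cr0 mult_zero_right)
    also have "(\<integral>p. (cmod (g p))\<^sup>2 + (cmod (w p))\<^sup>2 \<partial>?M) = (\<integral>p. (cmod (g p))\<^sup>2 \<partial>?M) + (\<Sum>i\<in>I. (cmod (v i))\<^sup>2)"
      by (simp only: Bochner_Integration.integral_add[OF g2 w2(2)] w2(1))
    finally show ?thesis by (simp only: pt diff_zero)
  qed
  moreover have "0 \<le> (\<integral>p. (cmod (g p))\<^sup>2 \<partial>?M)" by simp
  moreover have "0 \<le> (\<Sum>i\<in>I. (cmod (v i))\<^sup>2)" by (simp add: sum_nonneg)
  ultimately show ?thesis
    unfolding L2_norm_def g_def[symmetric]
    using sqrt_add_le_add_sqrt[of "\<integral>p. (cmod (g p))\<^sup>2 \<partial>?M" "\<Sum>i\<in>I. (cmod (v i))\<^sup>2"]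
    by (simp add: v_def add.commute)
qed

section \<open>A one-sided uniform law for a convex hull\<close>

lemma exp_minus_le_quadratic:
  fixes x :: real
  assumes "0 \<le> x"
  shows "exp (- x) \<le> 1 - x + x\<^sup>2 / 2"
proof -
  have "1 \<le> (1 - x + x\<^sup>2 / 2) * (1 + x + x\<^sup>2 / 2)"
  proof -
    have "(1 - x + x\<^sup>2 / 2) * (1 + x + x\<^sup>2 / 2) = 1 + (x\<^sup>2)\<^sup>2 / 4"
      by (simp add: field_simps power2_eq_square)
    then show ?thesis by simp
  qed
  also have "\<dots> \<le> (1 - x + x\<^sup>2 / 2) * exp x"
  proof (rule mult_left_mono)
    show "1 + x + x\<^sup>2 / 2 \<le> exp x" by (rule exp_lower_Taylor_quadratic[OF assms])
    have "1 - x + x\<^sup>2 / 2 = ((x - 1)\<^sup>2 + 1) / 2" by (simp add: power2_eq_square field_simps)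
    then show "0 \<le> 1 - x + x\<^sup>2 / 2" by (simp only: zero_le_divide_iff) simp
  qed
  finally show ?thesis by (simp add: exp_minus field_simps)
qed

text \<open>
  Chernoff's method with the exponential moment of \<open>- 2 \<beta> 1\<^sub>B\<close>.  Because the error is allowed to be
  the multiple \<open>\<beta> prob B\<close> plus \<open>\<zeta>\<close>, the exponent is linear in \<open>\<zeta>\<close>; a purely additive
  error \<open>\<zeta>\<close> would give only \<open>\<zeta>\<^sup>2\<close>.
\<close>

lemma (in prob_space) empirical_lower_tail:
  fixes m :: nat and \<beta> \<zeta> :: real
  assumes B: "B \<in> events" and \<beta>: "0 \<le> \<beta>"
  defines "P \<equiv> \<Pi>\<^sub>M k\<in>{..<m}. M"
  shows "measure P {t \<in> space P. (\<Sum>k<m. indicator B (t k)) < real m * ((1 - \<beta>) * prob B - \<zeta>)}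
           \<le> exp (- 2 * \<beta> * \<zeta> * real m)"
proof -
  interpret P: product_prob_space "\<lambda>_. M" "{..<m}" by unfold_locales
  interpret PP: prob_space P unfolding P_def by (rule prob_space_PiM) (rule prob_space_axioms)
  define l where "l = 2 * \<beta>"
  define p where "p = prob B"
  have l0: "0 \<le> l" using \<beta> by (simp add: l_def)
  have p01: "0 \<le> p" "p \<le> 1" by (simp_all add: p_def)
  define a where "a = real m * ((1 - \<beta>) * p - \<zeta>)"
  define Y where "Y = (\<lambda>t. \<Prod>k<m. exp (- l * indicator B (t k) :: real))"
  have Yexp: "Y t = exp (- l * (\<Sum>k<m. indicator B (t k)))" for t
    by (simp add: Y_def exp_sum sum_distrib_left)
  have ind_int: "integrable M (\<lambda>x. exp (- l * indicator B x :: real))"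
    by (rule integrable_const_bound[where B = 1]) (use B l0 in \<open>auto simp: indicator_def\<close>)
  have one: "(\<integral>x. exp (- l * indicator B x :: real) \<partial>M) = 1 - p * (1 - exp (- l))"
  proof -
    have "(\<integral>x. exp (- l * indicator B x :: real) \<partial>M) = (\<integral>x. 1 - (1 - exp (- l)) * indicator B x \<partial>M)"
      by (rule Bochner_Integration.integral_cong) (auto simp: indicator_def)
    also have "\<dots> = 1 - (1 - exp (- l)) * p"
      using B by (subst Bochner_Integration.integral_diff) (auto simp: p_def prob_space less_top[symmetric])
    finally show ?thesis by (simp add: mult.commute)
  qed
  have Yint: "integrable P Y"
    unfolding Y_def P_def by (rule P.product_integrable_prod) (use ind_int in auto)
  have EY: "(\<integral>t. Y t \<partial>P) = (1 - p * (1 - exp (- l))) ^ m"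
    unfolding Y_def P_def by (subst P.product_integral_prod) (use ind_int one in auto)
  have Yub: "(\<integral>t. Y t \<partial>P) \<le> exp (- p * (1 - exp (- l)) * real m)"
  proof -
    have "1 - p * (1 - exp (- l)) \<le> exp (- p * (1 - exp (- l)))"
      using exp_ge_add_one_self[of "- p * (1 - exp (- l))"] by simp
    moreover have "0 \<le> 1 - p * (1 - exp (- l))"
    proof -
      have "p * (1 - exp (- l)) \<le> 1 * 1" by (intro mult_mono) (use p01 l0 in auto)
      then show ?thesis by simp
    qed
    ultimately have "(1 - p * (1 - exp (- l))) ^ m \<le> exp (- p * (1 - exp (- l))) ^ m"
      by (rule power_mono)
    then show ?thesis by (simp add: EY exp_of_nat_mult[symmetric] mult_ac)
  qed
  have "{t \<in> space P. (\<Sum>k<m. indicator B (t k)) < real m * ((1 - \<beta>) * prob B - \<zeta>)}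
          \<subseteq> {t \<in> space P. exp (- l * a) \<le> Y t}"
  proof clarify
    fix t assume "(\<Sum>k<m. indicator B (t k)) < real m * ((1 - \<beta>) * prob B - \<zeta>)"
    then have "l * (\<Sum>k<m. indicator B (t k)) \<le> l * a"
      using l0 by (intro mult_left_mono) (auto simp: a_def p_def)
    then show "exp (- l * a) \<le> Y t" by (simp add: Yexp)
  qed
  then have "PP.prob {t \<in> space P. (\<Sum>k<m. indicator B (t k)) < real m * ((1 - \<beta>) * prob B - \<zeta>)}
          \<le> PP.prob {t \<in> space P. exp (- l * a) \<le> Y t}"
    using Yint by (intro PP.finite_measure_mono) auto
  also have "\<dots> \<le> (\<integral>t. Y t \<partial>P) / exp (- l * a)"
    by (rule integral_Markov_inequality_measure[where A = "{}"])
       (use Yint in \<open>auto simp: Y_def intro!: prod_nonneg\<close>)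
  also have "\<dots> \<le> exp (- p * (1 - exp (- l)) * real m) / exp (- l * a)"
    using Yub by (intro divide_right_mono) auto
  also have "\<dots> = exp (l * a - p * (1 - exp (- l)) * real m)"
    by (simp add: exp_diff[symmetric] add.commute)
  also have "\<dots> \<le> exp (- l * \<zeta> * real m)"
  proof -
    have "l * (1 - \<beta>) \<le> 1 - exp (- l)"
      using exp_minus_le_quadratic[OF l0] by (simp add: l_def power2_eq_square algebra_simps)
    then have "p * real m * (l * (1 - \<beta>)) \<le> p * real m * (1 - exp (- l))"
      using p01 by (intro mult_left_mono) auto
    then show ?thesis by (simp add: a_def algebra_simps)
  qed
  finally show ?thesis by (simp add: l_def)
qed

text \<open>
  Maurey's empirical method at a single point: a point \<open>f\<close> of the convex hull of \<open>D\<close> is the mean of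
  a random element of \<open>D\<close>, and Hoeffding's inequality compares \<open>f(x)\<close> with the value at \<open>x\<close> of
  an average of \<open>N\<close> independent copies.
\<close>

lemma maurey_pointwise:
  fixes D :: "('a \<Rightarrow> real) set" and p :: "('a \<Rightarrow> real) pmf"
  assumes p: "set_pmf p \<subseteq> D" "finite D" and bd: "\<And>h. h \<in> D \<Longrightarrow> \<bar>h x\<bar> \<le> 1"
    and w: "0 \<le> w" and N: "N > 0"
  shows "measure_pmf.prob (Pi_pmf {..<N} (\<lambda>_. 0) (\<lambda>_. p))
           {h. w \<le> \<bar>(\<Sum>k<N. h k x) / real N - measure_pmf.expectation p (\<lambda>h. h x)\<bar>}
         \<le> 2 * exp (- real N * w\<^sup>2 / 2)"
proof -
  let ?Q = "Pi_pmf {..<N} (\<lambda>_. 0) (\<lambda>_. p)"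
  have bdp: "\<bar>h x\<bar> \<le> 1" if "h \<in> set_pmf p" for h using that p bd by auto
  interpret Hoeffding_ineq "measure_pmf ?Q" "{..<N}" "\<lambda>k h. h k x" "\<lambda>_. - 1" "\<lambda>_. 1"
    "real N * measure_pmf.expectation p (\<lambda>h. h x)"
  proof unfold_locales
    show "prob_space.indep_vars (measure_pmf ?Q) (\<lambda>_. borel) (\<lambda>k h. h k x) {..<N}"
      by (rule prob_space.indep_vars_compose2[OF _ indep_vars_Pi_pmf])
         (auto simp: measure_pmf.prob_space_axioms)
    fix i assume i: "i \<in> {..<N}"
    show "AE h in measure_pmf ?Q. h i x \<in> {- 1..1}"
    proof (rule AE_pmfI)
      fix h assume "h \<in> set_pmf ?Q"
      then have "h i \<in> set_pmf p" using i by (auto simp: set_Pi_pmf PiE_dflt_def)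
      then show "h i x \<in> {- 1..1}" using bdp[of "h i"] by (auto simp: abs_le_iff)
    qed
  next
    show "finite {..<N}" by simp
  next
    have "(\<Sum>i<N. measure_pmf.expectation ?Q (\<lambda>h. h i x)) = (\<Sum>i<N. measure_pmf.expectation p (\<lambda>h. h x))"
    proof (rule sum.cong[OF refl])
      fix i assume i: "i \<in> {..<N}"
      have "measure_pmf.expectation ?Q (\<lambda>h. h i x)
              = measure_pmf.expectation (map_pmf (\<lambda>h. h i) ?Q) (\<lambda>h. h x)"
        by simp
      also have "map_pmf (\<lambda>h. h i) ?Q = p" using i by (subst Pi_pmf_component) auto
      finally show "measure_pmf.expectation ?Q (\<lambda>h. h i x) = measure_pmf.expectation p (\<lambda>h. h x)" .
    qed
    then show "real N * measure_pmf.expectation p (\<lambda>h. h x)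
                 \<equiv> (\<Sum>i<N. measure_pmf.expectation ?Q (\<lambda>h. h i x))"
      by (simp add: atomize_eq)
  qed
  have "{h. w \<le> \<bar>(\<Sum>k<N. h k x) / real N - measure_pmf.expectation p (\<lambda>h. h x)\<bar>}
          = {h\<in>space (measure_pmf ?Q). real N * w \<le>
                \<bar>(\<Sum>k<N. h k x) - real N * measure_pmf.expectation p (\<lambda>h. h x)\<bar>}"
  proof -
    have "w \<le> \<bar>S / real N - y\<bar> \<longleftrightarrow> real N * w \<le> \<bar>S - real N * y\<bar>" for S y :: real
    proof -
      have "\<bar>S - real N * y\<bar> = real N * \<bar>S / real N - y\<bar>"
        using N abs_mult[of "real N" "S / real N - y"] by (simp add: right_diff_distrib)
      then show ?thesis using N by simp
    qed
    then show ?thesis by simp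
  qed
  also have "measure_pmf.prob ?Q \<dots> \<le> 2 * exp (- 2 * (real N * w)\<^sup>2 / (\<Sum>k<N. (1 - (- 1 :: real))\<^sup>2))"
    by (rule Hoeffding_ineq_abs_ge) (use w N in auto)
  also have "- 2 * (real N * w)\<^sup>2 / (\<Sum>k<N. (1 - (- 1 :: real))\<^sup>2) = - real N * w\<^sup>2 / 2"
    using N by (simp add: field_simps power2_eq_square)
  finally show ?thesis .
qed

definition averages :: "('a \<Rightarrow> real) set \<Rightarrow> nat \<Rightarrow> ('a \<Rightarrow> real) set" where
  "averages D N = (\<lambda>h x. (\<Sum>k<N. h k x) / real N) ` ({..<N} \<rightarrow>\<^sub>E D)"

lemma finite_averages: "finite D \<Longrightarrow> finite (averages D N)"
  by (simp add: averages_def finite_PiE)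

lemma card_averages: "finite D \<Longrightarrow> card (averages D N) \<le> card D ^ N"
  unfolding averages_def
  by (rule order.trans[OF card_image_le]) (simp_all add: finite_PiE card_PiE)

lemma pmf_exists_le_expectation:
  fixes \<phi> :: "'b \<Rightarrow> real"
  assumes "finite (set_pmf q)" "measure_pmf.expectation q \<phi> \<le> c"
  shows "\<exists>h\<in>set_pmf q. \<phi> h \<le> c"
proof (rule ccontr)
  assume "\<not> ?thesis"
  then have *: "\<And>h. h \<in> set_pmf q \<Longrightarrow> c < \<phi> h" by auto
  have "measure_pmf.expectation q (\<lambda>_. c) < measure_pmf.expectation q \<phi>"
    by (rule measure_pmf.integral_less_AE_space)
       (use * in \<open>auto intro!: integrable_measure_pmf_finite assms simp: AE_measure_pmf_iff emeasure_pmf\<close>)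
  then show False using assms(2) by simp
qed

lemma finite_set_Pi_pmf:
  assumes "finite A" "finite (set_pmf p)"
  shows "finite (set_pmf (Pi_pmf A dflt (\<lambda>_. p)))"
proof (rule finite_subset)
  show "set_pmf (Pi_pmf A dflt (\<lambda>_. p)) \<subseteq> PiE_dflt A dflt (\<lambda>_. set_pmf p)"
    using assms by (simp add: set_Pi_pmf o_def)
qed (use assms in \<open>simp add: finite_PiE_dflt\<close>)

text \<open>
  One average is good at most points, simultaneously for the measure \<open>M\<close> and for the empirical
  measure of \<open>t\<close>: the expected size of the exceptional set, over the random average, is the
  average of the pointwise failure probabilities for either measure.
\<close>

lemma (in prob_space) maurey_exists:
  fixes D :: "('a \<Rightarrow> real) set" and p :: "('a \<Rightarrow> real) pmf" and t :: "nat \<Rightarrow> 'a"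
  assumes D: "finite D" "\<And>h. h \<in> D \<Longrightarrow> h \<in> borel_measurable M"
    and bd: "\<And>h x. h \<in> D \<Longrightarrow> x \<in> space M \<Longrightarrow> \<bar>h x\<bar> \<le> 1"
    and p: "set_pmf p \<subseteq> D" and w: "0 \<le> w" and N: "N > 0" and m: "m > 0"
    and t: "\<And>k. k < m \<Longrightarrow> t k \<in> space M"
  defines "f \<equiv> \<lambda>x. measure_pmf.expectation p (\<lambda>h. h x)"
  shows "\<exists>g\<in>averages D N. prob {x \<in> space M. w \<le> \<bar>g x - f x\<bar>}
           + (\<Sum>k<m. of_bool (w \<le> \<bar>g (t k) - f (t k)\<bar>)) / real m \<le> 4 * exp (- real N * w\<^sup>2 / 2)"
proof -
  let ?Q = "Pi_pmf {..<N} (\<lambda>_. 0) (\<lambda>_. p)"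
  define G :: "(nat \<Rightarrow> 'a \<Rightarrow> real) \<Rightarrow> 'a \<Rightarrow> real" where "G = (\<lambda>h x. (\<Sum>k<N. h k x) / real N)"
  define c where "c = 2 * exp (- real N * w\<^sup>2 / 2)"
  have finp: "finite (set_pmf p)" using D p finite_subset by blast
  have finQ: "finite (set_pmf ?Q)" by (rule finite_set_Pi_pmf) (use finp in auto)
  have mG: "G h \<in> borel_measurable M" if "h \<in> set_pmf ?Q" for h
  proof -
    have "h k \<in> D" if "k < N" for k
      using \<open>h \<in> set_pmf ?Q\<close> that p by (auto simp: set_Pi_pmf PiE_dflt_def)
    then show ?thesis unfolding G_def by (intro borel_measurable_divide borel_measurable_sum) (auto intro: D(2))
  qed
  have f_eq: "f = (\<lambda>x. \<Sum>h\<in>set_pmf p. h x * pmf p h)"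
    unfolding f_def by (intro ext integral_measure_pmf_real finp) 
  have mf: "f \<in> borel_measurable M"
    unfolding f_eq by (intro borel_measurable_sum borel_measurable_times) (use p in \<open>auto intro: D(2)\<close>)
  have pt: "(\<Sum>h\<in>set_pmf ?Q. of_bool (w \<le> \<bar>G h x - f x\<bar>) * pmf ?Q h) \<le> c" if x: "x \<in> space M" for x
  proof -
    have "(\<Sum>h\<in>set_pmf ?Q. of_bool (w \<le> \<bar>G h x - f x\<bar>) * pmf ?Q h)
            = measure_pmf.expectation ?Q (\<lambda>h. indicator {h. w \<le> \<bar>G h x - f x\<bar>} h)"
      by (subst integral_measure_pmf_real[OF finQ]) (auto simp: indicator_def of_bool_def intro!: sum.cong)
    also have "\<dots> = measure_pmf.prob ?Q {h. w \<le> \<bar>G h x - f x\<bar>}"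
      by simp
    also have "\<dots> \<le> c"
      unfolding c_def G_def f_def
      by (rule maurey_pointwise[OF p D(1) _ w N]) (use bd x in auto)
    finally show ?thesis .
  qed
  define \<Phi> where "\<Phi> = (\<lambda>h. prob {x \<in> space M. w \<le> \<bar>G h x - f x\<bar>}
           + (\<Sum>k<m. of_bool (w \<le> \<bar>G h (t k) - f (t k)\<bar>)) / real m)"
  have "measure_pmf.expectation ?Q \<Phi> = (\<Sum>h\<in>set_pmf ?Q. \<Phi> h * pmf ?Q h)"
    by (rule integral_measure_pmf_real[OF finQ])
  also have "\<dots> = (\<Sum>h\<in>set_pmf ?Q. prob {x \<in> space M. w \<le> \<bar>G h x - f x\<bar>} * pmf ?Q h)
     + (\<Sum>k<m. \<Sum>h\<in>set_pmf ?Q. of_bool (w \<le> \<bar>G h (t k) - f (t k)\<bar>) * pmf ?Q h) / real m"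
  proof -
    have "(\<Sum>k<m. \<Sum>h\<in>set_pmf ?Q. of_bool (w \<le> \<bar>G h (t k) - f (t k)\<bar>) * pmf ?Q h) / real m
            = (\<Sum>h\<in>set_pmf ?Q. (\<Sum>k<m. of_bool (w \<le> \<bar>G h (t k) - f (t k)\<bar>)) / real m * pmf ?Q h)"
      by (subst sum.swap) (simp add: sum_divide_distrib sum_distrib_right)
    then show ?thesis by (simp add: \<Phi>_def distrib_right sum.distrib)
  qed
  also have "\<dots> \<le> c + c"
  proof (rule add_mono)
    have "(\<Sum>h\<in>set_pmf ?Q. prob {x \<in> space M. w \<le> \<bar>G h x - f x\<bar>} * pmf ?Q h)
            = (\<Sum>h\<in>set_pmf ?Q. (\<integral>x. of_bool (w \<le> \<bar>G h x - f x\<bar>) * pmf ?Q h \<partial>M))"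
    proof (rule sum.cong[OF refl])
      fix h assume h: "h \<in> set_pmf ?Q"
      have [measurable]: "G h \<in> borel_measurable M" "f \<in> borel_measurable M" using mG[OF h] mf by auto
      have "(\<integral>x. of_bool (w \<le> \<bar>G h x - f x\<bar>) \<partial>M)
              = (\<integral>x. indicator {x \<in> space M. w \<le> \<bar>G h x - f x\<bar>} x \<partial>M)"
        by (rule Bochner_Integration.integral_cong) (auto simp: indicator_def)
      also have "\<dots> = prob {x \<in> space M. w \<le> \<bar>G h x - f x\<bar>}"
        by (simp add: Int_absorb1 Collect_conj_eq)
      finally show "prob {x \<in> space M. w \<le> \<bar>G h x - f x\<bar>} * pmf ?Q h
          = (\<integral>x. of_bool (w \<le> \<bar>G h x - f x\<bar>) * pmf ?Q h \<partial>M)" by simp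
    qed
    also have "\<dots> = (\<integral>x. (\<Sum>h\<in>set_pmf ?Q. of_bool (w \<le> \<bar>G h x - f x\<bar>) * pmf ?Q h) \<partial>M)"
    proof (rule Bochner_Integration.integral_sum[symmetric])
      fix h assume h: "h \<in> set_pmf ?Q"
      have [measurable]: "G h \<in> borel_measurable M" "f \<in> borel_measurable M" using mG[OF h] mf by auto
      show "integrable M (\<lambda>x. of_bool (w \<le> \<bar>G h x - f x\<bar>) * pmf ?Q h)"
        by (rule integrable_const_bound[where B = 1]) (auto simp: pmf_le_1)
    qed
    also have "\<dots> \<le> c"
    proof (rule integral_le_const)
      show "AE x in M. (\<Sum>h\<in>set_pmf ?Q. of_bool (w \<le> \<bar>G h x - f x\<bar>) * pmf ?Q h) \<le> c"
        using pt by auto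
      show "integrable M (\<lambda>x. \<Sum>h\<in>set_pmf ?Q. of_bool (w \<le> \<bar>G h x - f x\<bar>) * pmf ?Q h)"
      proof (rule Bochner_Integration.integrable_sum)
        fix h assume h: "h \<in> set_pmf ?Q"
        have [measurable]: "G h \<in> borel_measurable M" "f \<in> borel_measurable M" using mG[OF h] mf by auto
        show "integrable M (\<lambda>x. of_bool (w \<le> \<bar>G h x - f x\<bar>) * pmf ?Q h)"
          by (rule integrable_const_bound[where B = 1]) (auto simp: pmf_le_1)
      qed
    qed
    finally show "(\<Sum>h\<in>set_pmf ?Q. prob {x \<in> space M. w \<le> \<bar>G h x - f x\<bar>} * pmf ?Q h) \<le> c" .
    have "(\<Sum>k<m. \<Sum>h\<in>set_pmf ?Q. of_bool (w \<le> \<bar>G h (t k) - f (t k)\<bar>) * pmf ?Q h) \<le> (\<Sum>k<m. c)"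
      by (rule sum_mono) (use pt t in auto)
    then show "(\<Sum>k<m. \<Sum>h\<in>set_pmf ?Q. of_bool (w \<le> \<bar>G h (t k) - f (t k)\<bar>) * pmf ?Q h) / real m \<le> c"
      using m by (simp add: field_simps)
  qed
  finally have "measure_pmf.expectation ?Q \<Phi> \<le> 2 * c" by simp
  from pmf_exists_le_expectation[OF finQ this]
  obtain h where h: "h \<in> set_pmf ?Q" "\<Phi> h \<le> 2 * c" by blast
  have "G h \<in> averages D N"
    unfolding averages_def
  proof (rule image_eqI)
    show "restrict h {..<N} \<in> {..<N} \<rightarrow>\<^sub>E D"
      using h(1) p by (auto simp: set_Pi_pmf PiE_dflt_def)
    show "G h = (\<lambda>x. (\<Sum>k<N. restrict h {..<N} k x) / real N)" by (simp add: G_def)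
  qed
  then show ?thesis using h(2) unfolding \<Phi>_def c_def by (intro bexI[of _ "G h"]) auto
qed

text \<open>
  Layer cake from above: \<open>y\<^sup>2\<close> is at most the first \<open>v\<^sub>k\<^sup>2\<close> with \<open>v\<^sub>k\<^sub>+\<^sub>1 < |y|\<close>, and the increments from there on
  telescope.
\<close>

lemma square_le_level_sum:
  fixes v :: "nat \<Rightarrow> real" and y :: real
  assumes "\<And>k. v (Suc k) \<le> v k" "\<And>k. 0 \<le> v k" "\<bar>y\<bar> \<le> v 0"
  shows "y\<^sup>2 \<le> (v R)\<^sup>2 + (\<Sum>k<R. ((v k)\<^sup>2 - (v (Suc k))\<^sup>2) * of_bool (v (Suc k) < \<bar>y\<bar>))"
proof (induction R)
  case 0
  show ?case using assms(2,3) by (simp add: abs_le_square_iff[symmetric])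
next
  case (Suc R)
  have nn: "0 \<le> (v k)\<^sup>2 - (v (Suc k))\<^sup>2" for k
    using assms(1)[of k] assms(2)[of "Suc k"] by (simp add: power_mono)
  show ?case
  proof (cases "v (Suc R) < \<bar>y\<bar>")
    case True
    with Suc show ?thesis by simp
  next
    case False
    then have "y\<^sup>2 \<le> (v (Suc R))\<^sup>2" using assms(2)[of "Suc R"] by (simp add: abs_le_square_iff[symmetric])
    moreover have "0 \<le> (\<Sum>k<Suc R. ((v k)\<^sup>2 - (v (Suc k))\<^sup>2) * of_bool (v (Suc k) < \<bar>y\<bar>))"
      by (intro sum_nonneg mult_nonneg_nonneg nn) auto
    ultimately show ?thesis by linarith
  qed
qed

text \<open>
  Layer cake from below: the increments at heights below \<open>Y\<close> telescope to at most \<open>Y\<close>.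
\<close>

lemma level_sum_le:
  fixes a :: "nat \<Rightarrow> real"
  assumes "\<And>k. a (Suc k) \<le> a k" "\<And>k. 0 \<le> a k" "0 \<le> Y"
  shows "(\<Sum>k<R. (a k - a (Suc k)) * of_bool (a k < Y)) \<le> Y"
proof -
  have "(\<Sum>k<R. (a k - a (Suc k)) * of_bool (a k < Y)) \<le> max 0 (Y - a R)"
  proof (induction R)
    case 0
    then show ?case by simp
  next
    case (Suc R)
    then show ?case using assms(1)[of R] by (cases "a R < Y") (auto simp: max_def split: if_splits)
  qed
  also have "\<dots> \<le> Y" using assms(2)[of R] assms(3) by simp
  finally show ?thesis .
qed

text \<open>
  The heights are \<open>v\<^sub>k = (1 + \<beta>)\<^sup>-\<^sup>k\<close>.  For every \<open>f\<close> in the hull and every \<open>k\<close> there is an average \<open>g\<close> of \<open>N\<^sub>k\<close>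
  elements of \<open>D\<close> within \<open>w\<^sub>k = v\<^sub>k\<^sub>+\<^sub>2 - v\<^sub>k\<^sub>+\<^sub>3\<close> of \<open>f\<close> off a small exceptional set, and then
  \<open>{|f| > v\<^sub>k\<^sub>+\<^sub>1} \<subseteq> {|g| > v\<^sub>k\<^sub>+\<^sub>2} \<subseteq> {|f| > v\<^sub>k\<^sub>+\<^sub>3}\<close> up to that set.  The tail bound is applied to the sets
  \<open>{|g| > v\<^sub>k\<^sub>+\<^sub>2}\<close> only, of which there are finitely many.  Summing over the levels, the shift by three
  heights costs the factor \<open>(1 + \<beta>)\<^sup>6\<close>.

  The number of averages at level \<open>k\<close> has logarithm \<open>N\<^sub>k ln (card D)\<close>, of order \<open>v\<^sub>k\<^sup>-\<^sup>2\<close>.  But level \<open>k\<close>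
  enters the sum with weight of order \<open>v\<^sub>k\<^sup>2\<close>, so that the additive error \<open>\<zeta>\<^sub>k\<close> may be of order
  \<open>v\<^sub>k\<^sup>-\<^sup>2\<close> as well.  Thus all levels need the same number of samples, and their number \<open>R\<close>
  costs a single logarithmic factor.
\<close>

lemma (in prob_space) convex_hull_lower_isometry:
  fixes D :: "('a \<Rightarrow> real) set" and m R :: nat and \<beta> \<eta> \<epsilon> :: real
  assumes D: "finite D" "D \<noteq> {}" "\<And>h. h \<in> D \<Longrightarrow> h \<in> borel_measurable M"
    and bd: "\<And>h x. h \<in> D \<Longrightarrow> x \<in> space M \<Longrightarrow> \<bar>h x\<bar> \<le> 1"
    and \<beta>: "0 < \<beta>" "\<beta> \<le> 1 / 4" and \<eta>: "0 < \<eta>" "\<eta> \<le> 1" and \<epsilon>: "0 < \<epsilon>" "\<epsilon> \<le> 1"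
    and R: "R > 0" "(1 / (1 + \<beta>)) ^ (2 * R) \<le> \<eta> / 4"
    and m: "(2 * (1 + \<beta>) ^ 6 * ln (16 / \<eta>) / \<beta>\<^sup>2 + 1) * ln (card D) + ln (R / \<epsilon>) \<le> m * \<eta> / (4 * R)"
  defines "P \<equiv> \<Pi>\<^sub>M k\<in>{..<m}. M"
  shows "\<exists>E\<in>sets P. 1 - \<epsilon> \<le> measure P E \<and>
     (\<forall>t\<in>E. \<forall>p. set_pmf p \<subseteq> D \<longrightarrow>
        (\<integral>x. (measure_pmf.expectation p (\<lambda>h. h x))\<^sup>2 \<partial>M)
          \<le> (1 + \<beta>) ^ 6 / (1 - \<beta>) * ((\<Sum>k<m. (measure_pmf.expectation p (\<lambda>h. h (t k)))\<^sup>2) / m) + \<eta>)"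
proof (cases "m > 0")
  case False
  \<comment> \<open>With no samples the condition on \<open>m\<close> forces \<open>\<epsilon> = 1\<close>, and the empty event will do.\<close>
  have "ln (real R / \<epsilon>) \<le> 0"
  proof -
    have "0 \<le> (2 * (1 + \<beta>) ^ 6 * ln (16 / \<eta>) / \<beta>\<^sup>2 + 1) * ln (card D)"
      using \<beta> \<eta> D(1,2) by (intro mult_nonneg_nonneg add_nonneg_nonneg divide_nonneg_nonneg)
        (auto simp: Suc_le_eq card_gt_0_iff)
    then show ?thesis using m False by simp
  qed
  then have "real R \<le> \<epsilon>" using R \<epsilon> by (simp add: ln_le_zero_iff divide_le_eq)
  then have "1 \<le> \<epsilon>" using R(1) by (smt (verit) One_nat_def Suc_leI of_nat_1 of_nat_mono)
  then show ?thesis by (intro bexI[of _ "{}"]) auto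
next
  case m0: True
  interpret P: product_prob_space "\<lambda>_. M" "{..<m}" by unfold_locales
  interpret PP: prob_space P unfolding P_def by (rule prob_space_PiM) (rule prob_space_axioms)
  define v where "v = (\<lambda>k::nat. (1 / (1 + \<beta>)) ^ k)"
  define w where "w = (\<lambda>k. v (k + 2) - v (k + 3))"
  \<comment> \<open>Level \<open>k\<close> has weight at most \<open>2 \<beta> v\<^sub>k\<^sup>2\<close>, so each level contributes \<open>\<eta> / (4 R)\<close> to the error.\<close>
  define \<zeta> where "\<zeta> = (\<lambda>k. \<eta> / (8 * \<beta> * R * (v k)\<^sup>2))"
  \<comment> \<open>This makes the measure of the exceptional sets of the averages at most \<open>\<eta> / 4\<close>.\<close>
  define N where "N = (\<lambda>k. nat \<lceil>2 * ln (16 / \<eta>) / (w k)\<^sup>2\<rceil>)"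
  define B where "B = (\<lambda>k g. {x \<in> space M. v (k + 2) < \<bar>g x\<bar>})"
  have vpos: "0 < v k" for k using \<beta> by (simp add: v_def)
  have vSuc: "v k = (1 + \<beta>) * v (Suc k)" for k using \<beta> by (simp add: v_def)
  have vdec: "v (Suc k) \<le> v k" for k using vpos[of "Suc k"] \<beta> by (simp add: vSuc[of k] distrib_right)
  have vle1: "v k \<le> 1" for k using \<beta> by (simp add: v_def power_le_one)
  have w_eq: "w k = \<beta> * v (k + 3)" for k
    using vSuc[of "k + 2"] by (simp add: w_def numeral_eq_Suc algebra_simps)
  have wpos: "0 < w k" for k using \<beta> vpos by (simp add: w_eq)
  have w_le: "w k \<le> v (k + 1) - v (k + 2)" for k
  proof -
    have "v (k + 1) - v (k + 2) = \<beta> * v (k + 2)"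
      using vSuc[of "k + 1"] by (simp add: numeral_eq_Suc algebra_simps)
    then show ?thesis using vdec[of "k + 2"] \<beta> by (simp add: w_eq numeral_eq_Suc)
  qed
  have v3: "v k = (1 + \<beta>) ^ 3 * v (k + 3)" for k
    using vSuc[of k] vSuc[of "Suc k"] vSuc[of "Suc (Suc k)"]
    by (simp add: numeral_eq_Suc mult.assoc)
  have v6: "(v k)\<^sup>2 = (1 + \<beta>) ^ 6 * (v (k + 3))\<^sup>2" for k
    unfolding v3[of k] by (simp add: power_mult_distrib flip: power_mult)
  have lnpos: "0 < ln (16 / \<eta>)" using \<eta> by (intro ln_gt_zero) (simp add: field_simps)
  have Npos: "0 < N k" for k
    using lnpos wpos[of k] by (simp add: N_def)
  have Nlow: "2 * ln (16 / \<eta>) / (w k)\<^sup>2 \<le> N k" for k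
    unfolding N_def by linarith
  have Nup: "N k \<le> 2 * ln (16 / \<eta>) / (w k)\<^sup>2 + 1" for k
  proof -
    have "0 \<le> 2 * ln (16 / \<eta>) / (w k)\<^sup>2" using lnpos by simp
    then show ?thesis unfolding N_def by linarith
  qed
  have Bev: "B k g \<in> events" if "g \<in> averages D n" for k g n
  proof -
    have [measurable]: "g \<in> borel_measurable M"
      using that D(3) unfolding averages_def
      by (auto intro!: borel_measurable_divide borel_measurable_sum)
    show ?thesis unfolding B_def by measurable
  qed
  define Bad where "Bad = (\<lambda>k g. {t \<in> space P.
     (\<Sum>j<m. indicator (B k g) (t j)) < real m * ((1 - \<beta>) * prob (B k g) - \<zeta> k)})"
  have Bad_ev: "Bad k g \<in> PP.events" if "g \<in> averages D n" for k g n
  proof -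
    have [measurable]: "B k g \<in> events" using Bev[OF that] .
    show ?thesis unfolding Bad_def P_def by measurable
  qed
  have Bad_le: "PP.prob (Bad k g) \<le> exp (- 2 * \<beta> * \<zeta> k * real m)" if "g \<in> averages D n" for k g n
    unfolding Bad_def P_def using Bev[OF that] \<beta> by (intro empirical_lower_tail) auto
  define E where "E = space P - (\<Union>k<R. \<Union>g\<in>averages D (N k). Bad k g)"
  have Uev: "(\<Union>k<R. \<Union>g\<in>averages D (N k). Bad k g) \<in> PP.events"
    using Bad_ev by (intro sets.finite_UN) (auto simp: finite_averages D)
  have Eev: "E \<in> PP.events" unfolding E_def using Uev by auto
  have level: "PP.prob (\<Union>g\<in>averages D (N k). Bad k g) \<le> \<epsilon> / R" for k
  proof -
    have cD: "0 < card D" using D by (simp add: card_gt_0_iff)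
    have "PP.prob (\<Union>g\<in>averages D (N k). Bad k g) \<le> (\<Sum>g\<in>averages D (N k). PP.prob (Bad k g))"
      by (rule measure_UNION_le) (auto simp: finite_averages D Bad_ev)
    also have "\<dots> \<le> (\<Sum>g\<in>averages D (N k). exp (- 2 * \<beta> * \<zeta> k * real m))"
      by (intro sum_mono Bad_le)
    also have "\<dots> \<le> real (card D ^ N k) * exp (- 2 * \<beta> * \<zeta> k * real m)"
      unfolding sum_constant using card_averages[OF D(1)] by (intro mult_right_mono) (auto simp: of_nat_mono)
    also have "real (card D ^ N k) = exp (real (N k) * ln (card D))"
      using cD by (simp add: exp_of_nat_mult)
    also have "exp (real (N k) * ln (card D)) * exp (- 2 * \<beta> * \<zeta> k * real m)
       = exp (real (N k) * ln (card D) - 2 * \<beta> * \<zeta> k * real m)"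
      by (simp add: exp_add[symmetric])
    also have "\<dots> \<le> exp (ln (\<epsilon> / R))"
    proof (subst exp_le_cancel_iff)
      have v2: "0 < (v k)\<^sup>2" "(v k)\<^sup>2 \<le> 1" using vpos[of k] vle1[of k] by (auto simp: power_le_one)
      have lnc: "0 \<le> ln (card D)" using cD by simp
      have wv: "(w k)\<^sup>2 = \<beta>\<^sup>2 * (v k)\<^sup>2 / (1 + \<beta>) ^ 6"
        using \<beta> by (simp add: w_eq v6[of k] power_mult_distrib)
      have "real (N k) * ln (card D) * (v k)\<^sup>2
              \<le> (2 * ln (16 / \<eta>) / (w k)\<^sup>2 + 1) * ln (card D) * (v k)\<^sup>2"
        using Nup lnc by (intro mult_right_mono) auto
      also have "\<dots> = (2 * (1 + \<beta>) ^ 6 * ln (16 / \<eta>) / \<beta>\<^sup>2 + (v k)\<^sup>2) * ln (card D)"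
        using v2 \<beta> by (simp add: wv field_simps)
      also have "\<dots> \<le> (2 * (1 + \<beta>) ^ 6 * ln (16 / \<eta>) / \<beta>\<^sup>2 + 1) * ln (card D)"
        using v2 lnc by (intro mult_right_mono) auto
      finally have 1: "real (N k) * ln (card D) * (v k)\<^sup>2
          \<le> (2 * (1 + \<beta>) ^ 6 * ln (16 / \<eta>) / \<beta>\<^sup>2 + 1) * ln (card D)" .
      have lnR: "0 \<le> ln (R / \<epsilon>)" using R \<epsilon> by (intro ln_ge_zero) (simp add: field_simps)
      have 2: "ln (R / \<epsilon>) * (v k)\<^sup>2 \<le> ln (R / \<epsilon>)"
        using v2 lnR by (intro mult_left_le) auto
      have "(real (N k) * ln (card D) + ln (R / \<epsilon>)) * (v k)\<^sup>2 \<le> m * \<eta> / (4 * R)"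
        using 1 2 m by (simp add: distrib_right)
      also have "\<dots> = (2 * \<beta> * \<zeta> k * real m) * (v k)\<^sup>2"
        using v2 \<beta> R by (simp add: \<zeta>_def field_simps)
      finally have "real (N k) * ln (card D) + ln (R / \<epsilon>) \<le> 2 * \<beta> * \<zeta> k * real m"
        using v2 by (simp add: mult_le_cancel_right)
      then show "real (N k) * ln (card D) - 2 * \<beta> * \<zeta> k * real m \<le> ln (\<epsilon> / R)"
        using R \<epsilon> by (simp add: ln_div)
    qed
    also have "exp (ln (\<epsilon> / R)) = \<epsilon> / R" using \<epsilon> R by simp
    finally show ?thesis .
  qed
  have "PP.prob (\<Union>k<R. \<Union>g\<in>averages D (N k). Bad k g)
          \<le> (\<Sum>k<R. PP.prob (\<Union>g\<in>averages D (N k). Bad k g))"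
    by (rule measure_UNION_le) (auto intro!: sets.finite_UN simp: finite_averages D Bad_ev)
  also have "\<dots> \<le> (\<Sum>k<R. \<epsilon> / R)" by (intro sum_mono level)
  also have "\<dots> = \<epsilon>" using R by simp
  finally have PE: "1 - \<epsilon> \<le> PP.prob E"
    unfolding E_def using PP.prob_compl[OF Uev] by simp
  show ?thesis
  proof (intro bexI[of _ E] conjI ballI allI impI)
    show "1 - \<epsilon> \<le> PP.prob E" "E \<in> PP.events" by fact+
    fix t p assume t: "t \<in> E" and p: "set_pmf p \<subseteq> D"
    define f where "f = (\<lambda>x. measure_pmf.expectation p (\<lambda>h. h x))"
    have finp: "finite (set_pmf p)" using D p finite_subset by blast
    have f_eq: "f = (\<lambda>x. \<Sum>h\<in>set_pmf p. h x * pmf p h)"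
      unfolding f_def by (intro ext integral_measure_pmf_real finp)
    have mf[measurable]: "f \<in> borel_measurable M"
      unfolding f_eq by (intro borel_measurable_sum borel_measurable_times) (use p in \<open>auto intro: D\<close>)
    have f1: "\<bar>f x\<bar> \<le> 1" if "x \<in> space M" for x
    proof -
      have "\<bar>f x\<bar> \<le> (\<Sum>h\<in>set_pmf p. \<bar>h x * pmf p h\<bar>)" unfolding f_eq by (rule sum_abs)
      also have "\<dots> \<le> (\<Sum>h\<in>set_pmf p. 1 * pmf p h)"
        unfolding abs_mult using bd that p by (intro sum_mono mult_mono) auto
      also have "\<dots> = 1" using finp by (simp add: sum_pmf_eq_1)
      finally show ?thesis .
    qed
    have tk: "t k \<in> space M" if "k < m" for k
      using t that unfolding E_def P_def by (auto simp: space_PiM)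
    define emp where "emp = (\<lambda>k. \<Sum>j<m. of_bool (v (k + 3) < \<bar>f (t j)\<bar>) :: real)"
    define F where "F = (\<lambda>k. {x \<in> space M. v (k + 1) < \<bar>f x\<bar>})"
    have key: "(1 - \<beta>) * prob (F k) \<le> emp k / m + \<zeta> k + \<eta> / 4" if k: "k < R" for k
    proof -
      have "\<exists>g\<in>averages D (N k). prob {x \<in> space M. w k \<le> \<bar>g x - f x\<bar>}
           + (\<Sum>j<m. of_bool (w k \<le> \<bar>g (t j) - f (t j)\<bar>)) / real m \<le> 4 * exp (- real (N k) * (w k)\<^sup>2 / 2)"
        unfolding f_def
        by (rule maurey_exists) (use D bd p wpos[of k] Npos[of k] m0 tk in auto)
      then obtain g where g: "g \<in> averages D (N k)"
        and gb: "prob {x \<in> space M. w k \<le> \<bar>g x - f x\<bar>}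
           + (\<Sum>j<m. of_bool (w k \<le> \<bar>g (t j) - f (t j)\<bar>)) / real m \<le> 4 * exp (- real (N k) * (w k)\<^sup>2 / 2)"
        by blast
      have [measurable]: "g \<in> borel_measurable M"
        using g D(3) unfolding averages_def
        by (auto intro!: borel_measurable_divide borel_measurable_sum)
      have W: "{x \<in> space M. w k \<le> \<bar>g x - f x\<bar>} \<in> events" by measurable
      define b1 where "b1 = prob {x \<in> space M. w k \<le> \<bar>g x - f x\<bar>}"
      define b2 where "b2 = (\<Sum>j<m. of_bool (w k \<le> \<bar>g (t j) - f (t j)\<bar>) :: real)"
      have e: "4 * exp (- real (N k) * (w k)\<^sup>2 / 2) \<le> \<eta> / 4"
      proof -
        have "ln (16 / \<eta>) \<le> real (N k) * (w k)\<^sup>2 / 2"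
          using Nlow[of k] wpos[of k] by (simp add: field_simps)
        then have "exp (- real (N k) * (w k)\<^sup>2 / 2) \<le> exp (- ln (16 / \<eta>))" by simp
        also have "\<dots> = \<eta> / 16" using \<eta> by (simp add: exp_minus)
        finally show ?thesis by simp
      qed
      have b12: "b1 + b2 / m \<le> \<eta> / 4" unfolding b1_def b2_def by (rule order.trans[OF gb e])
      have "prob (F k) \<le> prob (B k g \<union> {x \<in> space M. w k \<le> \<bar>g x - f x\<bar>})"
      proof (rule finite_measure_mono)
        show "F k \<subseteq> B k g \<union> {x \<in> space M. w k \<le> \<bar>g x - f x\<bar>}"
          unfolding F_def B_def using w_le[of k] by auto
      qed (use Bev[OF g] W in auto)
      also have "\<dots> \<le> prob (B k g) + b1"
        unfolding b1_def by (rule measure_Un_le) (use Bev[OF g] W in auto)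
      finally have "(1 - \<beta>) * prob (F k) \<le> (1 - \<beta>) * (prob (B k g) + b1)"
        using \<beta> by (intro mult_left_mono) auto
      also have "\<dots> \<le> (1 - \<beta>) * prob (B k g) + b1"
        using \<beta> by (simp add: distrib_left b1_def mult_left_le_one_le)
      finally have 1: "(1 - \<beta>) * prob (F k) \<le> (1 - \<beta>) * prob (B k g) + b1" .
      have tsp: "t \<in> space P" and "t \<notin> Bad k g" using t g k by (auto simp: E_def)
      then have "real m * ((1 - \<beta>) * prob (B k g) - \<zeta> k) \<le> (\<Sum>j<m. indicator (B k g) (t j))"
        by (auto simp: Bad_def)
      also have "\<dots> \<le> (\<Sum>j<m. of_bool (v (k + 3) < \<bar>f (t j)\<bar>) + of_bool (w k \<le> \<bar>g (t j) - f (t j)\<bar>))"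
      proof (rule sum_mono)
        fix j assume "j \<in> {..<m}"
        show "indicator (B k g) (t j)
                \<le> (of_bool (v (k + 3) < \<bar>f (t j)\<bar>) + of_bool (w k \<le> \<bar>g (t j) - f (t j)\<bar>) :: real)"
          by (auto simp: B_def w_def indicator_def)
      qed
      also have "\<dots> = emp k + b2" by (simp add: emp_def b2_def sum.distrib)
      finally have "(1 - \<beta>) * prob (B k g) - \<zeta> k \<le> emp k / m + b2 / m"
        using m0 by (simp add: field_simps)
      then show ?thesis using 1 b12 by linarith
    qed
    define a where "a = (\<lambda>k. (v k)\<^sup>2 - (v (Suc k))\<^sup>2)"
    have a0: "0 \<le> a k" for k
      using vdec[of k] vpos[of "Suc k"] by (simp add: a_def power_mono)
    have a_sum: "(\<Sum>k<R. a k) \<le> 1"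
      unfolding a_def by (subst sum_lessThan_telescope') (simp add: v_def)
    have a_le: "a k \<le> 2 * \<beta> * (v k)\<^sup>2" for k
    proof -
      have "1 - 2 * \<beta> \<le> 1 / (1 + \<beta>)\<^sup>2"
      proof -
        have "(1 - 2 * \<beta>) * (1 + \<beta>)\<^sup>2 = 1 - 3 * \<beta>\<^sup>2 - 2 * \<beta> ^ 3"
          by (simp add: power2_eq_square power3_eq_cube algebra_simps)
        also have "\<dots> \<le> 1" using \<beta> zero_le_power[of \<beta> 2] zero_le_power[of \<beta> 3] by linarith
        finally show ?thesis using \<beta> by (simp add: pos_le_divide_eq)
      qed
      then have "(1 - 2 * \<beta>) * (v k)\<^sup>2 \<le> 1 / (1 + \<beta>)\<^sup>2 * (v k)\<^sup>2" by (rule mult_right_mono) simp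
      also have "\<dots> = (v (Suc k))\<^sup>2" using \<beta> by (simp add: vSuc[of k] power_mult_distrib)
      finally show ?thesis by (simp add: a_def algebra_simps)
    qed
    have a3: "a k = (1 + \<beta>) ^ 6 * a (k + 3)" for k
      using v6[of k] v6[of "Suc k"] by (simp add: a_def right_diff_distrib)
    have int_f2: "integrable M (\<lambda>x. (f x)\<^sup>2)"
      by (rule integrable_const_bound[where B = 1]) (use f1 in \<open>auto simp: abs_square_le_1\<close>)
    have intF: "integrable M (\<lambda>x. of_bool (v (Suc k) < \<bar>f x\<bar>) :: real)" for k
      by (rule integrable_const_bound[where B = 1]) auto
    have "(\<integral>x. (f x)\<^sup>2 \<partial>M) \<le> (\<integral>x. (v R)\<^sup>2 + (\<Sum>k<R. a k * of_bool (v (Suc k) < \<bar>f x\<bar>)) \<partial>M)"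
    proof (rule integral_mono[OF int_f2])
      show "integrable M (\<lambda>x. (v R)\<^sup>2 + (\<Sum>k<R. a k * of_bool (v (Suc k) < \<bar>f x\<bar>)))"
        by (intro Bochner_Integration.integrable_add Bochner_Integration.integrable_sum integrable_mult_right intF) auto
      fix x assume "x \<in> space M"
      then show "(f x)\<^sup>2 \<le> (v R)\<^sup>2 + (\<Sum>k<R. a k * of_bool (v (Suc k) < \<bar>f x\<bar>))"
        unfolding a_def using f1 vpos vdec
        by (intro square_le_level_sum) (auto simp: less_imp_le v_def)
    qed
    also have "\<dots> = (v R)\<^sup>2 + (\<Sum>k<R. a k * prob (F k))"
    proof -
      have "(\<integral>x. of_bool (v (Suc k) < \<bar>f x\<bar>) \<partial>M) = prob (F k)" for k
      proof -
        have "(\<integral>x. of_bool (v (Suc k) < \<bar>f x\<bar>) \<partial>M) = (\<integral>x. indicator (F k) x \<partial>M)"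
          by (rule Bochner_Integration.integral_cong) (auto simp: indicator_def F_def)
        also have "\<dots> = prob (F k)" by (simp add: F_def Int_absorb1 Collect_conj_eq)
        finally show ?thesis .
      qed
      then have "(\<Sum>k<R. a k * prob (F k)) = (\<Sum>k<R. \<integral>x. a k * of_bool (v (Suc k) < \<bar>f x\<bar>) \<partial>M)"
        by (simp only: integral_mult_right_zero)
      also have "\<dots> = (\<integral>x. (\<Sum>k<R. a k * of_bool (v (Suc k) < \<bar>f x\<bar>)) \<partial>M)"
        by (rule Bochner_Integration.integral_sum[symmetric]) (intro integrable_mult_right intF)
      finally have s: "(\<Sum>k<R. a k * prob (F k)) = (\<integral>x. (\<Sum>k<R. a k * of_bool (v (Suc k) < \<bar>f x\<bar>)) \<partial>M)" .
      have "(\<integral>x. (v R)\<^sup>2 + (\<Sum>k<R. a k * of_bool (v (Suc k) < \<bar>f x\<bar>)) \<partial>M)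
         = (\<integral>x. (v R)\<^sup>2 \<partial>M) + (\<integral>x. (\<Sum>k<R. a k * of_bool (v (Suc k) < \<bar>f x\<bar>)) \<partial>M)"
        by (intro Bochner_Integration.integral_add Bochner_Integration.integrable_sum integrable_mult_right intF) auto
      then show ?thesis unfolding s by (simp only: lebesgue_integral_const prob_space scaleR_one)
    qed
    finally have "(1 - \<beta>) * (\<integral>x. (f x)\<^sup>2 \<partial>M) \<le> (1 - \<beta>) * ((v R)\<^sup>2 + (\<Sum>k<R. a k * prob (F k)))"
      using \<beta> by (intro mult_left_mono) auto
    also have "\<dots> = (1 - \<beta>) * (v R)\<^sup>2 + (\<Sum>k<R. a k * ((1 - \<beta>) * prob (F k)))"
      by (simp only: distrib_left sum_distrib_left mult.left_commute)
    also have "(1 - \<beta>) * (v R)\<^sup>2 \<le> (v R)\<^sup>2" using \<beta> by (intro mult_left_le_one_le) auto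
    also have "(\<Sum>k<R. a k * ((1 - \<beta>) * prob (F k))) \<le> (\<Sum>k<R. a k * (emp k / m + \<zeta> k + \<eta> / 4))"
      using a0 key by (intro sum_mono mult_left_mono) auto
    also have "\<dots> = (\<Sum>k<R. a k * emp k) / m + (\<Sum>k<R. a k * \<zeta> k) + (\<Sum>k<R. a k) * (\<eta> / 4)"
      by (simp only: distrib_left sum.distrib sum_distrib_right sum_divide_distrib times_divide_eq_right)
    also have "(\<Sum>k<R. a k * emp k) = (1 + \<beta>) ^ 6 * (\<Sum>j<m. \<Sum>k<R. a (k + 3) * of_bool (v (k + 3) < \<bar>f (t j)\<bar>))"
    proof -
      have "(\<Sum>k<R. a k * emp k)
          = (\<Sum>k<R. \<Sum>j<m. (1 + \<beta>) ^ 6 * (a (k + 3) * of_bool (v (k + 3) < \<bar>f (t j)\<bar>)))"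
      proof (rule sum.cong[OF refl])
        fix k
        show "a k * emp k = (\<Sum>j<m. (1 + \<beta>) ^ 6 * (a (k + 3) * of_bool (v (k + 3) < \<bar>f (t j)\<bar>)))"
          by (simp only: emp_def sum_distrib_left a3[of k] mult.assoc)
      qed
      also have "\<dots> = (\<Sum>j<m. \<Sum>k<R. (1 + \<beta>) ^ 6 * (a (k + 3) * of_bool (v (k + 3) < \<bar>f (t j)\<bar>)))"
        by (rule sum.swap)
      finally show ?thesis by (simp only: sum_distrib_left)
    qed
    also have "(\<Sum>j<m. \<Sum>k<R. a (k + 3) * of_bool (v (k + 3) < \<bar>f (t j)\<bar>)) \<le> (\<Sum>j<m. (f (t j))\<^sup>2)"
    proof (rule sum_mono)
      fix j
      have "(\<Sum>k<R. a (k + 3) * of_bool (v (k + 3) < \<bar>f (t j)\<bar>))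
              = (\<Sum>k<R. ((v (k + 3))\<^sup>2 - (v (Suc k + 3))\<^sup>2) * of_bool ((v (k + 3))\<^sup>2 < (f (t j))\<^sup>2))"
      proof (rule sum.cong[OF refl])
        fix k
        have "v (k + 3) < \<bar>f (t j)\<bar> \<longleftrightarrow> (v (k + 3))\<^sup>2 < (f (t j))\<^sup>2"
          using vpos[of "k + 3"] abs_le_square_iff[of "f (t j)" "v (k + 3)"] by (simp add: not_le[symmetric])
        then show "a (k + 3) * of_bool (v (k + 3) < \<bar>f (t j)\<bar>)
          = ((v (k + 3))\<^sup>2 - (v (Suc k + 3))\<^sup>2) * of_bool ((v (k + 3))\<^sup>2 < (f (t j))\<^sup>2)"
          by (simp only: a_def add_Suc)
      qed
      also have "\<dots> \<le> (f (t j))\<^sup>2"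
      proof (rule level_sum_le[where a = "\<lambda>k. (v (k + 3))\<^sup>2"])
        fix k
        show "(v (Suc k + 3))\<^sup>2 \<le> (v (k + 3))\<^sup>2"
          using vdec[of "k + 3"] vpos[of "Suc k + 3"] by (intro power_mono) (auto simp: less_imp_le)
      qed auto
      finally show "(\<Sum>k<R. a (k + 3) * of_bool (v (k + 3) < \<bar>f (t j)\<bar>)) \<le> (f (t j))\<^sup>2" .
    qed
    also have "(\<Sum>k<R. a k * \<zeta> k) \<le> (\<Sum>k<R. \<eta> / (4 * R))"
    proof (rule sum_mono)
      fix k
      have "a k * \<zeta> k \<le> 2 * \<beta> * (v k)\<^sup>2 * \<zeta> k"
        using a_le \<beta> \<eta> by (intro mult_right_mono) (auto simp: \<zeta>_def)
      also have "\<dots> = \<eta> / (4 * R)" using vpos[of k] \<beta> R by (simp add: \<zeta>_def field_simps)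
      finally show "a k * \<zeta> k \<le> \<eta> / (4 * R)" .
    qed
    also have "(\<Sum>k<R. \<eta> / (4 * R)) = \<eta> / 4" using R by simp
    also have "(\<Sum>k<R. a k) * (\<eta> / 4) \<le> 1 * (\<eta> / 4)"
      using a_sum \<eta> by (intro mult_right_mono) auto
    also have "(v R)\<^sup>2 \<le> \<eta> / 4" using R by (simp add: v_def power_mult[symmetric] mult.commute)
    finally have "(1 - \<beta>) * (\<integral>x. (f x)\<^sup>2 \<partial>M)
        \<le> (1 + \<beta>) ^ 6 * ((\<Sum>j<m. (f (t j))\<^sup>2) / m) + 3 / 4 * \<eta>"
      using \<beta> by (simp add: divide_right_mono mult_left_mono)
    also have "\<dots> \<le> (1 + \<beta>) ^ 6 * ((\<Sum>j<m. (f (t j))\<^sup>2) / m) + (1 - \<beta>) * \<eta>"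
      using \<beta> \<eta> by (intro add_left_mono mult_right_mono) auto
    finally have "(1 - \<beta>) * (\<integral>x. (f x)\<^sup>2 \<partial>M)
        \<le> (1 - \<beta>) * ((1 + \<beta>) ^ 6 / (1 - \<beta>) * ((\<Sum>j<m. (f (t j))\<^sup>2) / m) + \<eta>)"
      using \<beta> by (simp add: distrib_left)
    then have "(\<integral>x. (f x)\<^sup>2 \<partial>M) \<le> (1 + \<beta>) ^ 6 / (1 - \<beta>) * ((\<Sum>j<m. (f (t j))\<^sup>2) / m) + \<eta>"
      by (rule mult_left_le_imp_le) (use \<beta> in simp)
    then show "(\<integral>x. (measure_pmf.expectation p (\<lambda>h. h x))\<^sup>2 \<partial>M)
          \<le> (1 + \<beta>) ^ 6 / (1 - \<beta>) * ((\<Sum>k<m. (measure_pmf.expectation p (\<lambda>h. h (t k)))\<^sup>2) / m) + \<eta>"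
      by (simp only: f_def)
  qed
qed

section \<open>Lower isometry for weighted combinations\<close>

lemma weighted_combination_as_expectation:
  fixes v u :: "'i \<Rightarrow> real" and \<phi> :: "'i \<Rightarrow> 'a \<Rightarrow> real"
  assumes I: "finite I" and u: "\<And>i. i \<in> I \<Longrightarrow> 0 < u i" and W: "0 < (\<Sum>i\<in>I. u i * \<bar>v i\<bar>)"
  defines "D \<equiv> (\<lambda>i x. \<phi> i x / u i) ` I \<union> (\<lambda>i x. - \<phi> i x / u i) ` I"
  shows "\<exists>p. set_pmf p \<subseteq> D \<and>
    (\<forall>x. measure_pmf.expectation p (\<lambda>h. h x) = (\<Sum>i\<in>I. v i * \<phi> i x) / (\<Sum>i\<in>I. u i * \<bar>v i\<bar>))"
proof -
  define W where "W = (\<Sum>i\<in>I. u i * \<bar>v i\<bar>)"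
  have W0: "0 < W" using W by (simp add: W_def)
  define a where "a = (\<lambda>i. if i \<in> I then u i * \<bar>v i\<bar> / W else 0)"
  have a0: "0 \<le> a i" for i using u[of i] W0 by (auto simp: a_def)
  have a1: "(\<integral>\<^sup>+i. ennreal (a i) \<partial>count_space UNIV) = 1"
  proof -
    have "(\<integral>\<^sup>+i. ennreal (a i) \<partial>count_space UNIV) = (\<Sum>i\<in>I. ennreal (a i))"
      by (rule nn_integral_count_space'[OF I]) (auto simp: a_def)
    also have "\<dots> = ennreal (\<Sum>i\<in>I. a i)" using a0 by (simp add: sum_ennreal)
    also have "(\<Sum>i\<in>I. a i) = 1"
      using W0 by (simp add: a_def W_def sum_divide_distrib[symmetric])
    finally show ?thesis by simp
  qed
  define q where "q = embed_pmf a"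
  have pmf_q: "pmf q i = a i" for i unfolding q_def by (rule pmf_embed_pmf[OF a0 a1])
  have set_q: "set_pmf q \<subseteq> {i \<in> I. v i \<noteq> 0}" by (auto simp: set_pmf_iff pmf_q a_def split: if_splits)
  define p where "p = map_pmf (\<lambda>i x. sgn (v i) * \<phi> i x / u i) q"
  show ?thesis
  proof (intro exI[of _ p] conjI allI)
    show "set_pmf p \<subseteq> D"
    proof
      fix h assume "h \<in> set_pmf p"
      then obtain i where i: "i \<in> I" "v i \<noteq> 0" "h = (\<lambda>x. sgn (v i) * \<phi> i x / u i)"
        using set_q by (auto simp: p_def)
      show "h \<in> D"
      proof (cases "v i > 0")
        case True
        then show ?thesis using i unfolding D_def by (intro UnI1 image_eqI[of _ _ i]) auto
      next
        case False
        then show ?thesis using i unfolding D_def by (intro UnI2 image_eqI[of _ _ i]) auto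
      qed
    qed
    fix x
    have "measure_pmf.expectation p (\<lambda>h. h x) = measure_pmf.expectation q (\<lambda>i. sgn (v i) * \<phi> i x / u i)"
      by (simp add: p_def)
    also have "\<dots> = (\<Sum>i\<in>I. sgn (v i) * \<phi> i x / u i * pmf q i)"
      using set_q by (intro integral_measure_pmf_real I) auto
    also have "\<dots> = (\<Sum>i\<in>I. v i * \<phi> i x / W)"
    proof (rule sum.cong[OF refl])
      fix i assume i: "i \<in> I"
      show "sgn (v i) * \<phi> i x / u i * pmf q i = v i * \<phi> i x / W"
        using u[OF i] i by (cases "v i = 0") (auto simp: pmf_q a_def sgn_if)
    qed
    finally show "measure_pmf.expectation p (\<lambda>h. h x) = (\<Sum>i\<in>I. v i * \<phi> i x) / (\<Sum>i\<in>I. u i * \<bar>v i\<bar>)"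
      by (simp add: sum_divide_distrib W_def)
  qed
qed

text \<open>
  Both sides are homogeneous, so the weighted sum of \<open>|v i|\<close> may be taken to be 1; the combination
  then lies in the convex hull of the functions \<open>\<plusminus> \<phi> i / u i\<close>, which are bounded by 1.
\<close>

lemma (in prob_space) weighted_lower_isometry_real:
  fixes \<phi> :: "'i \<Rightarrow> 'a \<Rightarrow> real" and u :: "'i \<Rightarrow> real" and m R :: nat and \<beta> \<eta> \<epsilon> :: real
  assumes I: "finite I" "I \<noteq> {}" and u: "\<And>i. i \<in> I \<Longrightarrow> 0 < u i"
    and \<phi>: "\<And>i. i \<in> I \<Longrightarrow> \<phi> i \<in> borel_measurable M"
    and bd: "\<And>i x. i \<in> I \<Longrightarrow> x \<in> space M \<Longrightarrow> \<bar>\<phi> i x\<bar> \<le> u i"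
    and \<beta>: "0 < \<beta>" "\<beta> \<le> 1 / 4" and \<eta>: "0 < \<eta>" "\<eta> \<le> 1" and \<epsilon>: "0 < \<epsilon>" "\<epsilon> \<le> 1"
    and R: "R > 0" "(1 / (1 + \<beta>)) ^ (2 * R) \<le> \<eta> / 4"
    and m: "(2 * (1 + \<beta>) ^ 6 * ln (16 / \<eta>) / \<beta>\<^sup>2 + 1) * ln (2 * card I) + ln (R / \<epsilon>) \<le> m * \<eta> / (4 * R)"
  defines "P \<equiv> \<Pi>\<^sub>M k\<in>{..<m}. M"
  shows "\<exists>E\<in>sets P. 1 - \<epsilon> \<le> measure P E \<and>
     (\<forall>t\<in>E. \<forall>v. (\<integral>x. (\<Sum>i\<in>I. v i * \<phi> i x)\<^sup>2 \<partial>M)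
          \<le> (1 + \<beta>) ^ 6 / (1 - \<beta>) * ((\<Sum>k<m. (\<Sum>i\<in>I. v i * \<phi> i (t k))\<^sup>2) / m) + \<eta> * (\<Sum>i\<in>I. u i * \<bar>v i\<bar>)\<^sup>2)"
proof -
  define D where "D = (\<lambda>i x. \<phi> i x / u i) ` I \<union> (\<lambda>i x. - \<phi> i x / u i) ` I"
  have D: "finite D" "D \<noteq> {}" using I by (auto simp: D_def)
  have card_D: "card D \<le> 2 * card I"
    using card_Un_le[of "(\<lambda>i x. \<phi> i x / u i) ` I" "(\<lambda>i x. - \<phi> i x / u i) ` I"]
      card_image_le[OF I(1), of "\<lambda>i x. \<phi> i x / u i"] card_image_le[OF I(1), of "\<lambda>i x. - \<phi> i x / u i"]
    unfolding D_def by linarith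
  have cD: "0 < card D" using D by (simp add: card_gt_0_iff)
  have "(2 * (1 + \<beta>) ^ 6 * ln (16 / \<eta>) / \<beta>\<^sup>2 + 1) * ln (card D)
      \<le> (2 * (1 + \<beta>) ^ 6 * ln (16 / \<eta>) / \<beta>\<^sup>2 + 1) * ln (2 * card I)"
    using \<beta> \<eta> cD card_D by (intro mult_left_mono ln_mono) (auto intro!: add_nonneg_nonneg)
  then have m': "(2 * (1 + \<beta>) ^ 6 * ln (16 / \<eta>) / \<beta>\<^sup>2 + 1) * ln (card D) + ln (R / \<epsilon>) \<le> m * \<eta> / (4 * R)"
    using m by linarith
  have "\<exists>E\<in>sets P. 1 - \<epsilon> \<le> measure P E \<and>
     (\<forall>t\<in>E. \<forall>p. set_pmf p \<subseteq> D \<longrightarrow>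
        (\<integral>x. (measure_pmf.expectation p (\<lambda>h. h x))\<^sup>2 \<partial>M)
          \<le> (1 + \<beta>) ^ 6 / (1 - \<beta>) * ((\<Sum>k<m. (measure_pmf.expectation p (\<lambda>h. h (t k)))\<^sup>2) / m) + \<eta>)"
    unfolding P_def
  proof (rule convex_hull_lower_isometry[OF D _ _ \<beta> \<eta> \<epsilon> R m'])
    show "h \<in> borel_measurable M" if "h \<in> D" for h
      using that \<phi> unfolding D_def by (auto intro!: borel_measurable_divide)
    show "\<bar>h x\<bar> \<le> 1" if "h \<in> D" "x \<in> space M" for h x
      using that bd u unfolding D_def by fastforce
  qed
  then obtain E where E: "E \<in> sets P" "1 - \<epsilon> \<le> measure P E"
    and conv: "\<And>t p. t \<in> E \<Longrightarrow> set_pmf p \<subseteq> D \<Longrightarrow>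
        (\<integral>x. (measure_pmf.expectation p (\<lambda>h. h x))\<^sup>2 \<partial>M)
          \<le> (1 + \<beta>) ^ 6 / (1 - \<beta>) * ((\<Sum>k<m. (measure_pmf.expectation p (\<lambda>h. h (t k)))\<^sup>2) / m) + \<eta>"
    by blast
  show ?thesis
  proof (intro bexI[of _ E] conjI ballI allI E)
    fix t v assume t: "t \<in> E"
    define W where "W = (\<Sum>i\<in>I. u i * \<bar>v i\<bar>)"
    define C where "C = (1 + \<beta>) ^ 6 / (1 - \<beta>)"
    have W_nn: "0 \<le> W" unfolding W_def using u by (intro sum_nonneg mult_nonneg_nonneg) (auto simp: less_imp_le)
    show "(\<integral>x. (\<Sum>i\<in>I. v i * \<phi> i x)\<^sup>2 \<partial>M)
          \<le> C * ((\<Sum>k<m. (\<Sum>i\<in>I. v i * \<phi> i (t k))\<^sup>2) / m) + \<eta> * (\<Sum>i\<in>I. u i * \<bar>v i\<bar>)\<^sup>2"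
    proof (cases "W = 0")
      case True
      then have "u i * \<bar>v i\<bar> = 0" if "i \<in> I" for i
        unfolding W_def by (subst (asm) sum_nonneg_eq_0_iff) (use I u that in \<open>auto simp: less_imp_le\<close>)
      then have "v i = 0" if "i \<in> I" for i using u[OF that] that by force
      then show ?thesis by simp
    next
      case False
      then have W0: "0 < W" using W_nn by simp
      obtain p where p: "set_pmf p \<subseteq> D"
        "\<And>x. measure_pmf.expectation p (\<lambda>h. h x) = (\<Sum>i\<in>I. v i * \<phi> i x) / W"
        using weighted_combination_as_expectation[OF I(1) u W0[unfolded W_def], where \<phi> = \<phi>]
        unfolding D_def W_def by blast
      have "(\<integral>x. ((\<Sum>i\<in>I. v i * \<phi> i x) / W)\<^sup>2 \<partial>M)
         \<le> C * ((\<Sum>k<m. ((\<Sum>i\<in>I. v i * \<phi> i (t k)) / W)\<^sup>2) / m) + \<eta>"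
        using conv[OF t p(1)] unfolding p(2) C_def .
      then have "(\<integral>x. (\<Sum>i\<in>I. v i * \<phi> i x)\<^sup>2 \<partial>M) / W\<^sup>2
         \<le> C * ((\<Sum>k<m. (\<Sum>i\<in>I. v i * \<phi> i (t k))\<^sup>2) / W\<^sup>2 / m) + \<eta>"
        by (simp only: power_divide integral_divide_zero sum_divide_distrib[symmetric])
      then have "(\<integral>x. (\<Sum>i\<in>I. v i * \<phi> i x)\<^sup>2 \<partial>M)
         \<le> (C * ((\<Sum>k<m. (\<Sum>i\<in>I. v i * \<phi> i (t k))\<^sup>2) / W\<^sup>2 / m) + \<eta>) * W\<^sup>2"
        using W0 by (simp only: pos_divide_le_eq zero_less_power)
      also have "\<dots> = C * ((\<Sum>k<m. (\<Sum>i\<in>I. v i * \<phi> i (t k))\<^sup>2) / m) + \<eta> * W\<^sup>2"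
        using W0 by (simp add: field_simps)
      finally show ?thesis by (simp only: W_def)
    qed
  qed
qed

lemma sum_Re_Im_abs_squares_le:
  fixes z :: "'i \<Rightarrow> complex" and u :: "'i \<Rightarrow> real"
  assumes "\<And>i. i \<in> I \<Longrightarrow> 0 \<le> u i"
  shows "(\<Sum>i\<in>I. u i * \<bar>Re (z i)\<bar>)\<^sup>2 + (\<Sum>i\<in>I. u i * \<bar>Im (z i)\<bar>)\<^sup>2 \<le> (\<Sum>i\<in>I. u i * cmod (z i))\<^sup>2"
proof -
  define y where "y = (\<lambda>i. Complex (u i * \<bar>Re (z i)\<bar>) (u i * \<bar>Im (z i)\<bar>))"
  have "cmod (\<Sum>i\<in>I. y i) \<le> (\<Sum>i\<in>I. cmod (y i))" by (rule norm_sum)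
  also have "\<dots> = (\<Sum>i\<in>I. u i * cmod (z i))"
  proof (rule sum.cong[OF refl])
    fix i assume "i \<in> I"
    then have "0 \<le> u i" by (rule assms)
    then show "cmod (y i) = u i * cmod (z i)"
      by (simp add: y_def cmod_def power_mult_distrib real_sqrt_mult flip: distrib_left)
  qed
  finally have "(cmod (\<Sum>i\<in>I. y i))\<^sup>2 \<le> (\<Sum>i\<in>I. u i * cmod (z i))\<^sup>2" by (rule power_mono) simp
  then show ?thesis by (simp add: cmod_power2 y_def)
qed

text \<open>
  The real and imaginary parts of \<open>z\<close> are treated separately; all terms add up, the weighted sums
  by Minkowski's inequality.
\<close>

theorem (in prob_space) weighted_lower_isometry:
  fixes \<phi> :: "'i \<Rightarrow> 'a \<Rightarrow> real" and u :: "'i \<Rightarrow> real" and m R :: nat and \<beta> \<eta> \<epsilon> :: real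
  assumes I: "finite I" "I \<noteq> {}" and u: "\<And>i. i \<in> I \<Longrightarrow> 0 < u i"
    and \<phi>: "\<And>i. i \<in> I \<Longrightarrow> \<phi> i \<in> borel_measurable M"
    and bd: "\<And>i x. i \<in> I \<Longrightarrow> x \<in> space M \<Longrightarrow> \<bar>\<phi> i x\<bar> \<le> u i"
    and on: "\<And>i j. i \<in> I \<Longrightarrow> j \<in> I \<Longrightarrow> (\<integral>x. \<phi> i x * \<phi> j x \<partial>M) = of_bool (i = j)"
    and \<beta>: "0 < \<beta>" "\<beta> \<le> 1 / 4" and \<eta>: "0 < \<eta>" "\<eta> \<le> 1" and \<epsilon>: "0 < \<epsilon>" "\<epsilon> \<le> 1"
    and R: "R > 0" "(1 / (1 + \<beta>)) ^ (2 * R) \<le> \<eta> / 4"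
    and m: "(2 * (1 + \<beta>) ^ 6 * ln (16 / \<eta>) / \<beta>\<^sup>2 + 1) * ln (2 * card I) + ln (R / \<epsilon>) \<le> m * \<eta> / (4 * R)"
  defines "P \<equiv> \<Pi>\<^sub>M k\<in>{..<m}. M"
  shows "\<exists>E\<in>sets P. 1 - \<epsilon> \<le> measure P E \<and>
     (\<forall>t\<in>E. \<forall>z. (\<Sum>i\<in>I. (cmod (z i))\<^sup>2)
          \<le> (1 + \<beta>) ^ 6 / (1 - \<beta>) * ((\<Sum>k<m. (cmod (\<Sum>i\<in>I. z i * of_real (\<phi> i (t k))))\<^sup>2) / m)
             + \<eta> * (\<Sum>i\<in>I. u i * cmod (z i))\<^sup>2)"
proof -
  have norm: "(\<integral>x. (\<Sum>i\<in>I. v i * \<phi> i x)\<^sup>2 \<partial>M) = (\<Sum>i\<in>I. (v i)\<^sup>2)" for v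
  proof -
    have int: "integrable M (\<lambda>x. \<phi> i x * \<phi> j x)" if "i \<in> I" "j \<in> I" for i j
    proof (rule integrable_const_bound[where B = "u i * u j"])
      show "AE x in M. norm (\<phi> i x * \<phi> j x) \<le> u i * u j"
        using bd[OF that(1)] bd[OF that(2)] u[OF that(1)] by (auto simp: abs_mult intro!: mult_mono)
      show "(\<lambda>x. \<phi> i x * \<phi> j x) \<in> borel_measurable M" using \<phi> that by (intro borel_measurable_times) auto
    qed
    have "(\<integral>x. (\<Sum>i\<in>I. v i * \<phi> i x)\<^sup>2 \<partial>M) = (\<integral>x. (\<Sum>i\<in>I. \<Sum>j\<in>I. v i * v j * (\<phi> i x * \<phi> j x)) \<partial>M)"
      by (simp add: power2_eq_square sum_product mult_ac)
    also have "\<dots> = (\<Sum>i\<in>I. \<Sum>j\<in>I. v i * v j * (\<integral>x. \<phi> i x * \<phi> j x \<partial>M))"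
    proof (subst Bochner_Integration.integral_sum)
      fix i assume i: "i \<in> I"
      show "integrable M (\<lambda>x. \<Sum>j\<in>I. v i * v j * (\<phi> i x * \<phi> j x))"
        by (intro Bochner_Integration.integrable_sum integrable_mult_right int i)
    next
      show "(\<Sum>i\<in>I. \<integral>x. (\<Sum>j\<in>I. v i * v j * (\<phi> i x * \<phi> j x)) \<partial>M)
          = (\<Sum>i\<in>I. \<Sum>j\<in>I. v i * v j * (\<integral>x. \<phi> i x * \<phi> j x \<partial>M))"
      proof (rule sum.cong[OF refl])
        fix i assume i: "i \<in> I"
        show "(\<integral>x. (\<Sum>j\<in>I. v i * v j * (\<phi> i x * \<phi> j x)) \<partial>M) = (\<Sum>j\<in>I. v i * v j * (\<integral>x. \<phi> i x * \<phi> j x \<partial>M))"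
          by (subst Bochner_Integration.integral_sum) (intro integrable_mult_right int i, assumption, simp only: integral_mult_right_zero)
      qed
    qed
    also have "\<dots> = (\<Sum>i\<in>I. \<Sum>j\<in>I. if j = i then v i * v j else 0)"
      by (intro sum.cong refl) (auto simp: on)
    also have "\<dots> = (\<Sum>i\<in>I. (v i)\<^sup>2)" using I by (simp add: sum.delta' power2_eq_square)
    finally show ?thesis .
  qed
  have "\<exists>E\<in>sets P. 1 - \<epsilon> \<le> measure P E \<and>
     (\<forall>t\<in>E. \<forall>v. (\<integral>x. (\<Sum>i\<in>I. v i * \<phi> i x)\<^sup>2 \<partial>M)
          \<le> (1 + \<beta>) ^ 6 / (1 - \<beta>) * ((\<Sum>k<m. (\<Sum>i\<in>I. v i * \<phi> i (t k))\<^sup>2) / m) + \<eta> * (\<Sum>i\<in>I. u i * \<bar>v i\<bar>)\<^sup>2)"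
    unfolding P_def by (rule weighted_lower_isometry_real) (fact I u \<phi> bd \<beta> \<eta> \<epsilon> R m)+
  then obtain E where E: "E \<in> sets P" "1 - \<epsilon> \<le> measure P E"
    and real: "\<And>t v. t \<in> E \<Longrightarrow> (\<Sum>i\<in>I. (v i)\<^sup>2)
          \<le> (1 + \<beta>) ^ 6 / (1 - \<beta>) * ((\<Sum>k<m. (\<Sum>i\<in>I. v i * \<phi> i (t k))\<^sup>2) / m) + \<eta> * (\<Sum>i\<in>I. u i * \<bar>v i\<bar>)\<^sup>2"
    unfolding norm by blast
  show ?thesis
  proof (intro bexI[of _ E] conjI ballI allI E)
    fix t :: "nat \<Rightarrow> 'a" and z :: "'i \<Rightarrow> complex" assume t: "t \<in> E"
    define C where "C = (1 + \<beta>) ^ 6 / (1 - \<beta>)"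
    define G where "G = (\<lambda>v. (\<Sum>k<m. (\<Sum>i\<in>I. v i * \<phi> i (t k))\<^sup>2) / m)"
    define U where "U = (\<lambda>v. (\<Sum>i\<in>I. u i * \<bar>v i\<bar>)\<^sup>2)"
    have "(\<Sum>i\<in>I. (cmod (z i))\<^sup>2) = (\<Sum>i\<in>I. (Re (z i))\<^sup>2) + (\<Sum>i\<in>I. (Im (z i))\<^sup>2)"
      by (simp add: cmod_power2 sum.distrib)
    also have "\<dots> \<le> (C * G (\<lambda>i. Re (z i)) + \<eta> * U (\<lambda>i. Re (z i))) + (C * G (\<lambda>i. Im (z i)) + \<eta> * U (\<lambda>i. Im (z i)))"
      unfolding C_def G_def U_def by (intro add_mono real t)
    also have "\<dots> = C * (G (\<lambda>i. Re (z i)) + G (\<lambda>i. Im (z i))) + \<eta> * (U (\<lambda>i. Re (z i)) + U (\<lambda>i. Im (z i)))"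
      by (simp add: distrib_left)
    also have "G (\<lambda>i. Re (z i)) + G (\<lambda>i. Im (z i)) = (\<Sum>k<m. (cmod (\<Sum>i\<in>I. z i * of_real (\<phi> i (t k))))\<^sup>2) / m"
      by (simp add: G_def cmod_power2 sum.distrib add_divide_distrib)
    also have "\<eta> * (U (\<lambda>i. Re (z i)) + U (\<lambda>i. Im (z i))) \<le> \<eta> * (\<Sum>i\<in>I. u i * cmod (z i))\<^sup>2"
      unfolding U_def using \<eta> u by (intro mult_left_mono sum_Re_Im_abs_squares_le) (auto simp: less_imp_le)
    finally show "(\<Sum>i\<in>I. (cmod (z i))\<^sup>2)
          \<le> C * ((\<Sum>k<m. (cmod (\<Sum>i\<in>I. z i * of_real (\<phi> i (t k))))\<^sup>2) / m)
             + \<eta> * (\<Sum>i\<in>I. u i * cmod (z i))\<^sup>2" by simp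
  qed
qed

section \<open>Recovery by the weighted square-root LASSO\<close>

lemma lasso_constants:
  fixes \<delta> :: real
  assumes "0 < \<delta>" "\<delta> < 1 / 5"
  defines "\<rho> \<equiv> 4 * \<delta> / (1 - \<delta>)" and "\<tau> \<equiv> sqrt (1 + \<delta>) / (1 - \<delta>)"
  shows "0 < \<rho>" "\<rho> < 1" "\<delta> / (1 - \<delta>) \<le> \<rho>" "sqrt (1 + \<delta>) \<le> \<tau>" "1 \<le> \<tau>"
proof -
  show "0 < \<rho>" "\<rho> < 1" "\<delta> / (1 - \<delta>) \<le> \<rho>" using assms by (simp_all add: \<rho>_def field_simps)
  have "1 \<le> sqrt (1 + \<delta>)" using assms by simp
  moreover have "sqrt (1 + \<delta>) * (1 - \<delta>) \<le> sqrt (1 + \<delta>) * 1"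
    using assms by (intro mult_left_mono) auto
  ultimately have "1 \<le> sqrt (1 + \<delta>)" "sqrt (1 + \<delta>) \<le> \<tau>"
    using assms by (simp_all add: \<tau>_def pos_le_divide_eq)
  then show "sqrt (1 + \<delta>) \<le> \<tau>" "1 \<le> \<tau>" by linarith+
qed

text \<open>
  The arithmetic of the recovery proof.  Here \<open>a\<close> and \<open>b\<close> are the weighted \<open>\<ell>\<^sup>1\<close> norms of the
  coefficient error off and on a lower set, \<open>s2\<close> is its \<open>\<ell>\<^sup>2\<close> norm on that set, \<open>V1\<close> and \<open>V2\<close> are the norms
  of the whole error, \<open>D\<close> is the norm of its image under the matrix, and \<open>R\<close> and \<open>E\<close> are the norms of
  the residual at the minimizer and of the data error.
\<close>

lemma lasso_algebra:
  fixes \<delta> \<theta> K :: real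
  assumes \<delta>: "0 < \<delta>" "\<delta> < 1 / 5" and K: "0 < K"
  defines "\<rho> \<equiv> 4 * \<delta> / (1 - \<delta>)" and "\<tau> \<equiv> sqrt (1 + \<delta>) / (1 - \<delta>)"
  assumes \<theta>: "(5 + \<rho>) * \<tau> / ((1 + \<rho>) * (2 + \<rho>)) \<le> \<theta>"
    and nonneg: "0 \<le> a" "0 \<le> R" "0 \<le> E"
    and b: "b \<le> sqrt K * s2" and s2: "s2 \<le> V2" and V1: "V1 = a + b" "0 \<le> V1"
    and iso: "V2 \<le> sqrt (1 + \<delta>) * D + \<delta> * V1 / sqrt K" and D: "D \<le> R + E"
    and min: "a \<le> b + 2 * \<sigma> + \<theta> * sqrt K * (E - R)"
  shows "V1 \<le> (2 * (1 + \<rho>) * \<sigma> + sqrt K * (((1 + \<rho>) * \<theta> + 2 * \<tau>) * E)) / (1 - \<rho>)"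
    and "V2 \<le> (2 * (1 + \<rho>) * (2 + \<rho>) * \<sigma> / sqrt K + ((1 + \<rho>) * (2 + \<rho>) * \<theta> + (5 + \<rho>) * \<tau>) * E) / (1 - \<rho>)"
proof -
  note c = lasso_constants[OF \<delta>, folded \<rho>_def \<tau>_def]
  define k where "k = sqrt K"
  have k: "0 < k" using K by (simp add: k_def)
  define \<alpha> where "\<alpha> = sqrt (1 + \<delta>)"
  have \<alpha>: "0 < \<alpha>" "\<alpha> \<le> \<tau>" using \<delta> c(4) by (auto simp: \<alpha>_def)
  have \<theta>': "(5 + \<rho>) * \<tau> \<le> (1 + \<rho>) * (2 + \<rho>) * \<theta>"
    using \<theta> c(1) by (simp add: divide_le_eq mult.commute mult_pos_pos)
  \<comment> \<open>The robust null space property, after moving the contribution of the lower set to the left.\<close>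
  have s2_le: "s2 \<le> \<tau> * (R + E) + \<rho> * (a / k)"
  proof -
    have "\<delta> * V1 / k \<le> \<delta> * (a + k * s2) / k"
      using \<delta> k b by (intro divide_right_mono mult_left_mono) (auto simp: V1 k_def)
    also have "\<dots> = \<delta> * (a / k) + \<delta> * s2" using k by (simp add: field_simps)
    finally have "s2 \<le> \<alpha> * D + \<delta> * (a / k) + \<delta> * s2"
      using iso s2 by (simp add: \<alpha>_def k_def)
    moreover have "\<alpha> * D \<le> \<alpha> * (R + E)" using \<alpha> D by (intro mult_left_mono) auto
    ultimately have "(1 - \<delta>) * s2 \<le> \<alpha> * (R + E) + \<delta> * (a / k)" by (simp add: algebra_simps)
    then have "s2 \<le> (\<alpha> * (R + E) + \<delta> * (a / k)) / (1 - \<delta>)" using \<delta> by (simp add: pos_le_divide_eq mult.commute)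
    also have "\<dots> = \<tau> * (R + E) + \<delta> / (1 - \<delta>) * (a / k)"
      by (simp add: \<tau>_def \<alpha>_def add_divide_distrib)
    also have "\<dots> \<le> \<tau> * (R + E) + \<rho> * (a / k)"
      using c(3) nonneg k by (intro add_left_mono mult_right_mono) auto
    finally show ?thesis .
  qed
  have b_le: "b \<le> k * \<tau> * (R + E) + \<rho> * a"
  proof -
    have "b \<le> k * (\<tau> * (R + E) + \<rho> * (a / k))"
      using b[folded k_def] mult_left_mono[OF s2_le less_imp_le[OF k]] by (rule order_trans)
    also have "\<dots> = k * \<tau> * (R + E) + \<rho> * a" using k by (simp add: field_simps)
    finally show ?thesis .
  qed
  have a_le: "(1 - \<rho>) * a \<le> k * \<tau> * (R + E) + 2 * \<sigma> + \<theta> * k * (E - R)"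
    using b_le min by (simp add: k_def algebra_simps)
  have V1_le: "(1 - \<rho>) * V1 \<le> 2 * (1 + \<rho>) * \<sigma> + k * ((2 * \<tau> - (1 + \<rho>) * \<theta>) * R + (2 * \<tau> + (1 + \<rho>) * \<theta>) * E)"
  proof -
    have "V1 \<le> (1 + \<rho>) * a + k * \<tau> * (R + E)" using b_le by (simp add: V1 algebra_simps)
    then have "(1 - \<rho>) * V1 \<le> (1 - \<rho>) * ((1 + \<rho>) * a + k * \<tau> * (R + E))"
      using c by (intro mult_left_mono) auto
    also have "\<dots> = (1 + \<rho>) * ((1 - \<rho>) * a) + (1 - \<rho>) * (k * \<tau> * (R + E))" by (simp add: algebra_simps)
    also have "\<dots> \<le> (1 + \<rho>) * (k * \<tau> * (R + E) + 2 * \<sigma> + \<theta> * k * (E - R)) + (1 - \<rho>) * (k * \<tau> * (R + E))"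
      using a_le c by (intro add_right_mono mult_left_mono) auto
    also have "\<dots> = 2 * (1 + \<rho>) * \<sigma> + k * ((2 * \<tau> - (1 + \<rho>) * \<theta>) * R + (2 * \<tau> + (1 + \<rho>) * \<theta>) * E)"
      by (simp add: algebra_simps)
    finally show ?thesis .
  qed
  \<comment> \<open>The residual term \<open>R\<close> has a nonpositive coefficient and can be dropped.\<close>
  have "2 * \<tau> \<le> (1 + \<rho>) * \<theta>"
  proof -
    have "(2 + \<rho>) * (2 * \<tau>) \<le> (5 + \<rho>) * \<tau>"
    proof -
      have "\<rho> * \<tau> \<le> 1 * \<tau>" using c by (intro mult_right_mono) auto
      then show ?thesis by (simp add: algebra_simps)
    qed
    also have "\<dots> \<le> (2 + \<rho>) * ((1 + \<rho>) * \<theta>)" using \<theta>' by (simp add: mult_ac)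
    finally show ?thesis using c by (simp add: mult_le_cancel_left)
  qed
  then have "(2 * \<tau> - (1 + \<rho>) * \<theta>) * R \<le> 0" using nonneg by (intro mult_nonpos_nonneg) auto
  then have "k * ((2 * \<tau> - (1 + \<rho>) * \<theta>) * R + (2 * \<tau> + (1 + \<rho>) * \<theta>) * E) \<le> k * ((2 * \<tau> + (1 + \<rho>) * \<theta>) * E)"
    using k by (intro mult_left_mono) auto
  then have "(1 - \<rho>) * V1 \<le> 2 * (1 + \<rho>) * \<sigma> + k * (((1 + \<rho>) * \<theta> + 2 * \<tau>) * E)"
    using V1_le by (simp add: add.commute)
  then show "V1 \<le> (2 * (1 + \<rho>) * \<sigma> + sqrt K * (((1 + \<rho>) * \<theta> + 2 * \<tau>) * E)) / (1 - \<rho>)"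
    using c by (simp add: pos_le_divide_eq mult.commute k_def)
  define X where "X = 2 * (1 + \<rho>) * \<sigma> / k + ((2 * \<tau> - (1 + \<rho>) * \<theta>) * R + (2 * \<tau> + (1 + \<rho>) * \<theta>) * E)"
  have WX: "(1 - \<rho>) * (V1 / k) \<le> X"
  proof -
    have "(1 - \<rho>) * V1 / k \<le> (2 * (1 + \<rho>) * \<sigma> + k * ((2 * \<tau> - (1 + \<rho>) * \<theta>) * R + (2 * \<tau> + (1 + \<rho>) * \<theta>) * E)) / k"
      using V1_le k by (intro divide_right_mono) auto
    also have "\<dots> = X" using k by (simp add: X_def add_divide_distrib)
    finally show ?thesis by simp
  qed
  have W0: "0 \<le> (1 - \<rho>) * (V1 / k)" using c V1 k by (intro mult_nonneg_nonneg) auto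
  have "(1 - \<rho>) * V2 \<le> (1 - \<rho>) * (\<alpha> * D + \<delta> * (V1 / k))"
    using iso c by (intro mult_left_mono) (auto simp: \<alpha>_def k_def)
  also have "\<dots> = (1 - \<rho>) * (\<alpha> * D) + \<delta> * ((1 - \<rho>) * (V1 / k))" by (simp add: algebra_simps)
  also have "\<dots> \<le> (1 - \<rho>) * (\<tau> * (R + E)) + (2 + \<rho>) * X"
  proof (rule add_mono)
    have "\<alpha> * D \<le> \<alpha> * (R + E)" using \<alpha> D by (intro mult_left_mono) auto
    also have "\<dots> \<le> \<tau> * (R + E)" using \<alpha> nonneg by (intro mult_right_mono) auto
    finally show "(1 - \<rho>) * (\<alpha> * D) \<le> (1 - \<rho>) * (\<tau> * (R + E))" using c by (intro mult_left_mono) auto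
    \<comment> \<open>The factor \<open>\<delta>\<close> is increased to \<open>2 + \<rho>\<close> on purpose: the negative multiple of the residual \<open>R\<close>
      inside \<open>X\<close> then outweighs the term \<open>\<tau> R\<close>.  This fixes the lower bound on \<open>\<theta>\<close>.\<close>
    have "\<delta> * ((1 - \<rho>) * (V1 / k)) \<le> (2 + \<rho>) * ((1 - \<rho>) * (V1 / k))"
      using c \<delta> W0 by (intro mult_right_mono) auto
    also have "\<dots> \<le> (2 + \<rho>) * X" using WX c by (intro mult_left_mono) auto
    finally show "\<delta> * ((1 - \<rho>) * (V1 / k)) \<le> (2 + \<rho>) * X" .
  qed
  also have "\<dots> = 2 * (1 + \<rho>) * (2 + \<rho>) * \<sigma> / k + ((5 + \<rho>) * \<tau> - (1 + \<rho>) * (2 + \<rho>) * \<theta>) * R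
      + ((1 + \<rho>) * (2 + \<rho>) * \<theta> + (5 + \<rho>) * \<tau>) * E"
    using k by (simp add: X_def field_simps)
  also have "\<dots> \<le> 2 * (1 + \<rho>) * (2 + \<rho>) * \<sigma> / k + ((1 + \<rho>) * (2 + \<rho>) * \<theta> + (5 + \<rho>) * \<tau>) * E"
    using \<theta>' nonneg mult_nonpos_nonneg[of "(5 + \<rho>) * \<tau> - (1 + \<rho>) * (2 + \<rho>) * \<theta>" R] by simp
  finally show "V2 \<le> (2 * (1 + \<rho>) * (2 + \<rho>) * \<sigma> / sqrt K + ((1 + \<rho>) * (2 + \<rho>) * \<theta> + (5 + \<rho>) * \<tau>) * E) / (1 - \<rho>)"
    using c by (simp add: pos_le_divide_eq mult.commute k_def)
qed

lemma l2_norm_triangle: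
  assumes "\<And>k. k < m \<Longrightarrow> cmod (v k) \<le> cmod (a k) + cmod (b k)"
  shows "l2_norm m v \<le> l2_norm m a + l2_norm m b"
proof -
  have "l2_norm m v \<le> L2_set (\<lambda>k. cmod (a k) + cmod (b k)) {..<m}"
    unfolding l2_norm_def by (rule L2_set_mono) (use assms in auto)
  also have "\<dots> \<le> l2_norm m a + l2_norm m b"
    unfolding l2_norm_def by (rule L2_set_triangle_ineq)
  finally show ?thesis .
qed

text \<open>
  The lower isometry is assumed for all vectors, with a multiple of the squared weighted \<open>\<ell>\<^sup>1\<close> norm as
  error term; for sets of weighted cardinality at most \<open>K\<close> this contains the usual robust null
  space property.
\<close>

theorem sr_lasso_recovery:
  fixes u :: "(nat \<Rightarrow> nat) \<Rightarrow> real" and x xh :: "(nat \<Rightarrow> nat) \<Rightarrow> complex" and e y :: "nat \<Rightarrow> complex"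
  assumes \<delta>: "0 < \<delta>" "\<delta> < 1 / 5" and K: "0 < K"
  defines "\<rho> \<equiv> 4 * \<delta> / (1 - \<delta>)" and "\<tau> \<equiv> sqrt (1 + \<delta>) / (1 - \<delta>)"
  assumes \<theta>: "(5 + \<rho>) * \<tau> / ((1 + \<rho>) * (2 + \<rho>)) \<le> \<theta>"
    and I: "finite I" and S: "S \<subseteq> I" "(\<Sum>i\<in>S. (u i)\<^sup>2) \<le> K" and u: "\<And>i. 0 \<le> u i"
    and iso: "\<And>z. (\<Sum>i\<in>I. (cmod (z i))\<^sup>2)
        \<le> (1 + \<delta>) * (l2_norm m (mat_vec A I z))\<^sup>2 + \<delta>\<^sup>2 / K * (\<Sum>i\<in>I. u i * cmod (z i))\<^sup>2"
    and y: "y = (\<lambda>k. mat_vec A I x k + e k)"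
    and min: "(\<Sum>i\<in>I. u i * cmod (xh i)) + \<theta> * sqrt K * l2_norm m (\<lambda>k. mat_vec A I xh k - y k)
        \<le> (\<Sum>i\<in>I. u i * cmod (x i)) + \<theta> * sqrt K * l2_norm m (\<lambda>k. mat_vec A I x k - y k)"
  defines "\<sigma> \<equiv> (\<Sum>i\<in>I - S. u i * cmod (x i))" and "E \<equiv> l2_norm m e"
  shows "(\<Sum>i\<in>I. u i * cmod (xh i - x i))
      \<le> (2 * (1 + \<rho>) * \<sigma> + sqrt K * (((1 + \<rho>) * \<theta> + 2 * \<tau>) * E)) / (1 - \<rho>)"
    and "sqrt (\<Sum>i\<in>I. (cmod (xh i - x i))\<^sup>2)
      \<le> (2 * (1 + \<rho>) * (2 + \<rho>) * \<sigma> / sqrt K + ((1 + \<rho>) * (2 + \<rho>) * \<theta> + (5 + \<rho>) * \<tau>) * E) / (1 - \<rho>)"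
proof -
  define v where "v = (\<lambda>i. xh i - x i)"
  define R where "R = l2_norm m (\<lambda>k. mat_vec A I xh k - y k)"
  define D where "D = l2_norm m (mat_vec A I v)"
  define a where "a = (\<Sum>i\<in>I - S. u i * cmod (v i))"
  define b where "b = (\<Sum>i\<in>S. u i * cmod (v i))"
  define V1 where "V1 = (\<Sum>i\<in>I. u i * cmod (v i))"
  define V2 where "V2 = sqrt (\<Sum>i\<in>I. (cmod (v i))\<^sup>2)"
  define s2 where "s2 = L2_set (\<lambda>i. cmod (v i)) S"
  have split: "(\<Sum>i\<in>I. g i) = (\<Sum>i\<in>I - S. g i) + (\<Sum>i\<in>S. g i)" for g :: "_ \<Rightarrow> real"
    by (rule sum.subset_diff[OF S(1) I])
  have finS: "finite S" using S I finite_subset by blast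
  have V1: "V1 = a + b" unfolding V1_def a_def b_def by (rule split)
  have V10: "0 \<le> V1" unfolding V1_def using u by (intro sum_nonneg mult_nonneg_nonneg) auto
  have a0: "0 \<le> a" unfolding a_def using u by (intro sum_nonneg mult_nonneg_nonneg) auto
  have R0: "0 \<le> R" "0 \<le> E" unfolding R_def E_def l2_norm_def by (rule L2_set_nonneg)+
  have b: "b \<le> sqrt K * s2"
  proof -
    have "b \<le> L2_set u S * s2"
      unfolding b_def s2_def using L2_set_mult_ineq[of u "\<lambda>i. cmod (v i)" S] u by simp
    also have "\<dots> \<le> sqrt K * s2"
      unfolding s2_def by (intro mult_right_mono L2_set_nonneg) (use S in \<open>simp add: L2_set_def\<close>)
    finally show ?thesis .
  qed
  have s2: "s2 \<le> V2"
    unfolding s2_def V2_def L2_set_def using S I by (intro real_sqrt_le_mono sum_mono2) auto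
  have iso': "V2 \<le> sqrt (1 + \<delta>) * D + \<delta> * V1 / sqrt K"
  proof -
    have "V2 \<le> sqrt ((sqrt (1 + \<delta>) * D)\<^sup>2 + (\<delta> * V1 / sqrt K)\<^sup>2)"
      unfolding V2_def
      using iso[of v] \<delta> K by (intro real_sqrt_le_mono) (simp add: D_def V1_def power_mult_distrib power_divide)
    also have "\<dots> \<le> sqrt ((sqrt (1 + \<delta>) * D)\<^sup>2) + sqrt ((\<delta> * V1 / sqrt K)\<^sup>2)"
      by (rule sqrt_add_le_add_sqrt) auto
    also have "\<dots> = sqrt (1 + \<delta>) * D + \<delta> * V1 / sqrt K"
      using \<delta> K V10 by (simp add: D_def l2_norm_def L2_set_nonneg abs_mult)
    finally show ?thesis .
  qed
  have D: "D \<le> R + E"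
    unfolding D_def R_def E_def
  proof (rule l2_norm_triangle)
    fix k
    have "mat_vec A I v k = (mat_vec A I xh k - y k) + e k"
      by (simp add: y v_def mat_vec_def right_diff_distrib sum_subtractf)
    then show "cmod (mat_vec A I v k) \<le> cmod (mat_vec A I xh k - y k) + cmod (e k)"
      by (simp only: norm_triangle_ineq)
  qed
  have Ee: "l2_norm m (\<lambda>k. mat_vec A I x k - y k) = E" by (simp add: E_def y l2_norm_def)
  have min': "a \<le> b + 2 * \<sigma> + \<theta> * sqrt K * (E - R)"
  proof -
    have "(\<Sum>i\<in>S. u i * cmod (x i)) - b \<le> (\<Sum>i\<in>S. u i * cmod (xh i))"
    proof -
      have "u i * cmod (x i) \<le> u i * cmod (xh i) + u i * cmod (v i)" for i
        using mult_left_mono[OF norm_triangle_ineq4[of "xh i" "v i"] u[of i]] by (simp add: v_def distrib_left)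
      then have "(\<Sum>i\<in>S. u i * cmod (x i)) \<le> (\<Sum>i\<in>S. u i * cmod (xh i) + u i * cmod (v i))" by (rule sum_mono)
      then show ?thesis by (simp add: b_def sum.distrib)
    qed
    moreover have "a - \<sigma> \<le> (\<Sum>i\<in>I - S. u i * cmod (xh i))"
    proof -
      have "u i * cmod (v i) \<le> u i * cmod (xh i) + u i * cmod (x i)" for i
        using mult_left_mono[OF norm_triangle_ineq4[of "xh i" "x i"] u[of i]] by (simp add: v_def distrib_left)
      then have "a \<le> (\<Sum>i\<in>I - S. u i * cmod (xh i) + u i * cmod (x i))" unfolding a_def by (rule sum_mono)
      then show ?thesis by (simp add: \<sigma>_def sum.distrib)
    qed
    moreover have "(\<Sum>i\<in>I - S. u i * cmod (xh i)) + (\<Sum>i\<in>S. u i * cmod (xh i)) + \<theta> * sqrt K * R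
        \<le> \<sigma> + (\<Sum>i\<in>S. u i * cmod (x i)) + \<theta> * sqrt K * E"
      using min unfolding R_def[symmetric] Ee by (simp only: split \<sigma>_def)
    ultimately show ?thesis by (simp add: algebra_simps)
  qed
  show "(\<Sum>i\<in>I. u i * cmod (xh i - x i))
      \<le> (2 * (1 + \<rho>) * \<sigma> + sqrt K * (((1 + \<rho>) * \<theta> + 2 * \<tau>) * E)) / (1 - \<rho>)"
    using lasso_algebra(1)[OF \<delta> K \<theta>[unfolded \<rho>_def \<tau>_def] a0 R0 b s2 V1 V10 iso' D min']
    by (simp only: V1_def v_def \<rho>_def \<tau>_def)
  show "sqrt (\<Sum>i\<in>I. (cmod (xh i - x i))\<^sup>2)
      \<le> (2 * (1 + \<rho>) * (2 + \<rho>) * \<sigma> / sqrt K + ((1 + \<rho>) * (2 + \<rho>) * \<theta> + (5 + \<rho>) * \<tau>) * E) / (1 - \<rho>)"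
    using lasso_algebra(2)[OF \<delta> K \<theta>[unfolded \<rho>_def \<tau>_def] a0 R0 b s2 V1 V10 iso' D min']
    by (simp only: V2_def v_def \<rho>_def \<tau>_def)
qed

section \<open>Sample complexity\<close>

text \<open>
  With \<open>R\<close> of order \<open>ln q / \<delta>\<close> the lowest height is below \<open>\<eta> / 4 = 1 / (4 q)\<close>.  The
  remaining condition then reads \<open>m \<ge> C q R (ln q ln n / \<delta>\<^sup>2 + ln (R / \<epsilon>))\<close>, and each of the two terms
  is at most a constant times \<open>\<delta>\<close> times the maximum in the polylogarithmic factor.
\<close>

lemma sample_complexity:
  fixes K \<delta> \<epsilon> n m :: real
  assumes K: "1 \<le> K" and \<delta>: "0 < \<delta>" "\<delta> < 1 / 5" and \<epsilon>: "0 < \<epsilon>" "\<epsilon> < 1" and n: "2 \<le> n"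
  defines "q \<equiv> K / \<delta>\<^sup>2" and "\<beta> \<equiv> \<delta> / 16" and "\<eta> \<equiv> \<delta>\<^sup>2 / K"
  assumes m: "600000 * K * (1 / \<delta>\<^sup>2 * ln q *
         max (1 / \<delta>^4 * ln (q * ln q) * ln n) (1 / \<delta> * ln (1 / (\<delta> * \<epsilon>) * ln q))) \<le> m"
  shows "\<exists>R::nat. R > 0 \<and> (1 / (1 + \<beta>)) ^ (2 * R) \<le> \<eta> / 4 \<and>
    (2 * (1 + \<beta>) ^ 6 * ln (16 / \<eta>) / \<beta>\<^sup>2 + 1) * ln (2 * n) + ln (R / \<epsilon>) \<le> m * \<eta> / (4 * R)"
proof -
  have q25: "25 \<le> q"
  proof -
    have "\<delta>\<^sup>2 \<le> (1 / 5)\<^sup>2" using \<delta> by (intro power_mono) auto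
    then have "25 * \<delta>\<^sup>2 \<le> 1" by (simp add: power_divide)
    then have "25 * \<delta>\<^sup>2 \<le> K" using K by linarith
    then show ?thesis using \<delta> by (simp add: q_def pos_le_divide_eq)
  qed
  have q0: "0 < q" using q25 by simp
  have \<eta>q: "\<eta> = 1 / q" using K \<delta> by (simp add: \<eta>_def q_def)
  define l where "l = ln q"
  have l2: "2 \<le> l"
  proof -
    have "exp (2::real) = exp 1 * exp 1" by (simp flip: exp_add)
    also have "\<dots> \<le> 3 * 3" by (intro mult_mono exp_le) auto
    finally have "exp 2 \<le> q" using q25 by simp
    then show ?thesis unfolding l_def using q0 by (simp add: ln_ge_iff)
  qed
  have lnc: "ln (c * q) \<le> 2 * l" if "0 < c" "c \<le> q" for c
  proof -
    have "ln (c * q) = ln c + l" using that q0 by (simp add: l_def ln_mult)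
    also have "ln c \<le> l" unfolding l_def using that by simp
    finally show ?thesis by simp
  qed
  have l\<delta>: "1 \<le> l / \<delta>" "1 \<le> l / \<delta>\<^sup>2"
  proof -
    have "\<delta>\<^sup>2 \<le> 1" using \<delta> by (simp add: power_le_one)
    then show "1 \<le> l / \<delta>" "1 \<le> l / \<delta>\<^sup>2" using \<delta> l2 by (simp_all add: pos_le_divide_eq)
  qed
  have \<beta>: "0 < \<beta>" "\<beta> \<le> 1 / 80" using \<delta> by (simp_all add: \<beta>_def)
  \<comment> \<open>As \<open>ln (1 + \<beta>) \<ge> \<beta> / 2\<close>, this choice gives \<open>(1 + \<beta>)\<^bsup>2 R\<^esup> \<ge> q\<^sup>2 \<ge> 4 q\<close>.\<close>
  define R where "R = nat \<lceil>32 * l / \<delta>\<rceil>"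
  have pos: "0 < 32 * l / \<delta>" using l2 \<delta> by simp
  have Rlow: "32 * l / \<delta> \<le> R" unfolding R_def by linarith
  have Rup: "R \<le> 33 * l / \<delta>"
  proof -
    have "real R \<le> 32 * l / \<delta> + 1" unfolding R_def using pos by linarith
    then show ?thesis using l\<delta>(1) by simp
  qed
  have R0: "0 < R" using Rlow pos by linarith
  have Rpow: "(1 / (1 + \<beta>)) ^ (2 * R) \<le> \<eta> / 4"
  proof -
    have "\<beta>\<^sup>2 \<le> \<beta> / 2" using \<beta> by (simp add: power2_eq_square)
    then have "\<beta> / 2 \<le> \<beta> - \<beta>\<^sup>2" by simp
    also have "\<dots> \<le> ln (1 + \<beta>)" using \<beta> by (intro ln_one_plus_pos_lower_bound) auto
    finally have "real (2 * R) * (\<beta> / 2) \<le> real (2 * R) * ln (1 + \<beta>)" by (intro mult_left_mono) auto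
    moreover have "2 * l \<le> real (2 * R) * (\<beta> / 2)"
    proof -
      have "32 * l / \<delta> * (\<delta> / 16) \<le> real R * (\<delta> / 16)" using Rlow \<delta> by (intro mult_right_mono) auto
      then show ?thesis using \<delta> by (simp add: \<beta>_def mult.commute)
    qed
    ultimately have "exp (2 * l) \<le> exp (real (2 * R) * ln (1 + \<beta>))" by simp
    also have "\<dots> = (1 + \<beta>) ^ (2 * R)"
    proof -
      have "exp (ln (1 + \<beta>)) = 1 + \<beta>" using \<beta> by simp
      then show ?thesis by (simp only: exp_of_nat_mult)
    qed
    also have "exp (2 * l) = q * q" by (simp only: l_def mult_2 exp_add exp_ln[OF q0])
    finally have "4 * q \<le> (1 + \<beta>) ^ (2 * R)" using mult_right_mono[of 4 q q] q25 by linarith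
    then have "1 / (1 + \<beta>) ^ (2 * R) \<le> 1 / (4 * q)" using q0 by (intro divide_left_mono) auto
    then show ?thesis by (simp add: \<eta>q power_one_over)
  qed
  define T1 where "T1 = 1 / \<delta>^4 * ln (q * ln q) * ln n"
  define T2 where "T2 = 1 / \<delta> * ln (1 / (\<delta> * \<epsilon>) * ln q)"
  define T where "T = max T1 T2"
  have first: "(2 * (1 + \<beta>) ^ 6 * ln (16 / \<eta>) / \<beta>\<^sup>2 + 1) * ln (2 * n) \<le> 4098 * (\<delta> * T)"
  proof -
    have b6: "(1 + \<beta>) ^ 6 \<le> 2"
    proof -
      have "(1 + \<beta>) ^ 6 \<le> (81 / 80) ^ 6" using \<beta> by (intro power_mono) auto
      also have "\<dots> \<le> (2::real)" by (simp add: power_divide)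
      finally show ?thesis .
    qed
    have "ln (16 / \<eta>) \<le> 2 * l" using lnc[of 16] q25 by (simp add: \<eta>q)
    moreover have "0 \<le> ln (16 / \<eta>)" using q25 by (intro ln_ge_zero) (simp add: \<eta>q)
    ultimately have "2 * (1 + \<beta>) ^ 6 * ln (16 / \<eta>) \<le> 2 * 2 * (2 * l)"
      using b6 \<beta> by (intro mult_mono) auto
    then have "2 * (1 + \<beta>) ^ 6 * ln (16 / \<eta>) / \<beta>\<^sup>2 \<le> 2 * 2 * (2 * l) / \<beta>\<^sup>2"
      by (intro divide_right_mono) auto
    also have "\<dots> = 2048 * (l / \<delta>\<^sup>2)" using \<delta> by (simp add: \<beta>_def power_divide)
    finally have 1: "2 * (1 + \<beta>) ^ 6 * ln (16 / \<eta>) / \<beta>\<^sup>2 + 1 \<le> 2049 * (l / \<delta>\<^sup>2)" using l\<delta>(2) by simp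
    have 2: "ln (2 * n) \<le> 2 * ln n" "0 \<le> ln (2 * n)"
      using n by (simp_all add: ln_mult)
    have "(2 * (1 + \<beta>) ^ 6 * ln (16 / \<eta>) / \<beta>\<^sup>2 + 1) * ln (2 * n) \<le> (2049 * (l / \<delta>\<^sup>2)) * (2 * ln n)"
      using 1 2 l\<delta>(2) by (intro mult_mono) auto
    also have "\<dots> = 4098 * (\<delta>\<^sup>2 * (1 / \<delta>^4 * l * ln n))"
      using \<delta> by (simp add: field_simps eval_nat_numeral)
    also have "\<dots> \<le> 4098 * (\<delta> * T1)"
    proof (intro mult_left_mono mult_mono)
      show "\<delta>\<^sup>2 \<le> \<delta>" using \<delta> by (simp add: power2_eq_square)
      have "l \<le> ln (q * ln q)"
        unfolding l_def[symmetric] using q0 l2 by (subst (1) l_def) (simp add: ln_mult)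
      then show "1 / \<delta>^4 * l * ln n \<le> T1"
        unfolding T1_def using n \<delta> by (intro mult_right_mono mult_left_mono) auto
      show "0 \<le> 1 / \<delta>^4 * l * ln n" using n l2 by (intro mult_nonneg_nonneg) auto
    qed (use \<delta> in auto)
    also have "\<dots> \<le> 4098 * (\<delta> * T)" using \<delta> by (intro mult_left_mono) (auto simp: T_def)
    finally show ?thesis .
  qed
  have second: "ln (R / \<epsilon>) \<le> 33 * (\<delta> * T)"
  proof -
    define Y where "Y = 1 / (\<delta> * \<epsilon>) * l"
    have "\<delta> * \<epsilon> \<le> (1 / 5) * 1" using \<delta> \<epsilon> by (intro mult_mono) auto
    then have "3 * (\<delta> * \<epsilon>) \<le> l" using l2 by linarith
    then have Y3: "3 \<le> Y" using \<delta> \<epsilon> by (simp add: Y_def pos_le_divide_eq)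
    then have lnY: "1 \<le> ln Y" using exp_le by (subst ln_ge_iff) auto
    have "real R / \<epsilon> \<le> 33 * l / \<delta> / \<epsilon>" using Rup \<epsilon> by (intro divide_right_mono) auto
    also have "\<dots> = 33 * Y" by (simp add: Y_def)
    finally have "ln (R / \<epsilon>) \<le> ln (33 * Y)" using R0 \<epsilon> by (intro ln_mono) auto
    also have "\<dots> = ln 33 + ln Y" using Y3 by (subst ln_mult) auto
    also have "ln (33::real) \<le> 32" using ln_le_minus_one[of "33::real"] by simp
    also have "32 + ln Y \<le> 33 * ln Y" using lnY by simp
    also have "ln Y = \<delta> * T2" using \<delta> by (simp add: T2_def Y_def l_def)
    also have "33 * (\<delta> * T2) \<le> 33 * (\<delta> * T)" using \<delta> by (intro mult_left_mono) (auto simp: T_def)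
    finally show ?thesis by simp
  qed
  have T0: "0 \<le> T"
    unfolding T_def T1_def l_def[symmetric] using n q25 l2
    by (intro max.coboundedI1 mult_nonneg_nonneg ln_ge_zero) (auto intro: order_trans[OF _ mult_mono[of 1 q 1 l]])
  have third: "4545 * (\<delta> * T) \<le> m * \<eta> / (4 * R)"
  proof -
    have "600000 * K * (1 / \<delta>\<^sup>2 * l * T) = 600000 * q * l * T" by (simp add: q_def)
    then have mq: "600000 * q * l * T \<le> m" using m by (simp add: T_def T1_def T2_def l_def)
    have "4545 * (\<delta> * T) * (4 * real R) \<le> 4545 * (\<delta> * T) * (4 * (33 * l / \<delta>))"
      using Rup T0 \<delta> by (intro mult_left_mono) auto
    also have "\<dots> = 599940 * (l * T)" using \<delta> by simp
    also have "\<dots> \<le> 600000 * (l * T)" using l2 T0 by (intro mult_right_mono) auto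
    also have "\<dots> = 600000 * q * l * T / q" using q0 by simp
    also have "\<dots> \<le> m / q" using mq q0 by (intro divide_right_mono) auto
    finally have "4545 * (\<delta> * T) \<le> m / q / (4 * real R)" using R0 by (subst pos_le_divide_eq) auto
    then show ?thesis by (simp add: \<eta>q)
  qed
  have "0 \<le> \<delta> * T" using \<delta> T0 by simp
  then show ?thesis using R0 Rpow first second third by (intro exI[of _ R] conjI) linarith+
qed

section \<open>The recovery theorem\<close>

text \<open>
  The best approximation error is an infimum that may be infinite and need not be attained, so the
  error bounds are proved for each competitor separately.
\<close>

lemma ennreal_le_cmult_INF_add:
  fixes g :: "'b \<Rightarrow> ennreal" and X :: ennreal
  assumes c: "0 < c" and le: "\<And>a. a \<in> A \<Longrightarrow> X \<le> ennreal c * g a + ennreal B"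
  shows "X \<le> ennreal c * (INF a\<in>A. g a) + ennreal B"
proof -
  define k where "k = ennreal (1 / c)"
  have kc: "k * ennreal c = 1" using c by (simp add: k_def flip: ennreal_mult)
  have "k * (X - ennreal B) \<le> (INF a\<in>A. g a)"
  proof (rule INF_greatest)
    fix a assume a: "a \<in> A"
    have "X - ennreal B \<le> ennreal c * g a" using le[OF a] by (simp add: ennreal_minus_le_iff add.commute)
    then have "k * (X - ennreal B) \<le> k * (ennreal c * g a)" by (rule mult_left_mono) simp
    then show "k * (X - ennreal B) \<le> g a" by (simp add: mult.assoc[symmetric] kc)
  qed
  then have "ennreal c * (k * (X - ennreal B)) \<le> ennreal c * (INF a\<in>A. g a)" by (rule mult_left_mono) simp
  moreover have "ennreal c * (k * (X - ennreal B)) = X - ennreal B"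
    by (simp add: mult.assoc[symmetric] kc mult.commute[of "ennreal c"])
  ultimately have "X - ennreal B \<le> ennreal c * (INF a\<in>A. g a)" by simp
  then show ?thesis by (simp add: ennreal_minus_le_iff add.commute)
qed

lemma weighted_l1_norm_finite_sum_le:
  assumes "weighted_l1_norm F d z \<le> ennreal r" "0 \<le> r" "finite T" "T \<subseteq> multi_indices d"
  shows "(\<Sum>i\<in>T. weight F d i * cmod (z i)) \<le> r"
proof -
  have nn: "0 \<le> weight F d i * cmod (z i)" for i
    using weight_ge_1[of F d i] by (intro mult_nonneg_nonneg) auto
  have "ennreal (\<Sum>i\<in>T. weight F d i * cmod (z i)) = (\<Sum>i\<in>T. ennreal (weight F d i * cmod (z i)))"
    using nn by (simp add: sum_ennreal)
  also have "\<dots> \<le> weighted_l1_norm F d z"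
    unfolding weighted_l1_norm_def
    by (subst nonneg_infsum_complete) (use assms in \<open>auto intro!: SUP_upper\<close>)
  also have "\<dots> \<le> ennreal r" by fact
  finally show ?thesis using assms(2) by (simp add: ennreal_le_iff)
qed

lemma l2_norm_sq: "(l2_norm m v)\<^sup>2 = (\<Sum>k<m. (cmod (v k))\<^sup>2)"
  by (simp add: l2_norm_def L2_set_def sum_nonneg)

lemma isometry_constant:
  fixes \<delta> :: real
  assumes "0 < \<delta>" "\<delta> < 1 / 5"
  shows "(1 + \<delta> / 16) ^ 6 / (1 - \<delta> / 16) \<le> 1 + \<delta>"
proof -
  define b where "b = \<delta> / 16"
  have b: "0 < b" "b \<le> 1 / 80" "\<delta> = 16 * b" using assms by (auto simp: b_def)
  have b2: "b * b \<le> b / 80" using b mult_left_mono[of b "1 / 80" b] by simp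
  have "(1 + b) ^ 3 = 1 + 3 * b + 3 * (b * b) + b * (b * b)"
    by (simp add: power3_eq_cube algebra_simps)
  also have "b * (b * b) \<le> b * (b / 80)" using b b2 by (intro mult_left_mono) auto
  also have "1 + 3 * b + 3 * (b * b) + b * (b / 80) \<le> 1 + 4 * b"
  proof -
    have "b * (b / 80) = b * b / 80" by simp
    then show ?thesis using b2 b by linarith
  qed
  finally have c3: "(1 + b) ^ 3 \<le> 1 + 4 * b" by simp
  have "(1 + b) ^ 6 = (1 + b) ^ 3 * (1 + b) ^ 3" by (simp flip: power_add)
  also have "\<dots> \<le> (1 + 4 * b) * (1 + 4 * b)" using c3 b by (intro mult_mono) auto
  also have "\<dots> = 1 + 8 * b + 16 * (b * b)" by (simp add: algebra_simps)
  also have "\<dots> \<le> 1 + 15 * b - 16 * (b * b)" using b2 b by simp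
  also have "\<dots> = (1 + \<delta>) * (1 - b)" using b by (simp add: algebra_simps)
  finally show ?thesis using b(1,2) unfolding b_def[symmetric] by (simp add: pos_divide_le_eq)
qed

text \<open>
  The convex hull theorem for the tensor basis, at accuracy \<open>\<beta> = \<delta> / 16\<close> and \<open>\<eta> = \<delta>\<^sup>2 / K\<close>.  The
  growth bound for \<open>K\<close> converts the sample size in terms of \<open>s\<^sup>\<gamma>\<close> into one in terms of \<open>K\<close>.
\<close>

lemma lower_isometry_event:
  fixes F d s m and \<epsilon> \<delta> :: real
  assumes d: "1 \<le> d" and \<epsilon>: "0 < \<epsilon>" "\<epsilon> < 1" and \<delta>: "0 < \<delta>" "\<delta> < 1 / 5" and s: "2 \<le> s"
    and m: "600000 * real s powr growth_exponent F * polylog_factor F d s (card (hyperbolic_cross d s)) \<delta> \<epsilon> \<le> real m"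
  defines "I \<equiv> hyperbolic_cross d s" and "P \<equiv> \<Pi>\<^sub>M k\<in>{..<m}. cube_measure F d" and "K \<equiv> max_lower_card F d s"
  shows "\<exists>E\<in>sets P. 1 - \<epsilon> \<le> measure P E \<and>
    (\<forall>t\<in>E. \<forall>z. (\<Sum>i\<in>I. (cmod (z i))\<^sup>2)
       \<le> (1 + \<delta>) * (l2_norm m (mat_vec (design_matrix F d m t) I z))\<^sup>2
          + \<delta>\<^sup>2 / K * (\<Sum>i\<in>I. weight F d i * cmod (z i))\<^sup>2)"
proof -
  interpret prob_space "cube_measure F d" by (rule prob_space_cube_measure)
  have I2: "2 \<le> card I" unfolding I_def using d s by (rule card_hyperbolic_cross_ge_2)
  have I: "finite I" "I \<noteq> {}" using I2 by (auto simp: I_def hyperbolic_cross_finite)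
  have Im: "I \<subseteq> multi_indices d" by (auto simp: I_def hyperbolic_cross_def)
  have K1: "1 \<le> K" unfolding K_def using s by (intro max_lower_card_ge_1) auto
  define L where "L = polylog_factor F d s (card I) \<delta> \<epsilon>"
  have L_eq: "L = 1 / \<delta>\<^sup>2 * ln (K / \<delta>\<^sup>2) * max (1 / \<delta>^4 * ln (K / \<delta>\<^sup>2 * ln (K / \<delta>\<^sup>2)) * ln (card I))
       (1 / \<delta> * ln (1 / (\<delta> * \<epsilon>) * ln (K / \<delta>\<^sup>2)))"
    by (simp add: L_def polylog_factor_def Let_def K_def)
  have L0: "0 \<le> L"
  proof -
    have "\<delta>\<^sup>2 \<le> (1 / 5)\<^sup>2" using \<delta> by (intro power_mono) auto
    then have "25 * \<delta>\<^sup>2 \<le> K" using K1 by (simp add: power_divide)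
    then have q: "25 \<le> K / \<delta>\<^sup>2" using \<delta> by (simp add: pos_le_divide_eq)
    have "exp 1 \<le> K / \<delta>\<^sup>2" using exp_le q by linarith
    then have lq: "1 \<le> ln (K / \<delta>\<^sup>2)" using q by (subst ln_ge_iff) auto
    have "1 * 1 \<le> K / \<delta>\<^sup>2 * ln (K / \<delta>\<^sup>2)" using q lq by (intro mult_mono) auto
    then have "0 \<le> ln (K / \<delta>\<^sup>2 * ln (K / \<delta>\<^sup>2))" by simp
    then have "0 \<le> 1 / \<delta>^4 * ln (K / \<delta>\<^sup>2 * ln (K / \<delta>\<^sup>2)) * ln (card I)"
      using I2 by (intro mult_nonneg_nonneg) auto
    then have "0 \<le> max (1 / \<delta>^4 * ln (K / \<delta>\<^sup>2 * ln (K / \<delta>\<^sup>2)) * ln (card I))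
       (1 / \<delta> * ln (1 / (\<delta> * \<epsilon>) * ln (K / \<delta>\<^sup>2)))" by (rule max.coboundedI1)
    moreover have "0 \<le> 1 / \<delta>\<^sup>2 * ln (K / \<delta>\<^sup>2)" using lq by simp
    ultimately show ?thesis unfolding L_eq by (rule mult_nonneg_nonneg[rotated])
  qed
  have "600000 * K * L \<le> 600000 * real s powr growth_exponent F * L"
    unfolding K_def using L0 by (intro mult_right_mono mult_left_mono max_lower_card_le_powr) auto
  also have "\<dots> \<le> real m" using m by (simp add: L_def I_def)
  finally have mK: "600000 * K * L \<le> real m" .
  obtain R :: nat where R: "R > 0" "(1 / (1 + \<delta> / 16)) ^ (2 * R) \<le> \<delta>\<^sup>2 / K / 4"
    "(2 * (1 + \<delta> / 16) ^ 6 * ln (16 / (\<delta>\<^sup>2 / K)) / (\<delta> / 16)\<^sup>2 + 1) * ln (2 * real (card I)) + ln (R / \<epsilon>)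
       \<le> m * (\<delta>\<^sup>2 / K) / (4 * R)"
    using sample_complexity[OF K1 \<delta> \<epsilon>, of "real (card I)" "real m"] mK I2 unfolding L_eq by auto
  have \<eta>: "0 < \<delta>\<^sup>2 / K" "\<delta>\<^sup>2 / K \<le> 1"
  proof -
    have "\<delta>\<^sup>2 \<le> 1" using \<delta> by (simp add: power_le_one)
    then show "0 < \<delta>\<^sup>2 / K" "\<delta>\<^sup>2 / K \<le> 1" using \<delta> K1 by auto
  qed
  have "\<exists>E\<in>sets P. 1 - \<epsilon> \<le> measure P E \<and>
     (\<forall>t\<in>E. \<forall>z. (\<Sum>i\<in>I. (cmod (z i))\<^sup>2)
          \<le> (1 + \<delta> / 16) ^ 6 / (1 - \<delta> / 16) *
              ((\<Sum>k<m. (cmod (\<Sum>i\<in>I. z i * of_real (tensor_real F d i (t k))))\<^sup>2) / m)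
             + \<delta>\<^sup>2 / K * (\<Sum>i\<in>I. weight F d i * cmod (z i))\<^sup>2)"
    unfolding P_def
  proof (rule weighted_lower_isometry[OF I])
    show "0 < weight F d i" for i using weight_ge_1[of F d i] by simp
    show "tensor_real F d i \<in> borel_measurable (cube_measure F d)" for i by (rule measurable_tensor_real)
    show "\<bar>tensor_real F d i x\<bar> \<le> weight F d i" if "x \<in> space (cube_measure F d)" for i x
      using tensor_real_bound[OF that] by (simp add: weight_eq)
    show "(\<integral>x. tensor_real F d i x * tensor_real F d j x \<partial>cube_measure F d) = of_bool (i = j)"
      if "i \<in> I" "j \<in> I" for i j
      using tensor_real_orthonormal that Im by blast
    show "(2 * (1 + \<delta> / 16) ^ 6 * ln (16 / (\<delta>\<^sup>2 / K)) / (\<delta> / 16)\<^sup>2 + 1) * ln (real (2 * card I)) + ln (R / \<epsilon>)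
       \<le> m * (\<delta>\<^sup>2 / K) / (4 * R)"
      using R(3) by simp
  qed (use \<delta> \<epsilon> \<eta> R in auto)
  then obtain E where E: "E \<in> sets P" "1 - \<epsilon> \<le> measure P E"
    and iso: "\<And>t z. t \<in> E \<Longrightarrow> (\<Sum>i\<in>I. (cmod (z i))\<^sup>2)
          \<le> (1 + \<delta> / 16) ^ 6 / (1 - \<delta> / 16) *
              ((\<Sum>k<m. (cmod (\<Sum>i\<in>I. z i * of_real (tensor_real F d i (t k))))\<^sup>2) / m)
             + \<delta>\<^sup>2 / K * (\<Sum>i\<in>I. weight F d i * cmod (z i))\<^sup>2"
    by blast
  show ?thesis
  proof (intro bexI[of _ E] conjI ballI allI E)
    fix t z assume t: "t \<in> E"
    have "(\<Sum>k<m. (cmod (\<Sum>i\<in>I. z i * of_real (tensor_real F d i (t k))))\<^sup>2) / m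
        = (l2_norm m (mat_vec (design_matrix F d m t) I z))\<^sup>2"
    proof -
      have "(cmod (mat_vec (design_matrix F d m t) I z k))\<^sup>2
          = (cmod (\<Sum>i\<in>I. z i * of_real (tensor_real F d i (t k))))\<^sup>2 / m" for k
      proof -
        have "mat_vec (design_matrix F d m t) I z k
            = of_real (1 / sqrt m) * (\<Sum>i\<in>I. z i * of_real (tensor_real F d i (t k)))"
          by (simp add: mat_vec_def design_matrix_def tensor_poly_eq sum_distrib_left mult_ac)
        then have "cmod (mat_vec (design_matrix F d m t) I z k)
            = 1 / sqrt m * cmod (\<Sum>i\<in>I. z i * of_real (tensor_real F d i (t k)))"
          by (simp only: norm_mult norm_of_real) simp
        then show ?thesis by (simp add: power_divide)
      qed
      then show ?thesis by (simp add: l2_norm_sq sum_divide_distrib)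
    qed
    then have "(\<Sum>i\<in>I. (cmod (z i))\<^sup>2)
       \<le> (1 + \<delta> / 16) ^ 6 / (1 - \<delta> / 16) * (l2_norm m (mat_vec (design_matrix F d m t) I z))\<^sup>2
          + \<delta>\<^sup>2 / K * (\<Sum>i\<in>I. weight F d i * cmod (z i))\<^sup>2"
      using iso[OF t, of z] by simp
    also have "\<dots> \<le> (1 + \<delta>) * (l2_norm m (mat_vec (design_matrix F d m t) I z))\<^sup>2
          + \<delta>\<^sup>2 / K * (\<Sum>i\<in>I. weight F d i * cmod (z i))\<^sup>2"
      by (intro add_right_mono mult_right_mono isometry_constant \<delta>) simp
    finally show "(\<Sum>i\<in>I. (cmod (z i))\<^sup>2)
       \<le> (1 + \<delta>) * (l2_norm m (mat_vec (design_matrix F d m t) I z))\<^sup>2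
          + \<delta>\<^sup>2 / K * (\<Sum>i\<in>I. weight F d i * cmod (z i))\<^sup>2" .
  qed
qed

text \<open>
  Every competitor \<open>z'\<close> in the definition of the best approximation error provides a lower support
  set \<open>S\<close>, and the weighted \<open>\<ell>\<^sup>1\<close> norm of \<open>x\<close> off \<open>S\<close> is at most its distance to \<open>z'\<close>.  The part of it inside
  the hyperbolic cross controls the LASSO error, and the part outside is the truncation error.
  The two comparisons of \<open>K\<close> with \<open>s\<^sup>\<gamma>\<close> replace \<open>sqrt K\<close> by \<open>w = s\<^bsup>\<gamma> / 2\<^esup>\<close>.
\<close>

lemma recovery_bounds:
  fixes F d s m t f e xhat and \<delta> \<theta> :: real
  assumes d: "1 \<le> d" and \<delta>: "0 < \<delta>" "\<delta> < 1 / 5" and s: "2 \<le> s" "s \<le> 2 ^ (d + 1)"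
  defines "\<nu> \<equiv> cube_measure F d" and "I \<equiv> hyperbolic_cross d s" and "K \<equiv> max_lower_card F d s"
    and "A \<equiv> design_matrix F d m t" and "x \<equiv> coeffs_of F d f"
    and "\<rho> \<equiv> 4 * \<delta> / (1 - \<delta>)" and "\<tau> \<equiv> sqrt (1 + \<delta>) / (1 - \<delta>)"
    and "w \<equiv> real s powr (growth_exponent F / 2)"
  assumes f: "f \<in> L2_space \<nu>"
    and iso: "\<And>z. (\<Sum>i\<in>I. (cmod (z i))\<^sup>2)
       \<le> (1 + \<delta>) * (l2_norm m (mat_vec A I z))\<^sup>2 + \<delta>\<^sup>2 / K * (\<Sum>i\<in>I. weight F d i * cmod (z i))\<^sup>2"
    and \<theta>: "(5 + \<rho>) * \<tau> / ((1 + \<rho>) * (2 + \<rho>)) \<le> \<theta>"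
    and min: "sr_lasso_minimizer F d m I A (\<lambda>k. mat_vec A I x k + e k) (\<theta> * sqrt K) xhat"
  shows "Linf_norm \<nu> (\<lambda>p. f p - expansion F d I xhat p)
      \<le> ennreal ((3 + \<rho>) / (1 - \<rho>)) * lower_approx_error F d s x
         + ennreal (((1 + \<rho>) * \<theta> + 2 * \<tau>) / (1 - \<rho>) * w * l2_norm m e)"
    and "ennreal (L2_norm \<nu> (\<lambda>p. f p - expansion F d I xhat p))
      \<le> ennreal (4 * (1 + \<rho>) * (2 + \<rho>) / (1 - \<rho>)) * (lower_approx_error F d s x / ennreal w)
         + ennreal (((1 + \<rho>) * (2 + \<rho>) * \<theta> + (5 + \<rho>) * \<tau>) / (1 - \<rho>) * l2_norm m e)
         + ennreal (L2_norm \<nu> (\<lambda>p. f p - expansion F d I x p))"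
proof -
  note c = lasso_constants[OF \<delta>, folded \<rho>_def \<tau>_def]
  have Ifin: "finite I" by (simp add: I_def hyperbolic_cross_finite)
  have Im: "I \<subseteq> multi_indices d" by (auto simp: I_def hyperbolic_cross_def)
  have K1: "1 \<le> K" unfolding K_def using s by (intro max_lower_card_ge_1) auto
  have K0: "0 < K" using K1 by simp
  have w0: "0 < w" using s by (simp add: w_def)
  have w2: "w\<^sup>2 = real s powr growth_exponent F"
    using s by (simp add: w_def powr_power)
  have Kw: "sqrt K \<le> w"
    using max_lower_card_le_powr[of F d s] w0 by (intro real_le_lsqrt) (auto simp: w2 K_def)
  have wK: "w \<le> 2 * sqrt K"
  proof (rule power2_le_imp_le)
    have "w\<^sup>2 \<le> 3 * K" unfolding w2 K_def using d s by (intro max_lower_card_ge_powr) auto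
    also have "\<dots> \<le> (2 * sqrt K)\<^sup>2" using K1 by (simp add: power_mult_distrib)
    finally show "w\<^sup>2 \<le> (2 * sqrt K)\<^sup>2" .
  qed (use K1 in simp)
  define u where "u = weight F d"
  have u0: "0 \<le> u i" for i using weight_ge_1[of F d i] by (simp add: u_def)
  define E where "E = l2_norm m e"
  have E0: "0 \<le> E" by (simp add: E_def l2_norm_def L2_set_nonneg)
  have xh0: "xhat i = 0" if "i \<notin> I" for i
    using min that by (simp add: sr_lasso_minimizer_def is_arg_min_def vectors_on_def)
  have \<theta>0: "0 \<le> \<theta>"
    using \<theta> c by (intro order_trans[OF _ \<theta>] divide_nonneg_nonneg mult_nonneg_nonneg) auto
  define y where "y = (\<lambda>k. mat_vec A I x k + e k)"
  define z where "z = (\<lambda>i. if i \<in> I then x i else 0)"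
  have min': "(\<Sum>i\<in>I. u i * cmod (xhat i)) + \<theta> * sqrt K * l2_norm m (\<lambda>k. mat_vec A I xhat k - y k)
        \<le> (\<Sum>i\<in>I. u i * cmod (x i)) + \<theta> * sqrt K * l2_norm m (\<lambda>k. mat_vec A I x k - y k)"
  proof -
    \<comment> \<open>The minimizer is compared with the truncated coefficient vector.\<close>
    have "z \<in> vectors_on I" by (simp add: z_def vectors_on_def)
    then have "sr_lasso_objective F d m I A y (\<theta> * sqrt K) xhat \<le> sr_lasso_objective F d m I A y (\<theta> * sqrt K) z"
      using min by (auto simp: sr_lasso_minimizer_def is_arg_min_def y_def not_less)
    moreover have "sr_lasso_objective F d m I A y (\<theta> * sqrt K) z = sr_lasso_objective F d m I A y (\<theta> * sqrt K) x"
    proof -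
      have "mat_vec A I z = mat_vec A I x" by (simp add: mat_vec_def z_def fun_eq_iff cong: sum.cong)
      moreover have "(\<Sum>i\<in>I. weight F d i * cmod (z i)) = (\<Sum>i\<in>I. weight F d i * cmod (x i))"
        by (simp add: z_def cong: sum.cong)
      ultimately show ?thesis by (simp only: sr_lasso_objective_def)
    qed
    ultimately show ?thesis by (simp add: sr_lasso_objective_def u_def)
  qed
  define V1 where "V1 = (\<Sum>i\<in>I. u i * cmod (xhat i - x i))"
  define V2 where "V2 = sqrt (\<Sum>i\<in>I. (cmod (xhat i - x i))\<^sup>2)"
  define G where "G = (\<lambda>z'. weighted_l1_norm F d (\<lambda>i. x i - z' i))"
  define Z where "Z = {z'. {i. z' i \<noteq> 0} \<subseteq> multi_indices d \<and> finite {i. z' i \<noteq> 0} \<and>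
                     card {i. z' i \<noteq> 0} \<le> s \<and> lower_set {i. z' i \<noteq> (0::complex)}}"
  have \<sigma>_eq: "lower_approx_error F d s x = (INF z'\<in>Z. G z')"
    by (simp add: lower_approx_error_def Z_def G_def)
  have key: "(\<forall>T. finite T \<longrightarrow> T \<subseteq> multi_indices d \<longrightarrow>
        (\<Sum>i\<in>T. u i * cmod (x i - xhat i)) \<le> (3 + \<rho>) / (1 - \<rho>) * r + ((1 + \<rho>) * \<theta> + 2 * \<tau>) / (1 - \<rho>) * w * E)
      \<and> V2 \<le> 4 * (1 + \<rho>) * (2 + \<rho>) / (1 - \<rho>) / w * r + ((1 + \<rho>) * (2 + \<rho>) * \<theta> + (5 + \<rho>) * \<tau>) / (1 - \<rho>) * E"
    if z': "z' \<in> Z" and r: "G z' = ennreal r" "0 \<le> r" for z' r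
  proof -
    define S where "S = {i. z' i \<noteq> 0}"
    have S: "S \<in> small_lower_sets d s" using z' by (simp add: Z_def S_def small_lower_sets_def)
    have SI: "S \<subseteq> I"
      using S lower_set_subset_hyperbolic_cross by (auto simp: small_lower_sets_def I_def)
    have SK: "(\<Sum>i\<in>S. (u i)\<^sup>2) \<le> K"
      using max_lower_card_ge[OF S, of F] by (simp add: weighted_card_def K_def u_def)
    have part: "(\<Sum>i\<in>T. u i * cmod (x i)) \<le> r" if "finite T" "T \<subseteq> multi_indices d" "T \<inter> S = {}" for T
    proof -
      have "(\<Sum>i\<in>T. u i * cmod (x i)) = (\<Sum>i\<in>T. u i * cmod (x i - z' i))"
        using that(3) by (intro sum.cong refl) (auto simp: S_def)
      also have "\<dots> \<le> r"
        unfolding u_def by (rule weighted_l1_norm_finite_sum_le[OF _ r(2) that(1,2)]) (use r in \<open>simp add: G_def\<close>)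
      finally show ?thesis .
    qed
    define \<sigma> where "\<sigma> = (\<Sum>i\<in>I - S. u i * cmod (x i))"
    have \<sigma>: "0 \<le> \<sigma>" "\<sigma> \<le> r"
      unfolding \<sigma>_def using u0 Ifin Im by (auto intro!: sum_nonneg mult_nonneg_nonneg part)
    note rec' = sr_lasso_recovery[where u = u and e = e and y = y and xh = xhat,
        OF \<delta> K0 \<theta>[unfolded \<rho>_def \<tau>_def] Ifin SI SK u0 iso[folded u_def] y_def min']
    have rec: "V1 \<le> (2 * (1 + \<rho>) * \<sigma> + sqrt K * (((1 + \<rho>) * \<theta> + 2 * \<tau>) * E)) / (1 - \<rho>)"
      "V2 \<le> (2 * (1 + \<rho>) * (2 + \<rho>) * \<sigma> / sqrt K + ((1 + \<rho>) * (2 + \<rho>) * \<theta> + (5 + \<rho>) * \<tau>) * E) / (1 - \<rho>)"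
      unfolding V1_def V2_def \<sigma>_def E_def \<rho>_def \<tau>_def by (rule rec'(1), rule rec'(2))
    have quot: "(a * r + w * (c * E)) / d = a / d * r + c / d * w * E"
      "(a / w * r + c * E) / d = a / d / w * r + c / d * E"
      "p * q * v * (2 / k) = 2 * p * q * v / k" "p * q * v * (4 / k) = 4 * p * q / k * v" for a c d p q v k :: real
      by (simp_all add: add_divide_distrib mult_ac)
    show ?thesis
    proof (intro conjI allI impI)
      fix T assume T: "finite T" "T \<subseteq> multi_indices d"
      define \<kappa> where "\<kappa> = (\<Sum>i\<in>T - I. u i * cmod (x i))"
      have \<kappa>0: "0 \<le> \<kappa>" unfolding \<kappa>_def using u0 by (intro sum_nonneg mult_nonneg_nonneg) auto
      have "\<kappa> + \<sigma> = (\<Sum>i\<in>(T - I) \<union> (I - S). u i * cmod (x i))"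
        unfolding \<kappa>_def \<sigma>_def by (rule sum.union_disjoint[symmetric]) (use T Ifin in auto)
      also have "\<dots> \<le> r" by (rule part) (use T Ifin Im SI in auto)
      finally have \<kappa>\<sigma>: "\<kappa> + \<sigma> \<le> r" .
      have "(\<Sum>i\<in>T. u i * cmod (x i - xhat i))
          = (\<Sum>i\<in>T \<inter> I. u i * cmod (x i - xhat i)) + (\<Sum>i\<in>T - I. u i * cmod (x i - xhat i))"
        using sum.Int_Diff[OF T(1)] .
      also have "(\<Sum>i\<in>T - I. u i * cmod (x i - xhat i)) = \<kappa>"
        unfolding \<kappa>_def by (intro sum.cong refl) (auto simp: xh0)
      also have "(\<Sum>i\<in>T \<inter> I. u i * cmod (x i - xhat i)) \<le> (\<Sum>i\<in>I. u i * cmod (x i - xhat i))"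
        using Ifin u0 by (intro sum_mono2 mult_nonneg_nonneg) auto
      also have "\<dots> = V1" by (simp add: V1_def norm_minus_commute)
      finally have "(\<Sum>i\<in>T. u i * cmod (x i - xhat i)) \<le> V1 + \<kappa>" by simp
      also have "\<dots> \<le> (2 * (1 + \<rho>) * \<sigma> + sqrt K * (((1 + \<rho>) * \<theta> + 2 * \<tau>) * E)) / (1 - \<rho>) + \<kappa>"
        using rec(1) by simp
      also have "\<dots> \<le> ((3 + \<rho>) * r + w * (((1 + \<rho>) * \<theta> + 2 * \<tau>) * E)) / (1 - \<rho>)"
      proof -
        have "(1 - \<rho>) * \<kappa> \<le> (3 + \<rho>) * \<kappa>" using c \<kappa>0 by (intro mult_right_mono) auto
        moreover have "2 * (1 + \<rho>) * \<sigma> \<le> (3 + \<rho>) * \<sigma>" using c \<sigma> by (intro mult_right_mono) auto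
        moreover have "(3 + \<rho>) * (\<kappa> + \<sigma>) \<le> (3 + \<rho>) * r" using c \<kappa>\<sigma> by (intro mult_left_mono) auto
        moreover have "sqrt K * (((1 + \<rho>) * \<theta> + 2 * \<tau>) * E) \<le> w * (((1 + \<rho>) * \<theta> + 2 * \<tau>) * E)"
          using Kw c \<theta>0 E0 by (intro mult_right_mono mult_nonneg_nonneg add_nonneg_nonneg) auto
        ultimately have "2 * (1 + \<rho>) * \<sigma> + sqrt K * (((1 + \<rho>) * \<theta> + 2 * \<tau>) * E) + (1 - \<rho>) * \<kappa>
            \<le> (3 + \<rho>) * r + w * (((1 + \<rho>) * \<theta> + 2 * \<tau>) * E)"
          unfolding distrib_left[of "3 + \<rho>"] by linarith
        then have "(2 * (1 + \<rho>) * \<sigma> + sqrt K * (((1 + \<rho>) * \<theta> + 2 * \<tau>) * E) + (1 - \<rho>) * \<kappa>) / (1 - \<rho>)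
            \<le> ((3 + \<rho>) * r + w * (((1 + \<rho>) * \<theta> + 2 * \<tau>) * E)) / (1 - \<rho>)"
          using c by (intro divide_right_mono) auto
        then show ?thesis using c by (simp add: add_divide_distrib[of _ "(1 - \<rho>) * \<kappa>"])
      qed
      finally show "(\<Sum>i\<in>T. u i * cmod (x i - xhat i))
          \<le> (3 + \<rho>) / (1 - \<rho>) * r + ((1 + \<rho>) * \<theta> + 2 * \<tau>) / (1 - \<rho>) * w * E"
        by (simp only: quot)
    next
      have "2 / sqrt K \<le> 4 / w"
        using wK w0 K1 by (simp add: field_simps)
      then have "(1 + \<rho>) * (2 + \<rho>) * \<sigma> * (2 / sqrt K) \<le> (1 + \<rho>) * (2 + \<rho>) * r * (4 / w)"
        using c \<sigma> w0 K1 by (intro mult_mono mult_nonneg_nonneg) auto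
      then have "2 * (1 + \<rho>) * (2 + \<rho>) * \<sigma> / sqrt K \<le> 4 * (1 + \<rho>) * (2 + \<rho>) / w * r"
        by (simp only: quot)
      then have "(2 * (1 + \<rho>) * (2 + \<rho>) * \<sigma> / sqrt K + ((1 + \<rho>) * (2 + \<rho>) * \<theta> + (5 + \<rho>) * \<tau>) * E) / (1 - \<rho>)
         \<le> (4 * (1 + \<rho>) * (2 + \<rho>) / w * r + ((1 + \<rho>) * (2 + \<rho>) * \<theta> + (5 + \<rho>) * \<tau>) * E) / (1 - \<rho>)"
        using c by (intro divide_right_mono) auto
      with rec(2) have "V2 \<le> (4 * (1 + \<rho>) * (2 + \<rho>) / w * r + ((1 + \<rho>) * (2 + \<rho>) * \<theta> + (5 + \<rho>) * \<tau>) * E) / (1 - \<rho>)"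
        by linarith
      then show "V2 \<le> 4 * (1 + \<rho>) * (2 + \<rho>) / (1 - \<rho>) / w * r + ((1 + \<rho>) * (2 + \<rho>) * \<theta> + (5 + \<rho>) * \<tau>) / (1 - \<rho>) * E"
        by (simp only: quot)
    qed
  qed
  have fi: "integrable \<nu> f" unfolding \<nu>_def by (rule L2_space_integrable[OF f[unfolded \<nu>_def]])
  have di: "integrable \<nu> (\<lambda>p. f p - expansion F d I xhat p)"
    using fi unfolding \<nu>_def by (intro Bochner_Integration.integrable_diff integrable_expansion)
  have dc: "coeffs_of F d (\<lambda>p. f p - expansion F d I xhat p) i = x i - xhat i" if "i \<in> multi_indices d" for i
    using that xh0 fi coeffs_of_expansion[OF Im Ifin that, of F xhat] unfolding \<nu>_def
    by (auto simp: coeffs_of_diff integrable_expansion x_def)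
  have C1: "0 < (3 + \<rho>) / (1 - \<rho>)" using c by (intro divide_pos_pos) auto
  show "Linf_norm \<nu> (\<lambda>p. f p - expansion F d I xhat p)
      \<le> ennreal ((3 + \<rho>) / (1 - \<rho>)) * lower_approx_error F d s x
         + ennreal (((1 + \<rho>) * \<theta> + 2 * \<tau>) / (1 - \<rho>) * w * l2_norm m e)"
    unfolding \<sigma>_eq
  proof (rule ennreal_le_cmult_INF_add[OF C1])
    fix z' assume z': "z' \<in> Z"
    show "Linf_norm \<nu> (\<lambda>p. f p - expansion F d I xhat p)
        \<le> ennreal ((3 + \<rho>) / (1 - \<rho>)) * G z' + ennreal (((1 + \<rho>) * \<theta> + 2 * \<tau>) / (1 - \<rho>) * w * l2_norm m e)"
    proof (cases "G z'")
      case (real r)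
      define B where "B = (3 + \<rho>) / (1 - \<rho>) * r + ((1 + \<rho>) * \<theta> + 2 * \<tau>) / (1 - \<rho>) * w * E"
      have "AE p in \<nu>. cmod (f p - expansion F d I xhat p) \<le> B"
        unfolding \<nu>_def
      proof (rule AE_bounded_by_coeffs[OF d di[unfolded \<nu>_def]])
        fix T assume T: "finite T" "T \<subseteq> multi_indices d"
        have "(\<Sum>i\<in>T. weight F d i * cmod (coeffs_of F d (\<lambda>p. f p - expansion F d I xhat p) i))
            = (\<Sum>i\<in>T. u i * cmod (x i - xhat i))"
          unfolding u_def using T by (intro sum.cong refl) (auto simp: dc subset_eq)
        also have "\<dots> \<le> B" unfolding B_def using key[OF z' real(2,1)] T by blast
        finally show "(\<Sum>i\<in>T. weight F d i * cmod (coeffs_of F d (\<lambda>p. f p - expansion F d I xhat p) i)) \<le> B" .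
      qed
      then have "Linf_norm \<nu> (\<lambda>p. f p - expansion F d I xhat p) \<le> ennreal B"
        unfolding Linf_norm_def using borel_measurable_integrable[OF di]
        by (intro esssup_I) (auto intro: ennreal_leI)
      also have "ennreal B = ennreal ((3 + \<rho>) / (1 - \<rho>)) * G z'
          + ennreal (((1 + \<rho>) * \<theta> + 2 * \<tau>) / (1 - \<rho>) * w * l2_norm m e)"
      proof -
        have "0 \<le> (3 + \<rho>) / (1 - \<rho>) * r" using C1 real by (intro mult_nonneg_nonneg) auto
        moreover have "0 \<le> ((1 + \<rho>) * \<theta> + 2 * \<tau>) / (1 - \<rho>) * w * E"
          using c \<theta>0 E0 w0 by (intro mult_nonneg_nonneg divide_nonneg_nonneg add_nonneg_nonneg) auto
        ultimately show ?thesis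
          unfolding B_def real(2) E_def[symmetric]
          by (simp only: ennreal_plus ennreal_mult[OF less_imp_le[OF C1] real(1)])
      qed
      finally show ?thesis .
    next
      case top
      then show ?thesis using c(1,2) by (simp add: ennreal_mult_top)
    qed
  qed
  define C3 where "C3 = 4 * (1 + \<rho>) * (2 + \<rho>) / (1 - \<rho>)"
  have C3: "0 < C3" unfolding C3_def using c by (intro divide_pos_pos mult_pos_pos) auto
  define N where "N = L2_norm \<nu> (\<lambda>p. f p - expansion F d I x p)"
  have N0: "0 \<le> N" by (simp add: N_def L2_norm_def)
  define B where "B = ((1 + \<rho>) * (2 + \<rho>) * \<theta> + (5 + \<rho>) * \<tau>) / (1 - \<rho>) * E"
  have B0: "0 \<le> B"
    unfolding B_def using c \<theta>0 E0 by (intro mult_nonneg_nonneg divide_nonneg_nonneg add_nonneg_nonneg) auto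
  have "ennreal (L2_norm \<nu> (\<lambda>p. f p - expansion F d I xhat p)) \<le> ennreal (C3 / w) * (INF z'\<in>Z. G z') + ennreal (B + N)"
  proof (rule ennreal_le_cmult_INF_add)
    show "0 < C3 / w" using C3 w0 by simp
    fix z' assume z': "z' \<in> Z"
    show "ennreal (L2_norm \<nu> (\<lambda>p. f p - expansion F d I xhat p)) \<le> ennreal (C3 / w) * G z' + ennreal (B + N)"
    proof (cases "G z'")
      case (real r)
      have "L2_norm \<nu> (\<lambda>p. f p - expansion F d I xhat p) \<le> V2 + N"
        unfolding V2_def N_def \<nu>_def x_def by (rule L2_norm_expansion_triangle[OF f[unfolded \<nu>_def] Im Ifin])
      also have "\<dots> \<le> C3 / w * r + (B + N)"
        using key[OF z' real(2,1)] unfolding C3_def B_def by linarith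
      finally have "ennreal (L2_norm \<nu> (\<lambda>p. f p - expansion F d I xhat p)) \<le> ennreal (C3 / w * r + (B + N))"
        by (rule ennreal_leI)
      also have "\<dots> = ennreal (C3 / w) * G z' + ennreal (B + N)"
      proof -
        have p: "0 \<le> C3 / w" "0 \<le> B + N" "0 \<le> C3 / w * r" using C3 w0 B0 N0 real(1) by simp_all
        show ?thesis
          unfolding real(2) by (simp only: ennreal_plus[OF p(3,2)] ennreal_mult[OF p(1) real(1)])
      qed
      finally show ?thesis .
    next
      case top
      then show ?thesis using C3 w0 by (simp add: ennreal_mult_top)
    qed
  qed
  also have "ennreal (C3 / w) * (INF z'\<in>Z. G z') = ennreal C3 * ((INF z'\<in>Z. G z') / ennreal w)"
  proof -
    have "ennreal (C3 / w) = ennreal C3 / ennreal w" using C3 w0 by (simp add: divide_ennreal)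
    then show ?thesis by (simp add: ennreal_divide_times)
  qed
  also have "ennreal (B + N) = ennreal B + ennreal N" using B0 N0 by simp
  finally show "ennreal (L2_norm \<nu> (\<lambda>p. f p - expansion F d I xhat p))
      \<le> ennreal (4 * (1 + \<rho>) * (2 + \<rho>) / (1 - \<rho>)) * (lower_approx_error F d s x / ennreal w)
         + ennreal (((1 + \<rho>) * (2 + \<rho>) * \<theta> + (5 + \<rho>) * \<tau>) / (1 - \<rho>) * l2_norm m e)
         + ennreal (L2_norm \<nu> (\<lambda>p. f p - expansion F d I x p))"
    by (simp add: \<sigma>_eq C3_def B_def N_def E_def add.assoc)
qed

theorem theorem5p14:
  "\<exists>c::real. c > 0 \<and>
    (\<forall>(F::poly_family) (d::nat) (s::nat) (m::nat) (\<epsilon>::real) (\<delta>::real).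
      d \<ge> 1 \<longrightarrow> 0 < \<epsilon> \<longrightarrow> \<epsilon> < 1 \<longrightarrow> 0 < \<delta> \<longrightarrow> \<delta> < 1 / 5 \<longrightarrow> 2 \<le> s \<longrightarrow> s \<le> 2 ^ (d + 1) \<longrightarrow>
      (let \<nu> = cube_measure F d;
           \<gamma> = growth_exponent F;
           \<Lambda> = hyperbolic_cross d s;
           \<rho> = 4 * \<delta> / (1 - \<delta>);
           \<tau> = sqrt (1 + \<delta>) / (1 - \<delta>);
           P = (\<Pi>\<^sub>M k\<in>{..<m}. \<nu>)
       in real m \<ge> c * real s powr \<gamma> * polylog_factor F d s (card \<Lambda>) \<delta> \<epsilon> \<longrightarrow>
         (\<exists>E\<in>sets P. measure P E \<ge> 1 - \<epsilon> \<and>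
           (\<forall>t\<in>E. \<forall>f\<in>L2_space \<nu> \<inter> Linf_space \<nu>. \<forall>(e::nat \<Rightarrow> complex) (\<theta>::real) xhat.
             (let A = design_matrix F d m t;
                  x = coeffs_of F d f;
                  y = (\<lambda>k. mat_vec A \<Lambda> x k + e k);
                  f\<^sub>\<Lambda> = expansion F d \<Lambda> x;
                  ftilde = expansion F d \<Lambda> xhat;
                  C1 = (3 + \<rho>) / (1 - \<rho>);
                  C2 = ((1 + \<rho>) * \<theta> + 2 * \<tau>) / (1 - \<rho>);
                  C3 = 4 * (1 + \<rho>) * (2 + \<rho>) / (1 - \<rho>);
                  C4 = ((1 + \<rho>) * (2 + \<rho>) * \<theta> + (5 + \<rho>) * \<tau>) / (1 - \<rho>);
                  \<sigma> = lower_approx_error F d s x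
              in \<theta> \<ge> (5 + \<rho>) * \<tau> / ((1 + \<rho>) * (2 + \<rho>)) \<longrightarrow>
                 sr_lasso_minimizer F d m \<Lambda> A y (\<theta> * sqrt (max_lower_card F d s)) xhat \<longrightarrow>
                 Linf_norm \<nu> (\<lambda>p. f p - ftilde p)
                   \<le> ennreal C1 * \<sigma> + ennreal (C2 * real s powr (\<gamma> / 2) * l2_norm m e) \<and>
                 ennreal (L2_norm \<nu> (\<lambda>p. f p - ftilde p))
                   \<le> ennreal C3 * (\<sigma> / ennreal (real s powr (\<gamma> / 2)))
                      + ennreal (C4 * l2_norm m e)
                      + ennreal (L2_norm \<nu> (\<lambda>p. f p - f\<^sub>\<Lambda> p)))))))"
  apply (unfold Let_def)
  apply (intro exI[of _ "600000::real"] conjI allI impI)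
  subgoal by simp
  subgoal premises A for F d s m \<epsilon> \<delta>
  proof -
    let ?I = "hyperbolic_cross d s" and ?K = "max_lower_card F d s" and ?A = "design_matrix F d m"
    obtain E where E: "E \<in> sets (\<Pi>\<^sub>M k\<in>{..<m}. cube_measure F d)"
      "1 - \<epsilon> \<le> measure (\<Pi>\<^sub>M k\<in>{..<m}. cube_measure F d) E"
      and iso: "\<And>t z. t \<in> E \<Longrightarrow> (\<Sum>i\<in>?I. (cmod (z i))\<^sup>2)
         \<le> (1 + \<delta>) * (l2_norm m (mat_vec (?A t) ?I z))\<^sup>2 + \<delta>\<^sup>2 / ?K * (\<Sum>i\<in>?I. weight F d i * cmod (z i))\<^sup>2"
      using lower_isometry_event[OF A(1-6,8)] by blast
    show ?thesis
      apply (rule bexI[OF _ E(1)])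
      apply (rule conjI[OF E(2)])
      apply (intro ballI allI impI conjI)
      subgoal premises H for t f e \<theta> xhat
        by (rule recovery_bounds(1)[OF A(1,4-7) _ iso[OF H(1)] H(3,4)]) (use H(2) in blast)
      subgoal premises H for t f e \<theta> xhat
        by (rule recovery_bounds(2)[OF A(1,4-7) _ iso[OF H(1)] H(3,4)]) (use H(2) in blast)
      done
  qed
  done

end
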